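(* There exists a morphism $j:\Delta\to c\mathcal L_{\mathbb S}$, called the linearisation of $\Delta$ (with $j([n])=\Delta^n_k$), and it defines a Quillen adjunction $$j_!:\mathrm{Fun}(\Delta^{op},\mathbf{sSet})\rightleftharpoons \mathrm{Fun}^{\mathbb S}(c\mathcal L_{\mathbb S}^{op},\mathbf{sSet}):j^*$$ between the categories $\mathrm{Fun}^{\mathbb S}(c\mathcal L_{\mathbb S}^{op},\mathbf{sSet})$ and $\mathrm{Fun}(\Delta^{op},\mathbf{sSet})$ with their respective projective model structures.
   Context: $k$ is a fixed commutative ring; $\mathbf C(k)$ is the category of cochain complexes of $k$-modules. $\mathbf{dg\text{-}cat}$ is the category of dg-categories (categories enriched over $\mathbf C(k)$) with Tabuada's model structure: weak equivalences are the quasi-equivalences (quasi-isomorphisms on Hom complexes, essentially surjective on $H^0$-categories); fibrations are the dg-functors that are surjective on Hom complexes and lift homotopy equivalences $f(x)\to y'$ (closed degree $0$ morphisms invertible in $H^0$) to homotopy equivalences $x\to y$. A graph on $\mathbf C(k)$ is a set of objects with a complex $G(x,y)$ for each pair of objects; $L$ is the left adjoint to the forgetful functor from dg-categories to graphs. A dg-category $L(G)$ is free; it is of finite type if $G$ has finitely many objects and all $G(x,y)$ are perfect. $c\mathcal L$ is the full subcategory of $\mathbf{dg\text{-}cat}$ of cofibrant free dg-categories of finite type. $W$ is the class of quasi-equivalences, $L_W\mathbf{dg\text{-}cat}$ the (Dwyer–Kan) simplicial localization, and $c\mathcal L_{\mathbb S}$ its full simplicial subcategory on the objects of $c\mathcal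 L$. $\mathrm{Fun}^{\mathbb S}(-,\mathbf{sSet})$ denotes simplicial functors; projective model structures have objectwise weak equivalences and fibrations. $\Delta$ is the simplex category (viewed as a discrete simplicial category, so $\mathrm{Fun}(\Delta^{op},\mathbf{sSet})\simeq\mathrm{Fun}^{\mathbb S}(\Delta^{op},\mathbf{sSet})$). $\Delta^n_k$ is the free dg-category on the graph with objects $0,\dots,n$, complex $k$ (in degree $0$) from $i-1$ to $i$ and $0$ otherwise. $j^*$ is restriction along $j$ (the "delinearisation morphism") and $j_!$ its left adjoint. *)

theory Defs
  imports "HOL-Algebra.Module" "HOL-Homology.Simplices"
begin

section \<open>Categories, adjunctions and model-categorical notions\<close>

record ('o, 'a) cat =
  Ob :: "'o set"
  Hom :: "'o \<Rightarrow> 'o \<Rightarrow> 'a set"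
  Cmp :: "'o \<Rightarrow> 'o \<Rightarrow> 'o \<Rightarrow> 'a \<Rightarrow> 'a \<Rightarrow> 'a"
  Idn :: "'o \<Rightarrow> 'a"

text \<open>\<open>Cmp C x y z g f\<close> is the composite of \<open>f : x \<rightarrow> y\<close> and \<open>g : y \<rightarrow> z\<close>. Arrows do not carry
  their end points, which is why composition takes the three objects as arguments.\<close>

definition category :: "('o, 'a, 'e) cat_scheme \<Rightarrow> bool" where
  "category C \<longleftrightarrow>
    (\<forall>x\<in>Ob C. Idn C x \<in> Hom C x x) \<and>
    (\<forall>x\<in>Ob C. \<forall>y\<in>Ob C. \<forall>z\<in>Ob C. \<forall>f\<in>Hom C x y. \<forall>g\<in>Hom C y z. Cmp C x y z g f \<in> Hom C x z) \<and>
    (\<forall>x\<in>Ob C. \<forall>y\<in>Ob C. \<forall>f\<in>Hom C x y.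
      Cmp C x y y (Idn C y) f = f \<and> Cmp C x x y f (Idn C x) = f) \<and>
    (\<forall>w\<in>Ob C. \<forall>x\<in>Ob C. \<forall>y\<in>Ob C. \<forall>z\<in>Ob C. \<forall>f\<in>Hom C w x. \<forall>g\<in>Hom C x y. \<forall>h\<in>Hom C y z.
      Cmp C w y z h (Cmp C w x y g f) = Cmp C w x z (Cmp C x y z h g) f)"

record ('o, 'a, 'p, 'b) fctr =
  FOb :: "'o \<Rightarrow> 'p"
  FAr :: "'o \<Rightarrow> 'o \<Rightarrow> 'a \<Rightarrow> 'b"

definition is_functor ::
    "('o, 'a, 'e) cat_scheme \<Rightarrow> ('p, 'b, 'f) cat_scheme \<Rightarrow> ('o, 'a, 'p, 'b) fctr \<Rightarrow> bool" where
  "is_functor C D F \<longleftrightarrow> category C \<and> category D \<and>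
    (\<forall>x\<in>Ob C. FOb F x \<in> Ob D) \<and>
    (\<forall>x\<in>Ob C. \<forall>y\<in>Ob C. \<forall>f\<in>Hom C x y. FAr F x y f \<in> Hom D (FOb F x) (FOb F y)) \<and>
    (\<forall>x\<in>Ob C. FAr F x x (Idn C x) = Idn D (FOb F x)) \<and>
    (\<forall>x\<in>Ob C. \<forall>y\<in>Ob C. \<forall>z\<in>Ob C. \<forall>f\<in>Hom C x y. \<forall>g\<in>Hom C y z.
      FAr F x z (Cmp C x y z g f) =
      Cmp D (FOb F x) (FOb F y) (FOb F z) (FAr F y z g) (FAr F x y f))"

definition adjunction ::
    "('o, 'a, 'e) cat_scheme \<Rightarrow> ('p, 'b, 'f) cat_scheme \<Rightarrow>
     ('o, 'a, 'p, 'b) fctr \<Rightarrow> ('p, 'b, 'o, 'a) fctr \<Rightarrow> bool" where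
  "adjunction C D F U \<longleftrightarrow> is_functor C D F \<and> is_functor D C U \<and>
    (\<exists>\<phi>. (\<forall>x\<in>Ob C. \<forall>y\<in>Ob D. bij_betw (\<phi> x y) (Hom D (FOb F x) y) (Hom C x (FOb U y))) \<and>
      (\<forall>x\<in>Ob C. \<forall>x'\<in>Ob C. \<forall>y\<in>Ob D. \<forall>y'\<in>Ob D.
       \<forall>f\<in>Hom C x' x. \<forall>h\<in>Hom D (FOb F x) y. \<forall>g\<in>Hom D y y'.
        \<phi> x' y' (Cmp D (FOb F x') y y' g (Cmp D (FOb F x') (FOb F x) y h (FAr F x' x f))) =
        Cmp C x' (FOb U y) (FOb U y') (FAr U y y' g) (Cmp C x' x (FOb U y) (\<phi> x y h) f)))"

text \<open>A category with classes of weak equivalences and fibrations. In a model category these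
  determine the cofibrations, as the maps with the left lifting property against the trivial
  fibrations; this is how cofibrations are specified both for the projective model structures and
  for Tabuada's model structure.\<close>

record ('o, 'a) mcat = "('o, 'a) cat" +
  weq :: "'o \<Rightarrow> 'o \<Rightarrow> 'a \<Rightarrow> bool"
  fib :: "'o \<Rightarrow> 'o \<Rightarrow> 'a \<Rightarrow> bool"

definition trivial_fibration :: "('o, 'a) mcat \<Rightarrow> 'o \<Rightarrow> 'o \<Rightarrow> 'a \<Rightarrow> bool" where
  "trivial_fibration M x y p \<longleftrightarrow> fib M x y p \<and> weq M x y p"

definition cofibration :: "('o, 'a) mcat \<Rightarrow> 'o \<Rightarrow> 'o \<Rightarrow> 'a \<Rightarrow> bool" where
  "cofibration M x y i \<longleftrightarrow>
    (\<forall>a\<in>Ob M. \<forall>b\<in>Ob M. \<forall>p\<in>Hom M a b. trivial_fibration M a b p \<longrightarrow>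
      (\<forall>u\<in>Hom M x a. \<forall>v\<in>Hom M y b. Cmp M x a b p u = Cmp M x y b v i \<longrightarrow>
        (\<exists>h\<in>Hom M y a. Cmp M x y a h i = u \<and> Cmp M y a b p h = v)))"

definition initial :: "('o, 'a, 'e) cat_scheme \<Rightarrow> 'o \<Rightarrow> bool" where
  "initial C e \<longleftrightarrow> e \<in> Ob C \<and> (\<forall>y\<in>Ob C. \<exists>!f. f \<in> Hom C e y)"

definition cofibrant :: "('o, 'a) mcat \<Rightarrow> 'o \<Rightarrow> bool" where
  "cofibrant M x \<longleftrightarrow> x \<in> Ob M \<and>
    (\<exists>e i. initial M e \<and> i \<in> Hom M e x \<and> cofibration M e x i)"

text \<open>The right adjoint preserves fibrations and trivial fibrations, and the left adjoint preserves
  cofibrations. Between model categories this is any of the usual definitions of a Quillen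
  adjunction.\<close>

definition quillen_adjunction ::
    "('o, 'a) mcat \<Rightarrow> ('p, 'b) mcat \<Rightarrow>
     ('o, 'a, 'p, 'b) fctr \<Rightarrow> ('p, 'b, 'o, 'a) fctr \<Rightarrow> bool" where
  "quillen_adjunction M N F U \<longleftrightarrow> adjunction M N F U \<and>
    (\<forall>x\<in>Ob N. \<forall>y\<in>Ob N. \<forall>f\<in>Hom N x y. fib N x y f \<longrightarrow>
      fib M (FOb U x) (FOb U y) (FAr U x y f)) \<and>
    (\<forall>x\<in>Ob N. \<forall>y\<in>Ob N. \<forall>f\<in>Hom N x y. trivial_fibration N x y f \<longrightarrow>
      trivial_fibration M (FOb U x) (FOb U y) (FAr U x y f)) \<and>
    (\<forall>x\<in>Ob M. \<forall>y\<in>Ob M. \<forall>f\<in>Hom M x y. cofibration M x y f \<longrightarrow>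
      cofibration N (FOb F x) (FOb F y) (FAr F x y f))"


section \<open>Simplicial sets\<close>

definition dmap :: "nat \<Rightarrow> nat \<Rightarrow> (nat \<Rightarrow> nat) set" where
  "dmap m n = {\<theta> \<in> {..m} \<rightarrow>\<^sub>E {..n}. mono_on {..m} \<theta>}"

definition Delta :: "(nat, nat \<Rightarrow> nat) cat" where
  "Delta = \<lparr>Ob = UNIV, Hom = dmap, Cmp = (\<lambda>l m n \<theta> \<phi>. compose {..l} \<theta> \<phi>), Idn = (\<lambda>n. \<lambda>i\<in>{..n}. i)\<rparr>"

text \<open>\<open>sop X m n \<theta> : X\<^sub>n \<rightarrow> X\<^sub>m\<close> is the action of \<open>\<theta> \<in> dmap m n\<close>.\<close>

record 's sset =
  smp :: "nat \<Rightarrow> 's set"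
  sop :: "nat \<Rightarrow> nat \<Rightarrow> (nat \<Rightarrow> nat) \<Rightarrow> 's \<Rightarrow> 's"

definition is_sset :: "'s sset \<Rightarrow> bool" where
  "is_sset X \<longleftrightarrow>
    (\<forall>m n. \<forall>\<theta>\<in>dmap m n. \<forall>x\<in>smp X n. sop X m n \<theta> x \<in> smp X m) \<and>
    (\<forall>n. \<forall>x\<in>smp X n. sop X n n (\<lambda>i\<in>{..n}. i) x = x) \<and>
    (\<forall>l m n. \<forall>\<phi>\<in>dmap l m. \<forall>\<theta>\<in>dmap m n. \<forall>x\<in>smp X n.
      sop X l n (compose {..l} \<theta> \<phi>) x = sop X l m \<phi> (sop X m n \<theta> x))"

definition smap :: "'s sset \<Rightarrow> 't sset \<Rightarrow> (nat \<Rightarrow> 's \<Rightarrow> 't) set" where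
  "smap X Y = {f. (\<forall>n. f n \<in> smp X n \<rightarrow>\<^sub>E smp Y n) \<and>
    (\<forall>m n. \<forall>\<theta>\<in>dmap m n. \<forall>x\<in>smp X n. f m (sop X m n \<theta> x) = sop Y m n \<theta> (f n x))}"

definition std :: "nat \<Rightarrow> (nat \<Rightarrow> nat) sset" where
  "std n = \<lparr>smp = (\<lambda>m. dmap m n), sop = (\<lambda>l m \<phi> \<theta>. compose {..l} \<theta> \<phi>)\<rparr>"

definition horn :: "nat \<Rightarrow> nat \<Rightarrow> (nat \<Rightarrow> nat) sset" where
  "horn n k = (std n)\<lparr>smp := (\<lambda>m. {\<theta> \<in> dmap m n. \<exists>i\<le>n. i \<noteq> k \<and> i \<notin> \<theta> ` {..m}})\<rparr>"

definition sprod :: "'s sset \<Rightarrow> 't sset \<Rightarrow> ('s \<times> 't) sset" where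
  "sprod X Y = \<lparr>smp = (\<lambda>n. smp X n \<times> smp Y n),
    sop = (\<lambda>m n \<theta> (x, y). (sop X m n \<theta> x, sop Y m n \<theta> y))\<rparr>"

definition kan_fibration :: "'s sset \<Rightarrow> 't sset \<Rightarrow> (nat \<Rightarrow> 's \<Rightarrow> 't) \<Rightarrow> bool" where
  "kan_fibration X Y p \<longleftrightarrow>
    (\<forall>n\<ge>1. \<forall>k\<le>n. \<forall>u\<in>smap (horn n k) X. \<forall>v\<in>smap (std n) Y.
      (\<forall>m. \<forall>\<theta>\<in>smp (horn n k) m. p m (u m \<theta>) = v m \<theta>) \<longrightarrow>
      (\<exists>h\<in>smap (std n) X.
        (\<forall>m. \<forall>\<theta>\<in>smp (horn n k) m. h m \<theta> = u m \<theta>) \<and>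
        (\<forall>m. \<forall>\<theta>\<in>smp (std n) m. p m (h m \<theta>) = v m \<theta>)))"

text \<open>Geometric realisation: the quotient of the coproduct of the spaces \<open>X\<^sub>n \<times> |\<Delta>\<^sup>n|\<close> by
  \<open>(\<theta>\<^sup>* x, t) \<sim> (x, \<theta>\<^sub>* t)\<close>. Its points are equivalence classes of triples \<open>(n, x, t)\<close>.\<close>

definition push_simplex :: "nat \<Rightarrow> (nat \<Rightarrow> nat) \<Rightarrow> (nat \<Rightarrow> real) \<Rightarrow> nat \<Rightarrow> real" where
  "push_simplex m \<theta> t = (\<lambda>j. \<Sum>i\<in>{i\<in>{..m}. \<theta> i = j}. t i)"

inductive real_glue :: "'s sset \<Rightarrow> nat \<times> 's \<times> (nat \<Rightarrow> real) \<Rightarrow> nat \<times> 's \<times> (nat \<Rightarrow> real) \<Rightarrow> bool"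
  for X where
  "\<theta> \<in> dmap m n \<Longrightarrow> x \<in> smp X n \<Longrightarrow> t \<in> standard_simplex m \<Longrightarrow>
    real_glue X (m, sop X m n \<theta> x, t) (n, x, push_simplex m \<theta> t)"

definition real_class ::
    "'s sset \<Rightarrow> nat \<times> 's \<times> (nat \<Rightarrow> real) \<Rightarrow> (nat \<times> 's \<times> (nat \<Rightarrow> real)) set" where
  "real_class X p = {q. equivclp (real_glue X) p q}"

definition real_points :: "'s sset \<Rightarrow> (nat \<times> 's \<times> (nat \<Rightarrow> real)) set set" where
  "real_points X = {real_class X (n, x, t) |n x t. x \<in> smp X n \<and> t \<in> standard_simplex n}"

definition real_open :: "'s sset \<Rightarrow> (nat \<times> 's \<times> (nat \<Rightarrow> real)) set set \<Rightarrow> bool" where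
  "real_open X U \<longleftrightarrow> U \<subseteq> real_points X \<and>
    (\<forall>n. \<forall>x\<in>smp X n.
      openin (subtopology (powertop_real UNIV) (standard_simplex n))
        {t \<in> standard_simplex n. real_class X (n, x, t) \<in> U})"

lemma istopology_real_open: "istopology (real_open X)"
proof -
  have "real_open X (S \<inter> T)" if "real_open X S" "real_open X T" for S T
  proof -
    have "{t \<in> standard_simplex n. real_class X (n, x, t) \<in> S \<inter> T} =
        {t \<in> standard_simplex n. real_class X (n, x, t) \<in> S} \<inter>
        {t \<in> standard_simplex n. real_class X (n, x, t) \<in> T}" for n x
      by auto
    then show ?thesis
      using that by (auto simp: real_open_def)
  qed
  moreover have "real_open X (\<Union>\<K>)" if "\<forall>K\<in>\<K>. real_open X K" for \<K>
  proof -
    have "{t \<in> standard_simplex n. real_class X (n, x, t) \<in> \<Union>\<K>} =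
        (\<Union>K\<in>\<K>. {t \<in> standard_simplex n. real_class X (n, x, t) \<in> K})" for n x
      by auto
    then show ?thesis
      using that by (auto simp: real_open_def)
  qed
  ultimately show ?thesis
    unfolding istopology_def by blast
qed

definition realisation :: "'s sset \<Rightarrow> (nat \<times> 's \<times> (nat \<Rightarrow> real)) set topology" where
  "realisation X = topology (real_open X)"

definition real_map ::
    "'t sset \<Rightarrow> (nat \<Rightarrow> 's \<Rightarrow> 't) \<Rightarrow>
     (nat \<times> 's \<times> (nat \<Rightarrow> real)) set \<Rightarrow> (nat \<times> 't \<times> (nat \<Rightarrow> real)) set" where
  "real_map Y f c = (\<Union>(n, x, t)\<in>c. real_class Y (n, f n x, t))"

definition homotopy_equivalence_map ::
    "'a topology \<Rightarrow> 'b topology \<Rightarrow> ('a \<Rightarrow> 'b) \<Rightarrow> bool" where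
  "homotopy_equivalence_map X Y f \<longleftrightarrow> continuous_map X Y f \<and>
    (\<exists>g. continuous_map Y X g \<and>
      homotopic_with (\<lambda>_. True) X X (g \<circ> f) id \<and> homotopic_with (\<lambda>_. True) Y Y (f \<circ> g) id)"

text \<open>Realisations are CW complexes, so homotopy equivalences and weak homotopy equivalences
  between them agree.\<close>

definition weak_equivalence :: "'s sset \<Rightarrow> 't sset \<Rightarrow> (nat \<Rightarrow> 's \<Rightarrow> 't) \<Rightarrow> bool" where
  "weak_equivalence X Y f \<longleftrightarrow>
    homotopy_equivalence_map (realisation X) (realisation Y) (real_map Y f)"


section \<open>Simplicial categories and simplicial functors\<close>

text \<open>\<open>SCmp A x y z n g f\<close> composes \<open>n\<close>-simplices; \<open>SId A x\<close> is a vertex.\<close>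

record ('o, 's) scat =
  SOb :: "'o set"
  SHom :: "'o \<Rightarrow> 'o \<Rightarrow> 's sset"
  SCmp :: "'o \<Rightarrow> 'o \<Rightarrow> 'o \<Rightarrow> nat \<Rightarrow> 's \<Rightarrow> 's \<Rightarrow> 's"
  SId :: "'o \<Rightarrow> 's"

definition degen :: "'s sset \<Rightarrow> nat \<Rightarrow> 's \<Rightarrow> 's" where
  "degen X n v = sop X n 0 (\<lambda>i\<in>{..n}. 0) v"

definition simplicial_category :: "('o, 's) scat \<Rightarrow> bool" where
  "simplicial_category A \<longleftrightarrow>
    (\<forall>x\<in>SOb A. \<forall>y\<in>SOb A. is_sset (SHom A x y)) \<and>
    (\<forall>x\<in>SOb A. SId A x \<in> smp (SHom A x x) 0) \<and>
    (\<forall>x\<in>SOb A. \<forall>y\<in>SOb A. \<forall>z\<in>SOb A. \<forall>n. \<forall>f\<in>smp (SHom A x y) n. \<forall>g\<in>smp (SHom A y z) n.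
      SCmp A x y z n g f \<in> smp (SHom A x z) n \<and>
      (\<forall>m. \<forall>\<theta>\<in>dmap m n. sop (SHom A x z) m n \<theta> (SCmp A x y z n g f) =
        SCmp A x y z m (sop (SHom A y z) m n \<theta> g) (sop (SHom A x y) m n \<theta> f))) \<and>
    (\<forall>x\<in>SOb A. \<forall>y\<in>SOb A. \<forall>n. \<forall>f\<in>smp (SHom A x y) n.
      SCmp A x y y n (degen (SHom A y y) n (SId A y)) f = f \<and>
      SCmp A x x y n f (degen (SHom A x x) n (SId A x)) = f) \<and>
    (\<forall>w\<in>SOb A. \<forall>x\<in>SOb A. \<forall>y\<in>SOb A. \<forall>z\<in>SOb A. \<forall>n.
     \<forall>f\<in>smp (SHom A w x) n. \<forall>g\<in>smp (SHom A x y) n. \<forall>h\<in>smp (SHom A y z) n.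
      SCmp A w y z n h (SCmp A w x y n g f) = SCmp A w x z n (SCmp A x y z n h g) f)"

definition discrete :: "('o, 'a, 'e) cat_scheme \<Rightarrow> ('o, 'a) scat" where
  "discrete C = \<lparr>SOb = Ob C, SHom = (\<lambda>x y. \<lparr>smp = (\<lambda>_. Hom C x y), sop = (\<lambda>_ _ _ f. f)\<rparr>),
    SCmp = (\<lambda>x y z n g f. Cmp C x y z g f), SId = Idn C\<rparr>"

definition opposite :: "('o, 's) scat \<Rightarrow> ('o, 's) scat" where
  "opposite A = \<lparr>SOb = SOb A, SHom = (\<lambda>x y. SHom A y x),
    SCmp = (\<lambda>x y z n g f. SCmp A z y x n f g), SId = SId A\<rparr>"

definition full_sub :: "('o, 's) scat \<Rightarrow> 'o set \<Rightarrow> ('o, 's) scat" where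
  "full_sub A S = A\<lparr>SOb := S\<rparr>"

record ('o, 's, 'p, 't) sfun =
  SFOb :: "'o \<Rightarrow> 'p"
  SFAr :: "'o \<Rightarrow> 'o \<Rightarrow> nat \<Rightarrow> 's \<Rightarrow> 't"

definition simplicial_functor ::
    "('o, 's) scat \<Rightarrow> ('p, 't) scat \<Rightarrow> ('o, 's, 'p, 't) sfun \<Rightarrow> bool" where
  "simplicial_functor A B F \<longleftrightarrow> simplicial_category A \<and> simplicial_category B \<and>
    (\<forall>x\<in>SOb A. SFOb F x \<in> SOb B) \<and>
    (\<forall>x\<in>SOb A. \<forall>y\<in>SOb A. \<forall>n. \<forall>f\<in>smp (SHom A x y) n.
      SFAr F x y n f \<in> smp (SHom B (SFOb F x) (SFOb F y)) n \<and>
      (\<forall>m. \<forall>\<theta>\<in>dmap m n. SFAr F x y m (sop (SHom A x y) m n \<theta> f) =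
        sop (SHom B (SFOb F x) (SFOb F y)) m n \<theta> (SFAr F x y n f))) \<and>
    (\<forall>x\<in>SOb A. SFAr F x x 0 (SId A x) = SId B (SFOb F x)) \<and>
    (\<forall>x\<in>SOb A. \<forall>y\<in>SOb A. \<forall>z\<in>SOb A. \<forall>n. \<forall>f\<in>smp (SHom A x y) n. \<forall>g\<in>smp (SHom A y z) n.
      SFAr F x z n (SCmp A x y z n g f) =
      SCmp B (SFOb F x) (SFOb F y) (SFOb F z) n (SFAr F y z n g) (SFAr F x y n f))"

definition simplicial_nat ::
    "('o, 's) scat \<Rightarrow> ('p, 't) scat \<Rightarrow> ('o, 's, 'p, 't) sfun \<Rightarrow> ('o, 's, 'p, 't) sfun \<Rightarrow>
     ('o \<Rightarrow> 't) set" where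
  "simplicial_nat A B F G =
    {t \<in> (\<Pi>\<^sub>E a\<in>SOb A. smp (SHom B (SFOb F a) (SFOb G a)) 0).
      \<forall>a\<in>SOb A. \<forall>b\<in>SOb A. \<forall>n. \<forall>f\<in>smp (SHom A a b) n.
        SCmp B (SFOb F a) (SFOb G a) (SFOb G b) n
          (SFAr G a b n f) (degen (SHom B (SFOb F a) (SFOb G a)) n (t a)) =
        SCmp B (SFOb F a) (SFOb F b) (SFOb G b) n
          (degen (SHom B (SFOb F b) (SFOb G b)) n (t b)) (SFAr F a b n f)}"

definition FunS ::
    "('o, 's) scat \<Rightarrow> ('p, 't) scat \<Rightarrow> (('o, 's, 'p, 't) sfun, 'o \<Rightarrow> 't) cat" where
  "FunS A B = \<lparr>Ob = {F. simplicial_functor A B F}, Hom = simplicial_nat A B,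
    Cmp = (\<lambda>F G H s t. \<lambda>a\<in>SOb A. SCmp B (SFOb F a) (SFOb G a) (SFOb H a) 0 (s a) (t a)),
    Idn = (\<lambda>F. \<lambda>a\<in>SOb A. SId B (SFOb F a))\<rparr>"

text \<open>The simplicial category of simplicial sets with simplices in the type \<open>'v\<close>: the
  \<open>n\<close>-simplices of the mapping space from \<open>X\<close> to \<open>Y\<close> are the maps \<open>X \<times> \<Delta>[n] \<rightarrow> Y\<close>.\<close>

type_synonym 'v msimp = "nat \<Rightarrow> 'v \<times> (nat \<Rightarrow> nat) \<Rightarrow> 'v"

definition mapping_space :: "'v sset \<Rightarrow> 'v sset \<Rightarrow> 'v msimp sset" where
  "mapping_space X Y = \<lparr>smp = (\<lambda>n. smap (sprod X (std n)) Y),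
    sop = (\<lambda>m n \<theta> f p. \<lambda>(x, \<phi>)\<in>smp (sprod X (std m)) p. f p (x, compose {..p} \<theta> \<phi>))\<rparr>"

definition sSet :: "'v itself \<Rightarrow> ('v sset, 'v msimp) scat" where
  "sSet _ = \<lparr>SOb = {X. is_sset X}, SHom = mapping_space,
    SCmp = (\<lambda>X Y Z n g f p. \<lambda>(x, \<phi>)\<in>smp (sprod X (std n)) p. g p (f p (x, \<phi>), \<phi>)),
    SId = (\<lambda>X p. \<lambda>(x, \<phi>)\<in>smp (sprod X (std 0)) p. x)\<rparr>"

definition underlying_map :: "'v sset \<Rightarrow> 'v msimp \<Rightarrow> nat \<Rightarrow> 'v \<Rightarrow> 'v" where
  "underlying_map X t = (\<lambda>p. \<lambda>x\<in>smp X p. t p (x, \<lambda>i\<in>{..p}. 0))"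

text \<open>\<open>Fun\<^sup>S(A\<^sup>o\<^sup>p, sSet)\<close> with the projective model structure.\<close>

definition presheaves ::
    "'v itself \<Rightarrow> ('o, 's) scat \<Rightarrow> (('o, 's, 'v sset, 'v msimp) sfun, 'o \<Rightarrow> 'v msimp) mcat" where
  "presheaves T A = cat.extend (FunS (opposite A) (sSet T))
    \<lparr>weq = (\<lambda>F G t. \<forall>a\<in>SOb A.
        weak_equivalence (SFOb F a) (SFOb G a) (underlying_map (SFOb F a) (t a))),
     fib = (\<lambda>F G t. \<forall>a\<in>SOb A.
        kan_fibration (SFOb F a) (SFOb G a) (underlying_map (SFOb F a) (t a)))\<rparr>"

text \<open>Restriction of presheaves along a simplicial functor \<open>j : A \<rightarrow> B\<close>.\<close>

definition restriction ::
    "('o, 's) scat \<Rightarrow> ('o, 's, 'p, 't) sfun \<Rightarrow>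
     (('p, 't, 'v sset, 'v msimp) sfun, 'p \<Rightarrow> 'v msimp,
      ('o, 's, 'v sset, 'v msimp) sfun, 'o \<Rightarrow> 'v msimp) fctr" where
  "restriction A j = \<lparr>
    FOb = (\<lambda>F. \<lparr>SFOb = (\<lambda>a. SFOb F (SFOb j a)),
      SFAr = (\<lambda>a b n f. SFAr F (SFOb j a) (SFOb j b) n (SFAr j b a n f))\<rparr>),
    FAr = (\<lambda>F G t. \<lambda>a\<in>SOb A. t (SFOb j a))\<rparr>"

text \<open>A simplicial category is small with respect to the universe \<open>'v\<close> of simplicial sets if its
  objects and the simplices of its mapping spaces can be encoded in \<open>'v\<close>.\<close>

definition small_scat :: "'v itself \<Rightarrow> ('o, 's) scat \<Rightarrow> bool" where
  "small_scat _ A \<longleftrightarrow> infinite (UNIV :: 'v set) \<and>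
    (\<exists>\<iota> :: 'o \<Rightarrow> 'v. inj_on \<iota> (SOb A)) \<and>
    (\<exists>\<iota> :: 's \<Rightarrow> 'v. inj_on \<iota> (\<Union>x\<in>SOb A. \<Union>y\<in>SOb A. \<Union>n. smp (SHom A x y) n))"


section \<open>Simplicial localisation\<close>

text \<open>The hammock localisation of Dwyer and Kan. A hammock of width \<open>k\<close> from \<open>x\<close> to \<open>y\<close> is a
  zigzag whose columns are chains \<open>A\<^sub>0 \<rightarrow> \<dots> \<rightarrow> A\<^sub>k\<close> in \<open>W\<close>, the outer columns being constant at \<open>x\<close>
  and \<open>y\<close>, and whose horizontal arrows are natural transformations between chains, with components
  in \<open>W\<close> when they point backwards. Hammocks are taken modulo the reductions which omit a column
  of identities and compose adjacent columns of arrows with the same direction; every class contains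
  exactly one reduced hammock.\<close>

type_synonym ('o, 'a) chain = "(nat \<Rightarrow> 'o) \<times> (nat \<times> nat \<Rightarrow> 'a)"
type_synonym ('o, 'a) zigzag = "(bool \<times> 'o \<times> 'a) list"

definition chain_cat ::
    "('o, 'a, 'e) cat_scheme \<Rightarrow> ('o \<Rightarrow> 'o \<Rightarrow> 'a \<Rightarrow> bool) \<Rightarrow> nat \<Rightarrow> (('o, 'a) chain, nat \<Rightarrow> 'a) cat" where
  "chain_cat C W k = \<lparr>
    Ob = {(A, a). A \<in> {..k} \<rightarrow>\<^sub>E Ob C \<and>
      a \<in> (\<Pi>\<^sub>E (i, j)\<in>{(i, j). i \<le> j \<and> j \<le> k}. {f \<in> Hom C (A i) (A j). W (A i) (A j) f}) \<and>
      (\<forall>i\<le>k. a (i, i) = Idn C (A i)) \<and>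
      (\<forall>i j l. i \<le> j \<longrightarrow> j \<le> l \<longrightarrow> l \<le> k \<longrightarrow> Cmp C (A i) (A j) (A l) (a (j, l)) (a (i, j)) = a (i, l))},
    Hom = (\<lambda>(A, a) (B, b). {h \<in> (\<Pi>\<^sub>E i\<in>{..k}. Hom C (A i) (B i)).
      \<forall>i j. i \<le> j \<longrightarrow> j \<le> k \<longrightarrow>
        Cmp C (A i) (B i) (B j) (b (i, j)) (h i) = Cmp C (A i) (A j) (B j) (h j) (a (i, j))}),
    Cmp = (\<lambda>(A, _) (B, _) (D, _) g f. \<lambda>i\<in>{..k}. Cmp C (A i) (B i) (D i) (g i) (f i)),
    Idn = (\<lambda>(A, _). \<lambda>i\<in>{..k}. Idn C (A i))\<rparr>"

definition chain_weq ::
    "('o \<Rightarrow> 'o \<Rightarrow> 'a \<Rightarrow> bool) \<Rightarrow> nat \<Rightarrow> ('o, 'a) chain \<Rightarrow> ('o, 'a) chain \<Rightarrow> (nat \<Rightarrow> 'a) \<Rightarrow> bool" where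
  "chain_weq W k X Y h \<longleftrightarrow> (\<forall>i\<le>k. W (fst X i) (fst Y i) (h i))"

definition const_chain :: "('o, 'a, 'e) cat_scheme \<Rightarrow> nat \<Rightarrow> 'o \<Rightarrow> ('o, 'a) chain" where
  "const_chain C k x = (\<lambda>i\<in>{..k}. x, \<lambda>(i, j)\<in>{(i, j). i \<le> j \<and> j \<le> k}. Idn C x)"

definition pull_chain :: "nat \<Rightarrow> (nat \<Rightarrow> nat) \<Rightarrow> ('o, 'a) chain \<Rightarrow> ('o, 'a) chain" where
  "pull_chain m \<theta> = (\<lambda>(A, a).
    (\<lambda>i\<in>{..m}. A (\<theta> i), \<lambda>(i, j)\<in>{(i, j). i \<le> j \<and> j \<le> m}. a (\<theta> i, \<theta> j)))"

text \<open>A step \<open>(True, z, f)\<close> is an arrow \<open>f\<close> to the next object \<open>z\<close>; a step \<open>(False, z, f)\<close> is an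
  arrow \<open>f\<close> of \<open>W\<close> from the next object \<open>z\<close>.\<close>

fun is_zigzag ::
    "('o, 'a, 'e) cat_scheme \<Rightarrow> ('o \<Rightarrow> 'o \<Rightarrow> 'a \<Rightarrow> bool) \<Rightarrow> 'o \<Rightarrow> ('o, 'a) zigzag \<Rightarrow> 'o \<Rightarrow> bool" where
  "is_zigzag C W x [] y \<longleftrightarrow> x \<in> Ob C \<and> x = y"
| "is_zigzag C W x ((b, z, f) # s) y \<longleftrightarrow> x \<in> Ob C \<and>
    (if b then f \<in> Hom C x z else f \<in> Hom C z x \<and> W z x f) \<and> is_zigzag C W z s y"

inductive reduces ::
    "('o, 'a, 'e) cat_scheme \<Rightarrow> ('o \<Rightarrow> 'o \<Rightarrow> 'a \<Rightarrow> bool) \<Rightarrow> 'o \<Rightarrow> 'o \<Rightarrow>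
     ('o, 'a) zigzag \<Rightarrow> ('o, 'a) zigzag \<Rightarrow> bool"
  for C W x y where
  omit: "is_zigzag C W x p z \<Longrightarrow> is_zigzag C W z ((b, z, Idn C z) # q) y \<Longrightarrow>
    reduces C W x y (p @ (b, z, Idn C z) # q) (p @ q)"
| forward: "is_zigzag C W x p u \<Longrightarrow> is_zigzag C W u ((True, v, f) # (True, z, g) # q) y \<Longrightarrow>
    reduces C W x y (p @ (True, v, f) # (True, z, g) # q) (p @ (True, z, Cmp C u v z g f) # q)"
| backward: "is_zigzag C W x p u \<Longrightarrow> is_zigzag C W u ((False, v, f) # (False, z, g) # q) y \<Longrightarrow>
    reduces C W x y (p @ (False, v, f) # (False, z, g) # q) (p @ (False, z, Cmp C z v u f g) # q)"

definition hammock_class ::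
    "('o, 'a, 'e) cat_scheme \<Rightarrow> ('o \<Rightarrow> 'o \<Rightarrow> 'a \<Rightarrow> bool) \<Rightarrow> nat \<Rightarrow> 'o \<Rightarrow> 'o \<Rightarrow>
     (('o, 'a) chain, nat \<Rightarrow> 'a) zigzag \<Rightarrow> (('o, 'a) chain, nat \<Rightarrow> 'a) zigzag set" where
  "hammock_class C W k x y s =
    {t. equivclp
      (reduces (chain_cat C W k) (chain_weq W k) (const_chain C k x) (const_chain C k y)) s t}"

type_synonym ('o, 'a) hammock = "(('o, 'a) chain, nat \<Rightarrow> 'a) zigzag set"

definition hammock_space ::
    "('o, 'a, 'e) cat_scheme \<Rightarrow> ('o \<Rightarrow> 'o \<Rightarrow> 'a \<Rightarrow> bool) \<Rightarrow> 'o \<Rightarrow> 'o \<Rightarrow> ('o, 'a) hammock sset" where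
  "hammock_space C W x y = \<lparr>
    smp = (\<lambda>k. {hammock_class C W k x y s |s.
      is_zigzag (chain_cat C W k) (chain_weq W k) (const_chain C k x) s (const_chain C k y)}),
    sop = (\<lambda>m k \<theta> c. \<Union>s\<in>c. hammock_class C W m x y
      (map (\<lambda>(b, Z, h). (b, pull_chain m \<theta> Z, \<lambda>i\<in>{..m}. h (\<theta> i))) s))\<rparr>"

definition hammock_localisation ::
    "('o, 'a, 'e) cat_scheme \<Rightarrow> ('o \<Rightarrow> 'o \<Rightarrow> 'a \<Rightarrow> bool) \<Rightarrow> ('o, ('o, 'a) hammock) scat" where
  "hammock_localisation C W = \<lparr>SOb = Ob C, SHom = hammock_space C W,
    SCmp = (\<lambda>x y z k d c. \<Union>s\<in>c. \<Union>t\<in>d. hammock_class C W k x z (s @ t)),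
    SId = (\<lambda>x. hammock_class C W 0 x x [])\<rparr>"

text \<open>The vertex of the mapping space from \<open>x\<close> to \<open>y\<close> given by an arrow of \<open>C\<close>.\<close>

definition localise ::
    "('o, 'a, 'e) cat_scheme \<Rightarrow> ('o \<Rightarrow> 'o \<Rightarrow> 'a \<Rightarrow> bool) \<Rightarrow> 'o \<Rightarrow> 'o \<Rightarrow> 'a \<Rightarrow> ('o, 'a) hammock" where
  "localise C W x y f = hammock_class C W 0 x y [(True, const_chain C 0 y, \<lambda>i\<in>{..0}. f)]"


section \<open>Complexes, graphs and dg-categories\<close>

text \<open>Modules are the library's. Their type extends that of rings; the fields \<open>mult\<close> and \<open>one\<close>
  are not used. \<open>cdf X n\<close> is the differential from degree \<open>n\<close> to degree \<open>n + 1\<close>. Linear maps are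
  extensional functions, so that maps of complexes, graphs and dg-categories are equal as soon as
  they agree where they are defined.\<close>

definition linear_maps ::
    "('k, 'r) ring_scheme \<Rightarrow> ('k, 'm) module \<Rightarrow> ('k, 'n) module \<Rightarrow> ('m \<Rightarrow> 'n) set" where
  "linear_maps K M N = {f \<in> carrier M \<rightarrow>\<^sub>E carrier N.
    (\<forall>x\<in>carrier M. \<forall>y\<in>carrier M. f (x \<oplus>\<^bsub>M\<^esub> y) = f x \<oplus>\<^bsub>N\<^esub> f y) \<and>
    (\<forall>r\<in>carrier K. \<forall>x\<in>carrier M. f (r \<odot>\<^bsub>M\<^esub> x) = r \<odot>\<^bsub>N\<^esub> f x)}"

record ('k, 'm) cpx =
  cmd :: "int \<Rightarrow> ('k, 'm) module"
  cdf :: "int \<Rightarrow> 'm \<Rightarrow> 'm"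

definition is_complex :: "'k ring \<Rightarrow> ('k, 'm) cpx \<Rightarrow> bool" where
  "is_complex K X \<longleftrightarrow> (\<forall>n. Module.module K (cmd X n)) \<and>
    (\<forall>n. restrict (cdf X n) (carrier (cmd X n)) \<in> linear_maps K (cmd X n) (cmd X (n + 1))) \<and>
    (\<forall>n. \<forall>x\<in>carrier (cmd X n). cdf X (n + 1) (cdf X n x) = \<zero>\<^bsub>cmd X (n + 1 + 1)\<^esub>)"

definition chain_maps ::
    "'k ring \<Rightarrow> ('k, 'm) cpx \<Rightarrow> ('k, 'n) cpx \<Rightarrow> (int \<Rightarrow> 'm \<Rightarrow> 'n) set" where
  "chain_maps K X Y = {f. (\<forall>n. f n \<in> linear_maps K (cmd X n) (cmd Y n)) \<and>
    (\<forall>n. \<forall>x\<in>carrier (cmd X n). f (n + 1) (cdf X n x) = cdf Y n (f n x))}"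

definition cocycles :: "('k, 'm) cpx \<Rightarrow> int \<Rightarrow> 'm set" where
  "cocycles X n = {x \<in> carrier (cmd X n). cdf X n x = \<zero>\<^bsub>cmd X (n + 1)\<^esub>}"

definition coboundaries :: "('k, 'm) cpx \<Rightarrow> int \<Rightarrow> 'm set" where
  "coboundaries X n = cdf X (n - 1) ` carrier (cmd X (n - 1))"

text \<open>Injectivity and surjectivity of the map induced on cohomology.\<close>

definition quasi_iso :: "('k, 'm) cpx \<Rightarrow> ('k, 'n) cpx \<Rightarrow> (int \<Rightarrow> 'm \<Rightarrow> 'n) \<Rightarrow> bool" where
  "quasi_iso X Y f \<longleftrightarrow> (\<forall>n.
    (\<forall>x\<in>cocycles X n. f n x \<in> coboundaries Y n \<longrightarrow> x \<in> coboundaries X n) \<and>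
    (\<forall>y\<in>cocycles Y n. \<exists>x\<in>cocycles X n. y \<ominus>\<^bsub>cmd Y n\<^esub> f n x \<in> coboundaries Y n))"

definition free_module :: "'k ring \<Rightarrow> nat \<Rightarrow> ('k, nat \<Rightarrow> 'k) module" where
  "free_module K n = \<lparr>carrier = {..<n} \<rightarrow>\<^sub>E carrier K, mult = undefined, one = undefined,
    ring.zero = (\<lambda>i\<in>{..<n}. \<zero>\<^bsub>K\<^esub>), add = (\<lambda>x y. \<lambda>i\<in>{..<n}. x i \<oplus>\<^bsub>K\<^esub> y i),
    smult = (\<lambda>r x. \<lambda>i\<in>{..<n}. r \<otimes>\<^bsub>K\<^esub> x i)\<rparr>"

text \<open>Finitely generated projective modules: the direct summands of finite free modules.\<close>

definition fg_projective :: "'k ring \<Rightarrow> ('k, 'm) module \<Rightarrow> bool" where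
  "fg_projective K P \<longleftrightarrow> Module.module K P \<and>
    (\<exists>n. \<exists>i\<in>linear_maps K P (free_module K n). \<exists>r\<in>linear_maps K (free_module K n) P.
      \<forall>x\<in>carrier P. r (i x) = x)"

text \<open>A complex is perfect if it is quasi-isomorphic to a bounded complex of finitely generated
  projective modules. Such modules are, up to isomorphism, submodules of some \<open>K\<^sup>n\<close>, so it suffices
  to let \<open>P\<close> range over complexes with elements in \<open>nat \<Rightarrow> 'k\<close>; and \<open>P\<close> being bounded and
  projective, an isomorphism with it in the derived category is induced by a quasi-isomorphism
  from \<open>P\<close>.\<close>

definition perfect :: "'k ring \<Rightarrow> ('k, 'm) cpx \<Rightarrow> bool" where
  "perfect K X \<longleftrightarrow> is_complex K X \<and>
    (\<exists>P :: ('k, nat \<Rightarrow> 'k) cpx. is_complex K P \<and> (\<forall>n. fg_projective K (cmd P n)) \<and>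
      finite {n. carrier (cmd P n) \<noteq> {\<zero>\<^bsub>cmd P n\<^esub>}} \<and>
      (\<exists>f\<in>chain_maps K P X. quasi_iso P X f))"

record ('k, 'o, 'm) graph =
  gob :: "'o set"
  ghom :: "'o \<Rightarrow> 'o \<Rightarrow> ('k, 'm) cpx"

text \<open>\<open>dcmp C x y z q p g f\<close> is the composite of \<open>f\<close> of degree \<open>p\<close> from \<open>x\<close> to \<open>y\<close> and \<open>g\<close> of
  degree \<open>q\<close> from \<open>y\<close> to \<open>z\<close>. The forgetful functor from dg-categories to graphs is the record
  inclusion.\<close>

record ('k, 'o, 'm) dgcat = "('k, 'o, 'm) graph" +
  dcmp :: "'o \<Rightarrow> 'o \<Rightarrow> 'o \<Rightarrow> int \<Rightarrow> int \<Rightarrow> 'm \<Rightarrow> 'm \<Rightarrow> 'm"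
  did :: "'o \<Rightarrow> 'm"

abbreviation hm :: "('k, 'o, 'm, 'e) graph_scheme \<Rightarrow> 'o \<Rightarrow> 'o \<Rightarrow> int \<Rightarrow> ('k, 'm) module" where
  "hm G x y n \<equiv> cmd (ghom G x y) n"

definition is_graph :: "'k ring \<Rightarrow> ('k, 'o, 'm, 'e) graph_scheme \<Rightarrow> bool" where
  "is_graph K G \<longleftrightarrow> (\<forall>x\<in>gob G. \<forall>y\<in>gob G. is_complex K (ghom G x y))"

definition is_dgcat :: "'k ring \<Rightarrow> ('k, 'o, 'm) dgcat \<Rightarrow> bool" where
  "is_dgcat K C \<longleftrightarrow> is_graph K C \<and>
    (\<forall>x\<in>gob C. did C x \<in> cocycles (ghom C x x) 0) \<and>
    (\<forall>x\<in>gob C. \<forall>y\<in>gob C. \<forall>z\<in>gob C. \<forall>q p.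
      (\<forall>f\<in>carrier (hm C x y p).
        restrict (\<lambda>g. dcmp C x y z q p g f) (carrier (hm C y z q))
          \<in> linear_maps K (hm C y z q) (hm C x z (q + p))) \<and>
      (\<forall>g\<in>carrier (hm C y z q).
        restrict (\<lambda>f. dcmp C x y z q p g f) (carrier (hm C x y p))
          \<in> linear_maps K (hm C x y p) (hm C x z (q + p))) \<and>
      (\<forall>g\<in>carrier (hm C y z q). \<forall>f\<in>carrier (hm C x y p).
        cdf (ghom C x z) (q + p) (dcmp C x y z q p g f) =
        dcmp C x y z (q + 1) p (cdf (ghom C y z) q g) f \<oplus>\<^bsub>hm C x z (q + p + 1)\<^esub>
        (let h = dcmp C x y z q (p + 1) g (cdf (ghom C x y) p f)
         in if even q then h else \<ominus>\<^bsub>hm C x z (q + p + 1)\<^esub> h))) \<and>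
    (\<forall>x\<in>gob C. \<forall>y\<in>gob C. \<forall>p. \<forall>f\<in>carrier (hm C x y p).
      dcmp C x y y 0 p (did C y) f = f \<and> dcmp C x x y p 0 f (did C x) = f) \<and>
    (\<forall>w\<in>gob C. \<forall>x\<in>gob C. \<forall>y\<in>gob C. \<forall>z\<in>gob C. \<forall>r q p.
     \<forall>f\<in>carrier (hm C w x p). \<forall>g\<in>carrier (hm C x y q). \<forall>h\<in>carrier (hm C y z r).
      dcmp C w y z r (q + p) h (dcmp C w x y q p g f) =
      dcmp C w x z (r + q) p (dcmp C x y z r q h g) f)"

type_synonym ('a, 'b, 'o, 'm) gmap = "('a \<Rightarrow> 'o) \<times> ('a \<Rightarrow> 'a \<Rightarrow> int \<Rightarrow> 'b \<Rightarrow> 'm)"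

definition graph_maps ::
    "'k ring \<Rightarrow> ('k, 'a, 'b, 'e) graph_scheme \<Rightarrow> ('k, 'o, 'm, 'f) graph_scheme \<Rightarrow>
     ('a, 'b, 'o, 'm) gmap set" where
  "graph_maps K G H = {(fo, fm). fo \<in> gob G \<rightarrow>\<^sub>E gob H \<and>
    (\<forall>x\<in>gob G. \<forall>y\<in>gob G. fm x y \<in> chain_maps K (ghom G x y) (ghom H (fo x) (fo y))) \<and>
    (\<forall>x y. \<not> (x \<in> gob G \<and> y \<in> gob G) \<longrightarrow> fm x y = (\<lambda>_ _. undefined))}"

definition gmap_comp ::
    "('k, 'a, 'b, 'e) graph_scheme \<Rightarrow> ('c, 'd, 'o, 'm) gmap \<Rightarrow> ('a, 'b, 'c, 'd) gmap \<Rightarrow>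
     ('a, 'b, 'o, 'm) gmap" where
  "gmap_comp G g f =
    (\<lambda>x\<in>gob G. fst g (fst f x),
     \<lambda>x y n. if x \<in> gob G \<and> y \<in> gob G
       then \<lambda>v\<in>carrier (hm G x y n). snd g (fst f x) (fst f y) n (snd f x y n v)
       else (\<lambda>_. undefined))"

definition gmap_id :: "('k, 'a, 'b, 'e) graph_scheme \<Rightarrow> ('a, 'b, 'a, 'b) gmap" where
  "gmap_id G =
    (\<lambda>x\<in>gob G. x,
     \<lambda>x y n. if x \<in> gob G \<and> y \<in> gob G then \<lambda>v\<in>carrier (hm G x y n). v else (\<lambda>_. undefined))"

definition dg_functors ::
    "'k ring \<Rightarrow> ('k, 'a, 'b) dgcat \<Rightarrow> ('k, 'o, 'm) dgcat \<Rightarrow> ('a, 'b, 'o, 'm) gmap set" where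
  "dg_functors K C D = {(fo, fm) \<in> graph_maps K C D.
    (\<forall>x\<in>gob C. fm x x 0 (did C x) = did D (fo x)) \<and>
    (\<forall>x\<in>gob C. \<forall>y\<in>gob C. \<forall>z\<in>gob C. \<forall>q p.
     \<forall>g\<in>carrier (hm C y z q). \<forall>f\<in>carrier (hm C x y p).
      fm x z (q + p) (dcmp C x y z q p g f) =
      dcmp D (fo x) (fo y) (fo z) q p (fm y z q g) (fm x y p f))}"

definition homotopy_equivalences :: "('k, 'o, 'm) dgcat \<Rightarrow> 'o \<Rightarrow> 'o \<Rightarrow> 'm set" where
  "homotopy_equivalences C x y = {u \<in> cocycles (ghom C x y) 0. \<exists>v\<in>cocycles (ghom C y x) 0.
    dcmp C x y x 0 0 v u \<ominus>\<^bsub>hm C x x 0\<^esub> did C x \<in> coboundaries (ghom C x x) 0 \<and>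
    dcmp C y x y 0 0 u v \<ominus>\<^bsub>hm C y y 0\<^esub> did C y \<in> coboundaries (ghom C y y) 0}"

definition quasi_equivalence ::
    "('k, 'a, 'b) dgcat \<Rightarrow> ('k, 'o, 'm) dgcat \<Rightarrow> ('a, 'b, 'o, 'm) gmap \<Rightarrow> bool" where
  "quasi_equivalence C D f \<longleftrightarrow>
    (\<forall>x\<in>gob C. \<forall>y\<in>gob C. quasi_iso (ghom C x y) (ghom D (fst f x) (fst f y)) (snd f x y)) \<and>
    (\<forall>y\<in>gob D. \<exists>x\<in>gob C. homotopy_equivalences D (fst f x) y \<noteq> {})"

definition dg_fibration ::
    "('k, 'a, 'b) dgcat \<Rightarrow> ('k, 'o, 'm) dgcat \<Rightarrow> ('a, 'b, 'o, 'm) gmap \<Rightarrow> bool" where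
  "dg_fibration C D f \<longleftrightarrow>
    (\<forall>x\<in>gob C. \<forall>y\<in>gob C. \<forall>n.
      snd f x y n ` carrier (hm C x y n) = carrier (hm D (fst f x) (fst f y) n)) \<and>
    (\<forall>x\<in>gob C. \<forall>y'\<in>gob D. \<forall>v\<in>homotopy_equivalences D (fst f x) y'.
      \<exists>y\<in>gob C. \<exists>u\<in>homotopy_equivalences C x y. fst f y = y' \<and> snd f x y 0 u = v)"

text \<open>The category of dg-categories which are small with respect to the universe \<open>'u\<close>, i.e. have
  their objects and the elements of their Hom complexes in \<open>'u\<close>, with the classes of Tabuada's
  model structure. Records which differ only outside their carriers are distinct isomorphic objects;
  morphisms being extensional, this leaves the category unchanged up to equivalence.\<close>

definition dgCat ::
    "'u itself \<Rightarrow> 'k ring \<Rightarrow> (('k, 'u, 'u) dgcat, ('u, 'u, 'u, 'u) gmap) mcat" where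
  "dgCat _ K = \<lparr>Ob = {C. is_dgcat K C}, Hom = dg_functors K,
    Cmp = (\<lambda>C D E g f. gmap_comp C g f), Idn = gmap_id,
    weq = quasi_equivalence, fib = dg_fibration\<rparr>"

text \<open>\<open>C\<close> with \<open>\<eta> : G \<rightarrow> C\<close> is the free dg-category \<open>L(G)\<close>: the value at \<open>G\<close> of the left adjoint of
  the forgetful functor, with the unit of the adjunction.\<close>

definition free_on ::
    "'k ring \<Rightarrow> ('k, 'a, 'b) graph \<Rightarrow> ('k, 'o, 'm) dgcat \<Rightarrow> ('a, 'b, 'o, 'm) gmap \<Rightarrow> bool" where
  "free_on K G C \<eta> \<longleftrightarrow> is_graph K G \<and> is_dgcat K C \<and> \<eta> \<in> graph_maps K G C \<and>
    (\<forall>D :: ('k, 'o, 'm) dgcat. is_dgcat K D \<longrightarrow>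
      (\<forall>g\<in>graph_maps K G D. \<exists>!f. f \<in> dg_functors K C D \<and> gmap_comp G f \<eta> = g))"

definition free_finite_type :: "'k ring \<Rightarrow> ('k, 'u, 'u) dgcat \<Rightarrow> bool" where
  "free_finite_type K C \<longleftrightarrow> (\<exists>(G :: ('k, 'u, 'u) graph) \<eta>. free_on K G C \<eta> \<and>
    finite (gob G) \<and> (\<forall>x\<in>gob G. \<forall>y\<in>gob G. perfect K (ghom G x y)))"

definition cL :: "'u itself \<Rightarrow> 'k ring \<Rightarrow> ('k, 'u, 'u) dgcat set" where
  "cL T K = {C. is_dgcat K C \<and> cofibrant (dgCat T K) C \<and> free_finite_type K C}"

definition L_dgCat ::
    "'u itself \<Rightarrow> 'k ring \<Rightarrow>
     (('k, 'u, 'u) dgcat, (('k, 'u, 'u) dgcat, ('u, 'u, 'u, 'u) gmap) hammock) scat" where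
  "L_dgCat T K = hammock_localisation (dgCat T K) (weq (dgCat T K))"

definition cL_S ::
    "'u itself \<Rightarrow> 'k ring \<Rightarrow>
     (('k, 'u, 'u) dgcat, (('k, 'u, 'u) dgcat, ('u, 'u, 'u, 'u) gmap) hammock) scat" where
  "cL_S T K = full_sub (L_dgCat T K) (cL T K)"


section \<open>The linearisation of the simplex category\<close>

text \<open>The complexes \<open>k\<close> (if \<open>b\<close>) and \<open>0\<close>, concentrated in degree \<open>0\<close>.\<close>

definition unit_cpx :: "'k ring \<Rightarrow> bool \<Rightarrow> ('k, 'k) cpx" where
  "unit_cpx K b = \<lparr>
    cmd = (\<lambda>n. \<lparr>carrier = (if b \<and> n = 0 then carrier K else {\<zero>\<^bsub>K\<^esub>}), mult = undefined,
      one = undefined, ring.zero = \<zero>\<^bsub>K\<^esub>, add = add K, smult = mult K\<rparr>),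
    cdf = (\<lambda>n x. \<zero>\<^bsub>K\<^esub>)\<rparr>"

definition Delta_graph :: "'k ring \<Rightarrow> nat \<Rightarrow> ('k, nat, 'k) graph" where
  "Delta_graph K n = \<lparr>gob = {..n}, ghom = (\<lambda>i j. unit_cpx K (j = Suc i))\<rparr>"

text \<open>For \<open>\<eta>\<close> exhibiting \<open>C\<close> as \<open>\<Delta>\<^sup>n\<^sub>k\<close>, the composite of the \<open>l\<close> generators leading from \<open>i\<close> to
  \<open>i + l\<close>.\<close>

primrec path ::
    "'k ring \<Rightarrow> ('k, 'o, 'm) dgcat \<Rightarrow> (nat, 'k, 'o, 'm) gmap \<Rightarrow> nat \<Rightarrow> nat \<Rightarrow> 'm" where
  "path K C \<eta> i 0 = did C (fst \<eta> i)"
| "path K C \<eta> i (Suc l) = dcmp C (fst \<eta> i) (fst \<eta> (i + l)) (fst \<eta> (i + Suc l)) 0 0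
    (snd \<eta> (i + l) (i + Suc l) 0 \<one>\<^bsub>K\<^esub>) (path K C \<eta> i l)"

text \<open>The dg-functor induced by \<open>\<theta> : [m] \<rightarrow> [n]\<close>, given by \<open>\<theta>\<close> on objects and mapping the generator
  from \<open>i\<close> to \<open>i + 1\<close> to the path from \<open>\<theta> i\<close> to \<open>\<theta> (i + 1)\<close>.\<close>

definition induced_by ::
    "'k ring \<Rightarrow> nat \<Rightarrow> (nat \<Rightarrow> nat) \<Rightarrow> ('k, 'o, 'm) dgcat \<Rightarrow> (nat, 'k, 'o, 'm) gmap \<Rightarrow>
     (nat, 'k, 'o, 'm) gmap \<Rightarrow> ('o, 'm, 'o, 'm) gmap \<Rightarrow> bool" where
  "induced_by K m \<theta> D \<eta> \<eta>' f \<longleftrightarrow>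
    (\<forall>i\<le>m. fst f (fst \<eta> i) = fst \<eta>' (\<theta> i)) \<and>
    (\<forall>i<m. snd f (fst \<eta> i) (fst \<eta> (Suc i)) 0 (snd \<eta> i (Suc i) 0 \<one>\<^bsub>K\<^esub>) =
      path K D \<eta>' (\<theta> i) (\<theta> (Suc i) - \<theta> i))"

definition linearisation ::
    "'u itself \<Rightarrow> 'k ring \<Rightarrow>
     (nat, nat \<Rightarrow> nat, ('k, 'u, 'u) dgcat,
      (('k, 'u, 'u) dgcat, ('u, 'u, 'u, 'u) gmap) hammock) sfun \<Rightarrow> bool" where
  "linearisation T K j \<longleftrightarrow> simplicial_functor (discrete Delta) (cL_S T K) j \<and>
    (\<exists>\<eta>. (\<forall>n. free_on K (Delta_graph K n) (SFOb j n) (\<eta> n)) \<and>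
      (\<forall>m n. \<forall>\<theta>\<in>dmap m n. \<exists>f\<in>dg_functors K (SFOb j m) (SFOb j n).
        induced_by K m \<theta> (SFOb j n) (\<eta> m) (\<eta> n) f \<and>
        SFAr j m n 0 \<theta> = localise (dgCat T K) (weq (dgCat T K)) (SFOb j m) (SFOb j n) f))"

end

theory Submission
  imports Defs
begin

text \<open>The linearisation sends \<open>[n]\<close> to the dg-category with objects \<open>0, \<dots>, n\<close>, Hom complex \<open>K\<close> in
  degree \<open>0\<close> from \<open>i\<close> to \<open>j\<close> if \<open>i \<le> j\<close> and \<open>0\<close> otherwise, and the multiplication of \<open>K\<close> as composition. A
  dg-functor out of it is the same as a chain of \<open>n\<close> composable closed morphisms of degree \<open>0\<close>, so it is
  free on the generators; and since a trivial fibration is surjective on objects and on closed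
  morphisms of degree \<open>0\<close>, such chains lift, so it is cofibrant. A monotone map acts by the
  identity on scalars, which is visibly functorial, and \<open>j\<close> is the composite of this functor with the
  localisation functor. The left adjoint of \<open>j\<^sup>*\<close> is the left Kan extension; as fibrations and weak
  equivalences are objectwise, \<open>j\<^sup>*\<close> preserves them, which makes the adjunction Quillen.\<close>


section \<open>Categories and simplicial structures\<close>

text \<open>A presheaf takes values in \<open>'v sset\<close>, so the coend defining the left Kan
  extension must have its simplices in the fixed universe \<open>'v\<close>; this shapes the
  adjunction part. Smallness of \<open>cL_S\<close> gives codes in \<open>'v\<close> for its hom
  simplices, and an infinite \<open>'v\<close> absorbs pairs, so a class of triples can be named by
  the code of a chosen member. The enriched coend becomes an ordinary one in each degree because, by
  the Yoneda lemma, a simplicial functor to \<open>sSet\<close> amounts to an action of the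
  \<open>p\<close>-simplices of the Hom spaces on the \<open>p\<close>-simplices of the values, for
  all \<open>p\<close>, compatible with the simplicial operators (\<open>act\<close>,
  \<open>functor_of_action\<close>). On the side of the localisation, the unions over
  representatives in the definitions are meaningful because reductions are stable under
  concatenation and under restriction along monotone maps. Cofibrations are given by a lifting
  property, so the left adjoint preserves them by transposing lifting squares.\<close>

lemma category_Idn: "category C \<Longrightarrow> x \<in> Ob C \<Longrightarrow> Idn C x \<in> Hom C x x"
  by (auto simp: category_def)

lemma category_Cmp:
  "category C \<Longrightarrow> x \<in> Ob C \<Longrightarrow> y \<in> Ob C \<Longrightarrow> z \<in> Ob C \<Longrightarrow> f \<in> Hom C x y \<Longrightarrow> g \<in> Hom C y z \<Longrightarrow>
    Cmp C x y z g f \<in> Hom C x z"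
  by (auto simp: category_def)

lemma category_Idn_left:
  "category C \<Longrightarrow> x \<in> Ob C \<Longrightarrow> y \<in> Ob C \<Longrightarrow> f \<in> Hom C x y \<Longrightarrow> Cmp C x y y (Idn C y) f = f"
  by (auto simp: category_def)

lemma category_Idn_right:
  "category C \<Longrightarrow> x \<in> Ob C \<Longrightarrow> y \<in> Ob C \<Longrightarrow> f \<in> Hom C x y \<Longrightarrow> Cmp C x x y f (Idn C x) = f"
  by (auto simp: category_def)

lemma category_assoc:
  "category C \<Longrightarrow> w \<in> Ob C \<Longrightarrow> x \<in> Ob C \<Longrightarrow> y \<in> Ob C \<Longrightarrow> z \<in> Ob C \<Longrightarrow>
    f \<in> Hom C w x \<Longrightarrow> g \<in> Hom C x y \<Longrightarrow> h \<in> Hom C y z \<Longrightarrow>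
    Cmp C w y z h (Cmp C w x y g f) = Cmp C w x z (Cmp C x y z h g) f"
  unfolding category_def by blast

section \<open>Monotone maps between finite ordinals\<close>

lemma dmap_bound: "\<theta> \<in> dmap m n \<Longrightarrow> i \<le> m \<Longrightarrow> \<theta> i \<le> n"
  by (auto simp: dmap_def)

lemma dmap_mono: "\<theta> \<in> dmap m n \<Longrightarrow> i \<le> j \<Longrightarrow> j \<le> m \<Longrightarrow> \<theta> i \<le> \<theta> j"
  by (auto simp: dmap_def mono_on_def)

lemma dmap_id: "(\<lambda>i\<in>{..n}. i) \<in> dmap n n"
  by (auto simp: dmap_def mono_on_def)

lemma dmap_compose: "\<phi> \<in> dmap l m \<Longrightarrow> \<theta> \<in> dmap m n \<Longrightarrow> compose {..l} \<theta> \<phi> \<in> dmap l n"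
  by (auto simp: dmap_def mono_on_def compose_def PiE_def Pi_def)

lemma dmap_zero: "(\<lambda>i\<in>{..n}. 0) \<in> dmap n m"
  by (auto simp: dmap_def mono_on_def)

lemma dmap_compose_id [simp]: "\<theta> \<in> dmap m n \<Longrightarrow> compose {..m} \<theta> (\<lambda>i\<in>{..m}. i) = \<theta>"
  by (auto simp: dmap_def compose_def PiE_def extensional_def fun_eq_iff)

lemma dmap_id_compose [simp]: "\<theta> \<in> dmap m n \<Longrightarrow> compose {..m} (\<lambda>i\<in>{..n}. i) \<theta> = \<theta>"
  by (auto simp: dmap_def compose_def PiE_def extensional_def fun_eq_iff)

lemma dmap_compose_assoc:
  "\<psi> \<in> dmap k l \<Longrightarrow> compose {..k} (compose {..l} \<theta> \<phi>) \<psi> = compose {..k} \<theta> (compose {..k} \<phi> \<psi>)"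
  by (auto simp: dmap_def compose_def PiE_def Pi_def fun_eq_iff)

lemma dmap_to_0: "\<theta> \<in> dmap m 0 \<Longrightarrow> \<theta> = (\<lambda>i\<in>{..m}. 0)"
  by (auto simp: dmap_def PiE_def extensional_def fun_eq_iff)

lemma compose_zero [simp]: "\<phi> \<in> dmap l m \<Longrightarrow> compose {..l} (\<lambda>i\<in>{..m}. 0::nat) \<phi> = (\<lambda>i\<in>{..l}. 0)"
  by (auto simp: dmap_def compose_def PiE_def extensional_def fun_eq_iff)

section \<open>Rules for simplicial sets and simplicial categories\<close>

lemma is_ssetI:
  assumes "\<And>m n \<theta> x. \<theta> \<in> dmap m n \<Longrightarrow> x \<in> smp X n \<Longrightarrow> sop X m n \<theta> x \<in> smp X m"
    and "\<And>n x. x \<in> smp X n \<Longrightarrow> sop X n n (\<lambda>i\<in>{..n}. i) x = x"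
    and "\<And>l m n \<phi> \<theta> x. \<phi> \<in> dmap l m \<Longrightarrow> \<theta> \<in> dmap m n \<Longrightarrow> x \<in> smp X n \<Longrightarrow>
      sop X l n (compose {..l} \<theta> \<phi>) x = sop X l m \<phi> (sop X m n \<theta> x)"
  shows "is_sset X"
  unfolding is_sset_def by (intro conjI allI ballI; rule assms; assumption)

lemma sset_sop: "is_sset X \<Longrightarrow> \<theta> \<in> dmap m n \<Longrightarrow> x \<in> smp X n \<Longrightarrow> sop X m n \<theta> x \<in> smp X m"
  unfolding is_sset_def by blast

lemma sset_id: "is_sset X \<Longrightarrow> x \<in> smp X n \<Longrightarrow> sop X n n (\<lambda>i\<in>{..n}. i) x = x"
  unfolding is_sset_def by blast

lemma sset_compose:
  "is_sset X \<Longrightarrow> \<phi> \<in> dmap l m \<Longrightarrow> \<theta> \<in> dmap m n \<Longrightarrow> x \<in> smp X n \<Longrightarrow>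
    sop X l n (compose {..l} \<theta> \<phi>) x = sop X l m \<phi> (sop X m n \<theta> x)"
  unfolding is_sset_def by blast

lemma simplicial_categoryI:
  assumes "\<And>x y. x \<in> SOb A \<Longrightarrow> y \<in> SOb A \<Longrightarrow> is_sset (SHom A x y)"
    and "\<And>x. x \<in> SOb A \<Longrightarrow> SId A x \<in> smp (SHom A x x) 0"
    and "\<And>x y z n f g. \<lbrakk>x \<in> SOb A; y \<in> SOb A; z \<in> SOb A; f \<in> smp (SHom A x y) n;
      g \<in> smp (SHom A y z) n\<rbrakk> \<Longrightarrow> SCmp A x y z n g f \<in> smp (SHom A x z) n"
    and "\<And>x y z n f g m \<theta>. \<lbrakk>x \<in> SOb A; y \<in> SOb A; z \<in> SOb A; f \<in> smp (SHom A x y) n;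
      g \<in> smp (SHom A y z) n; \<theta> \<in> dmap m n\<rbrakk> \<Longrightarrow>
      sop (SHom A x z) m n \<theta> (SCmp A x y z n g f) =
        SCmp A x y z m (sop (SHom A y z) m n \<theta> g) (sop (SHom A x y) m n \<theta> f)"
    and "\<And>x y n f. \<lbrakk>x \<in> SOb A; y \<in> SOb A; f \<in> smp (SHom A x y) n\<rbrakk> \<Longrightarrow>
      SCmp A x y y n (degen (SHom A y y) n (SId A y)) f = f"
    and "\<And>x y n f. \<lbrakk>x \<in> SOb A; y \<in> SOb A; f \<in> smp (SHom A x y) n\<rbrakk> \<Longrightarrow>
      SCmp A x x y n f (degen (SHom A x x) n (SId A x)) = f"
    and "\<And>w x y z n f g h. \<lbrakk>w \<in> SOb A; x \<in> SOb A; y \<in> SOb A; z \<in> SOb A;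
      f \<in> smp (SHom A w x) n; g \<in> smp (SHom A x y) n; h \<in> smp (SHom A y z) n\<rbrakk> \<Longrightarrow>
      SCmp A w y z n h (SCmp A w x y n g f) = SCmp A w x z n (SCmp A x y z n h g) f"
  shows "simplicial_category A"
  unfolding simplicial_category_def by (intro conjI allI ballI; rule assms; assumption)

lemma simplicial_categoryD:
  assumes "simplicial_category A"
  shows "\<And>x y. x \<in> SOb A \<Longrightarrow> y \<in> SOb A \<Longrightarrow> is_sset (SHom A x y)"
    and "\<And>x. x \<in> SOb A \<Longrightarrow> SId A x \<in> smp (SHom A x x) 0"
    and "\<And>x y z n f g. \<lbrakk>x \<in> SOb A; y \<in> SOb A; z \<in> SOb A; f \<in> smp (SHom A x y) n;
      g \<in> smp (SHom A y z) n\<rbrakk> \<Longrightarrow> SCmp A x y z n g f \<in> smp (SHom A x z) n"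
    and "\<And>x y z n f g m \<theta>. \<lbrakk>x \<in> SOb A; y \<in> SOb A; z \<in> SOb A; f \<in> smp (SHom A x y) n;
      g \<in> smp (SHom A y z) n; \<theta> \<in> dmap m n\<rbrakk> \<Longrightarrow>
      sop (SHom A x z) m n \<theta> (SCmp A x y z n g f) =
        SCmp A x y z m (sop (SHom A y z) m n \<theta> g) (sop (SHom A x y) m n \<theta> f)"
    and "\<And>x y n f. \<lbrakk>x \<in> SOb A; y \<in> SOb A; f \<in> smp (SHom A x y) n\<rbrakk> \<Longrightarrow>
      SCmp A x y y n (degen (SHom A y y) n (SId A y)) f = f"
    and "\<And>x y n f. \<lbrakk>x \<in> SOb A; y \<in> SOb A; f \<in> smp (SHom A x y) n\<rbrakk> \<Longrightarrow>
      SCmp A x x y n f (degen (SHom A x x) n (SId A x)) = f"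
    and "\<And>w x y z n f g h. \<lbrakk>w \<in> SOb A; x \<in> SOb A; y \<in> SOb A; z \<in> SOb A;
      f \<in> smp (SHom A w x) n; g \<in> smp (SHom A x y) n; h \<in> smp (SHom A y z) n\<rbrakk> \<Longrightarrow>
      SCmp A w y z n h (SCmp A w x y n g f) = SCmp A w x z n (SCmp A x y z n h g) f"
  using assms unfolding simplicial_category_def by simp_all


section \<open>The hammock localisation\<close>

lemma is_zigzag_Ob: "is_zigzag C W x s y \<Longrightarrow> x \<in> Ob C \<and> y \<in> Ob C"
  by (induction s arbitrary: x) auto

lemma is_zigzag_append:
  "is_zigzag C W x (s @ t) y \<longleftrightarrow> (\<exists>z. is_zigzag C W x s z \<and> is_zigzag C W z t y)"
  by (induction s arbitrary: x) (auto dest: is_zigzag_Ob)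

lemma reduces_zigzag_left: "reduces C W x y s t \<Longrightarrow> is_zigzag C W x s y"
  by (induction rule: reduces.induct) (auto simp: is_zigzag_append)

text \<open>A reduction rewrites the middle of a zigzag, so \<open>t\<close> is absorbed into the
  untouched tail \<open>q\<close>. With \<open>reduces_append_left\<close> this makes concatenation
  compatible with reductions.\<close>

lemma reduces_append_right:
  assumes "reduces C W x y s s'" "is_zigzag C W y t z"
  shows "reduces C W x z (s @ t) (s' @ t)"
  using assms(1)
proof cases
  case (omit p u b q)
  then show ?thesis
    using reduces.omit[of C W x p u b "q @ t" z] assms(2) by (auto simp: is_zigzag_append)
next
  case (forward p u v f w g q)
  then show ?thesis
    using reduces.forward[of C W x p u v f w g "q @ t" z] assms(2) by (auto simp: is_zigzag_append)
next
  case (backward p u v f w g q)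
  then show ?thesis
    using reduces.backward[of C W x p u v f w g "q @ t" z] assms(2) by (auto simp: is_zigzag_append)
qed

lemma reduces_append_left:
  assumes "reduces C W y z t t'" "is_zigzag C W x s y"
  shows "reduces C W x z (s @ t) (s @ t')"
  using assms(1)
proof cases
  case (omit p u b q)
  then show ?thesis
    using reduces.omit[of C W x "s @ p" u b q z] assms(2) by (auto simp: is_zigzag_append)
next
  case (forward p u v f w g q)
  then show ?thesis
    using reduces.forward[of C W x "s @ p" u v f w g q z] assms(2) by (auto simp: is_zigzag_append)
next
  case (backward p u v f w g q)
  then show ?thesis
    using reduces.backward[of C W x "s @ p" u v f w g q z] assms(2) by (auto simp: is_zigzag_append)
qed

text \<open>Well-definedness on hammock classes is checked this way: it suffices to send each single
  reduction to equivalent zigzags.\<close>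

lemma equivclp_map:
  assumes "equivclp R s t" "\<And>a b. R a b \<Longrightarrow> equivclp Q (f a) (f b)"
  shows "equivclp Q (f s) (f t)"
  using assms(1)
proof (induction rule: equivclp_induct)
  case (step y z)
  then show ?case
    by (meson assms(2) equivclp_sym equivclp_trans)
qed auto

text \<open>The closure conditions keep zigzags well typed: identities in \<open>W\<close> make
  constant chains objects of \<open>chain_cat\<close>, and closure under composition keeps the
  composite of two backward columns in \<open>W\<close>.\<close>

locale relative_category =
  fixes C :: "('o, 'a, 'e) cat_scheme" and W :: "'o \<Rightarrow> 'o \<Rightarrow> 'a \<Rightarrow> bool"
  assumes cat: "category C"
    and weq_Idn: "x \<in> Ob C \<Longrightarrow> W x x (Idn C x)"
    and weq_Cmp: "\<lbrakk>x \<in> Ob C; y \<in> Ob C; z \<in> Ob C; f \<in> Hom C x y; g \<in> Hom C y z; W x y f; W y z g\<rbrakk>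
      \<Longrightarrow> W x z (Cmp C x y z g f)"
begin

abbreviation (input) "Ch \<equiv> chain_cat C W"
abbreviation (input) "chw \<equiv> chain_weq W"
abbreviation (input) "cst \<equiv> const_chain C"

section \<open>Categories of chains and restriction along monotone maps\<close>

lemma chain_Ob_D:
  assumes "X \<in> Ob (Ch k)" and "i \<le> j" "j \<le> k"
  shows "fst X i \<in> Ob C" "fst X j \<in> Ob C" "snd X (i, j) \<in> Hom C (fst X i) (fst X j)"
  using assms by (auto simp: chain_cat_def PiE_def Pi_def)

lemma chain_Hom_iff:
  "h \<in> Hom (Ch k) X Y \<longleftrightarrow> h \<in> (\<Pi>\<^sub>E i\<in>{..k}. Hom C (fst X i) (fst Y i)) \<and>
    (\<forall>i j. i \<le> j \<longrightarrow> j \<le> k \<longrightarrow>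
      Cmp C (fst X i) (fst Y i) (fst Y j) (snd Y (i, j)) (h i) =
      Cmp C (fst X i) (fst X j) (fst Y j) (h j) (snd X (i, j)))"
  by (auto simp: chain_cat_def split: prod.splits)

lemma chain_Cmp:
  "Cmp (Ch k) X Y Z g f = (\<lambda>i\<in>{..k}. Cmp C (fst X i) (fst Y i) (fst Z i) (g i) (f i))"
  by (auto simp: chain_cat_def split: prod.splits)

lemma chain_Idn: "Idn (Ch k) X = (\<lambda>i\<in>{..k}. Idn C (fst X i))"
  by (auto simp: chain_cat_def split: prod.splits)

text \<open>The commuting squares of \<open>f\<close> and \<open>g\<close> are pasted along the
  column of \<open>Y\<close>; the three instances of associativity do the rebracketing.\<close>

lemma chain_Cmp_closed:
  assumes X: "X \<in> Ob (Ch k)" and Y: "Y \<in> Ob (Ch k)" and Z: "Z \<in> Ob (Ch k)"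
    and f: "f \<in> Hom (Ch k) X Y" and g: "g \<in> Hom (Ch k) Y Z"
  shows "Cmp (Ch k) X Y Z g f \<in> Hom (Ch k) X Z"
proof -
  have fi: "f i \<in> Hom C (fst X i) (fst Y i)" and gi: "g i \<in> Hom C (fst Y i) (fst Z i)" if "i \<le> k"
    for i
    using f g that by (auto simp: chain_Hom_iff)
  have "Cmp C (fst X i) (fst Z i) (fst Z j) (snd Z (i, j)) (Cmp C (fst X i) (fst Y i) (fst Z i) (g
    i) (f i)) =
      Cmp C (fst X i) (fst X j) (fst Z j) (Cmp C (fst X j) (fst Y j) (fst Z j) (g j) (f j)) (snd X
        (i, j))"
    if ij: "i \<le> j" "j \<le> k" for i j
  proof -
    note ob = chain_Ob_D[OF X ij] chain_Ob_D[OF Y ij] chain_Ob_D[OF Z ij]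
    have ik: "i \<le> k" using ij by simp
    have fc: "Cmp C (fst X i) (fst Y i) (fst Y j) (snd Y (i, j)) (f i) =
      Cmp C (fst X i) (fst X j) (fst Y j) (f j) (snd X (i, j))"
      and gc: "Cmp C (fst Y i) (fst Z i) (fst Z j) (snd Z (i, j)) (g i) =
      Cmp C (fst Y i) (fst Y j) (fst Z j) (g j) (snd Y (i, j))"
      using f g ij by (auto simp: chain_Hom_iff)
    show ?thesis
      using category_assoc[OF cat, of "fst X i" "fst Y i" "fst Z i" "fst Z j" "f i" "g i" "snd Z
        (i,j)"]
        category_assoc[OF cat, of "fst X i" "fst Y i" "fst Y j" "fst Z j" "f i" "snd Y (i,j)" "g j"]
        category_assoc[OF cat, of "fst X i" "fst X j" "fst Y j" "fst Z j" "snd X (i,j)" "f j" "g j"]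
        ob fi[OF ik] gi[OF ik] fi[OF ij(2)] gi[OF ij(2)] fc gc
      by simp
  qed
  moreover have "Cmp C (fst X i) (fst Y i) (fst Z i) (g i) (f i) \<in> Hom C (fst X i) (fst Z i)"
    if "i \<le> k" for i
    using that by (intro category_Cmp[OF cat] fi gi chain_Ob_D(1)[OF X that] chain_Ob_D(1)[OF Y
      that]
        chain_Ob_D(1)[OF Z that]) auto
  ultimately show ?thesis
    by (auto simp: chain_Hom_iff chain_Cmp)
qed

lemma chain_weq_Cmp:
  assumes X: "X \<in> Ob (Ch k)" and Y: "Y \<in> Ob (Ch k)" and Z: "Z \<in> Ob (Ch k)"
    and f: "f \<in> Hom (Ch k) X Y" and g: "g \<in> Hom (Ch k) Y Z" and "chw k X Y f" "chw k Y Z g"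
  shows "chw k X Z (Cmp (Ch k) X Y Z g f)"
  using assms unfolding chain_weq_def
  by (auto simp: chain_Hom_iff chain_Cmp PiE_def Pi_def
      intro!: weq_Cmp chain_Ob_D(1)[OF X] chain_Ob_D(1)[OF Y] chain_Ob_D(1)[OF Z])

lemma const_chain_Ob: "x \<in> Ob C \<Longrightarrow> cst k x \<in> Ob (Ch k)"
  by (auto simp: chain_cat_def const_chain_def weq_Idn category_Idn[OF cat]
      category_Idn_left[OF cat])

lemma pull_chain_Ob:
  assumes \<theta>: "\<theta> \<in> dmap m k" and X: "X \<in> Ob (Ch k)"
  shows "pull_chain m \<theta> X \<in> Ob (Ch m)"
proof -
  obtain A a where [simp]: "X = (A, a)" by (cases X)
  have *: "\<theta> i \<le> \<theta> j" "\<theta> j \<le> k" if "i \<le> j" "j \<le> m" for i j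
    using dmap_mono[OF \<theta> that] dmap_bound[OF \<theta>] that by auto
  have **: "\<theta> i \<le> k" if "i \<le> m" for i
    using dmap_bound[OF \<theta> that] .
  show ?thesis
    using X * ** by (auto simp: chain_cat_def pull_chain_def PiE_def Pi_def)
qed

lemma pull_chain_fst: "i \<le> m \<Longrightarrow> fst (pull_chain m \<theta> X) i = fst X (\<theta> i)"
  by (cases X) (auto simp: pull_chain_def)

lemma pull_chain_snd: "i \<le> j \<Longrightarrow> j \<le> m \<Longrightarrow> snd (pull_chain m \<theta> X) (i, j) = snd X (\<theta> i, \<theta> j)"
  by (cases X) (auto simp: pull_chain_def)

lemma pull_chain_const: "\<theta> \<in> dmap m k \<Longrightarrow> pull_chain m \<theta> (cst k x) = cst m x"
  using dmap_bound[of \<theta> m k] dmap_mono[of \<theta> m k]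
  by (auto simp: const_chain_def pull_chain_def fun_eq_iff)

lemma pull_chain_compose:
  "\<phi> \<in> dmap l m \<Longrightarrow> pull_chain l (compose {..l} \<theta> \<phi>) X = pull_chain l \<phi> (pull_chain m \<theta> X)"
  using dmap_bound[of \<phi> l m] dmap_mono[of \<phi> l m]
  by (cases X) (auto simp: pull_chain_def fun_eq_iff compose_def)

lemma pull_chain_id:
  assumes "X \<in> Ob (Ch k)" shows "pull_chain k (\<lambda>i\<in>{..k}. i) X = X"
proof -
  obtain A a where [simp]: "X = (A, a)" by (cases X)
  show ?thesis
    using assms by (auto simp: chain_cat_def pull_chain_def fun_eq_iff PiE_def extensional_def)
qed

text \<open>Names the step map written inline in the \<open>sop\<close> of
  \<open>hammock_space\<close>, so that restriction of a zigzag is a plain \<open>map\<close> and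
  distributes over append.\<close>

definition pull_step ::
  "nat \<Rightarrow> (nat \<Rightarrow> nat) \<Rightarrow> bool \<times> ('o, 'a) chain \<times> (nat \<Rightarrow> 'a) \<Rightarrow> bool \<times> ('o,
    'a) chain \<times> (nat \<Rightarrow> 'a)" where
  "pull_step m \<theta> = (\<lambda>(b, Z, h). (b, pull_chain m \<theta> Z, \<lambda>i\<in>{..m}. h (\<theta> i)))"

lemma pull_Hom:
  assumes \<theta>: "\<theta> \<in> dmap m k" and h: "h \<in> Hom (Ch k) X Y"
  shows "(\<lambda>i\<in>{..m}. h (\<theta> i)) \<in> Hom (Ch m) (pull_chain m \<theta> X) (pull_chain m \<theta> Y)"
  using h dmap_bound[OF \<theta>] dmap_mono[OF \<theta>]
  by (auto simp: chain_Hom_iff pull_chain_fst pull_chain_snd PiE_def Pi_def)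

lemma pull_weq:
  assumes \<theta>: "\<theta> \<in> dmap m k" and h: "chw k X Y h"
  shows "chw m (pull_chain m \<theta> X) (pull_chain m \<theta> Y) (\<lambda>i\<in>{..m}. h (\<theta> i))"
  using h dmap_bound[OF \<theta>] by (auto simp: chain_weq_def pull_chain_fst)

lemma pull_zigzag:
  assumes \<theta>: "\<theta> \<in> dmap m k" and "is_zigzag (Ch k) (chw k) x s y"
  shows "is_zigzag (Ch m) (chw m) (pull_chain m \<theta> x) (map (pull_step m \<theta>) s) (pull_chain m \<theta> y)"
  using assms(2)
proof (induction s arbitrary: x)
  case Nil
  then show ?case by (auto simp: pull_chain_Ob[OF \<theta>])
next
  case (Cons a s)
  then show ?case
    by (cases a) (auto simp: pull_step_def pull_chain_Ob[OF \<theta>] pull_Hom[OF \<theta>] pull_weq[OF \<theta>])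
qed

lemma pull_Idn:
  assumes "\<theta> \<in> dmap m k"
  shows "(\<lambda>i\<in>{..m}. Idn (Ch k) z (\<theta> i)) = Idn (Ch m) (pull_chain m \<theta> z)"
  using dmap_bound[OF assms] by (auto simp: chain_Idn pull_chain_fst fun_eq_iff)

lemma pull_Cmp:
  assumes "\<theta> \<in> dmap m k"
  shows "(\<lambda>i\<in>{..m}. Cmp (Ch k) X Y Z g f (\<theta> i)) =
    Cmp (Ch m) (pull_chain m \<theta> X) (pull_chain m \<theta> Y) (pull_chain m \<theta> Z)
      (\<lambda>i\<in>{..m}. g (\<theta> i)) (\<lambda>i\<in>{..m}. f (\<theta> i))"
  using dmap_bound[OF assms] by (auto simp: chain_Cmp pull_chain_fst fun_eq_iff)

text \<open>Identities and composites of columns are computed level by level, so restricting the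
  levels turns each reduction into one of the same kind.\<close>

lemma pull_reduces:
  assumes \<theta>: "\<theta> \<in> dmap m k" and "reduces (Ch k) (chw k) x y s t"
  shows "reduces (Ch m) (chw m) (pull_chain m \<theta> x) (pull_chain m \<theta> y)
    (map (pull_step m \<theta>) s) (map (pull_step m \<theta>) t)"
  using assms(2)
proof cases
  case (omit p z b q)
  show ?thesis
    using pull_zigzag[OF \<theta> omit(3)] pull_zigzag[OF \<theta> omit(4)] unfolding omit
    by (simp add: pull_step_def pull_Idn[OF \<theta>] reduces.omit del: is_zigzag.simps)
next
  case (forward p u v f w g q)
  show ?thesis
    using pull_zigzag[OF \<theta> forward(3)] pull_zigzag[OF \<theta> forward(4)] unfolding forward
    by (simp add: pull_step_def pull_Cmp[OF \<theta>] reduces.forward del: is_zigzag.simps)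
next
  case (backward p u v f w g q)
  show ?thesis
    using pull_zigzag[OF \<theta> backward(3)] pull_zigzag[OF \<theta> backward(4)] unfolding backward
    by (simp add: pull_step_def pull_Cmp[OF \<theta>] reduces.backward del: is_zigzag.simps)
qed

lemma reduces_zigzag_right:
  assumes "reduces (Ch k) (chw k) x y s t"
  shows "is_zigzag (Ch k) (chw k) x t y"
  using assms
proof cases
  case (omit p z b q)
  then show ?thesis by (auto simp: is_zigzag_append simp del: split_paired_Ex)
next
  case (forward p u v f w g q)
  then show ?thesis
    using chain_Cmp_closed[of u k v w f g]
    by (auto simp: is_zigzag_append simp del: split_paired_Ex dest: is_zigzag_Ob)
next
  case (backward p u v f w g q)
  then show ?thesis
    using chain_Cmp_closed[of w k v u g f] chain_weq_Cmp[of w k v u g f]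
    by (auto simp: is_zigzag_append simp del: split_paired_Ex dest: is_zigzag_Ob)
qed

text \<open>\<open>hammock_class\<close> is formed among all lists of steps; this excludes a class
  that mixes zigzags with ill-typed lists. Both ends of a single reduction are zigzags, which drives
  the induction.\<close>

lemma equivclp_zigzag:
  assumes "equivclp (reduces (Ch k) (chw k) x y) s t"
  shows "is_zigzag (Ch k) (chw k) x s y \<longleftrightarrow> is_zigzag (Ch k) (chw k) x t y"
  using assms
proof (induction rule: equivclp_induct)
  case (step t u)
  then show ?case
    by (meson reduces_zigzag_left reduces_zigzag_right)
qed auto

section \<open>Hammock classes and their operations\<close>

abbreviation (input) heq ::
    "nat \<Rightarrow> 'o \<Rightarrow> 'o \<Rightarrow> (('o, 'a) chain, nat \<Rightarrow> 'a) zigzag \<Rightarrow> (('o, 'a) chain, nat \<Rightarrow> 'a) zigzag \<Rightarrow> bool"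
  where "heq k x y \<equiv> equivclp (reduces (Ch k) (chw k) (cst k x) (cst k y))"

abbreviation (input) zz :: "nat \<Rightarrow> 'o \<Rightarrow> 'o \<Rightarrow> (('o, 'a) chain, nat \<Rightarrow> 'a) zigzag \<Rightarrow> bool"
  where "zz k x y s \<equiv> is_zigzag (Ch k) (chw k) (cst k x) s (cst k y)"

abbreviation (input) "cls \<equiv> hammock_class C W"

lemma hammock_class_eq_iff: "cls k x y s = cls k x y t \<longleftrightarrow> heq k x y s t"
  unfolding hammock_class_def
  by (auto intro: equivclp_trans equivclp_sym)

text \<open>Operations on hammocks are defined as unions over representatives. The class contains
  \<open>s\<close>, so it is nonempty and a value independent of the representative equals the
  union.\<close>

lemma UN_hammock_class:
  assumes "\<And>t. heq k x y s t \<Longrightarrow> F t = F s"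
  shows "(\<Union>t\<in>cls k x y s. F t) = F s"
proof (rule SUP_eq_const)
  have "s \<in> cls k x y s" by (simp add: hammock_class_def)
  then show "cls k x y s \<noteq> {}" by blast
  show "F t = F s" if "t \<in> cls k x y s" for t
    using that assms[of t] by (simp add: hammock_class_def)
qed

lemma hammock_pull:
  assumes \<theta>: "\<theta> \<in> dmap m k"
  shows "sop (hammock_space C W x y) m k \<theta> (cls k x y s) = cls m x y (map (pull_step m \<theta>) s)"
proof -
  have "cls m x y (map (pull_step m \<theta>) t) = cls m x y (map (pull_step m \<theta>) s)"
    if "heq k x y s t" for t
  proof -
    have "heq m x y (map (pull_step m \<theta>) s) (map (pull_step m \<theta>) t)"
      using that
    proof (rule equivclp_map)
      fix a b assume "reduces (Ch k) (chw k) (cst k x) (cst k y) a b"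
      from pull_reduces[OF \<theta> this] show "heq m x y (map (pull_step m \<theta>) a) (map (pull_step m \<theta>) b)"
        by (auto simp: pull_chain_const[OF \<theta>])
    qed
    then show ?thesis using hammock_class_eq_iff by metis
  qed
  from UN_hammock_class[of k x y s "\<lambda>t. cls m x y (map (pull_step m \<theta>) t)", OF this]
  show ?thesis
    by (simp add: hammock_space_def pull_step_def)
qed

lemma hammock_comp:
  assumes s: "zz k x y s" and t: "zz k y z t"
  shows "SCmp (hammock_localisation C W) x y z k (cls k y z t) (cls k x y s) = cls k x z (s @ t)"
proof -
  \<comment> \<open>Representatives are changed one factor at a time. Replacing \<open>t\<close>
    needs the prefix \<open>s'\<close> to be a zigzag, which is where \<open>equivclp_zigzag\<close>
    enters.\<close>
  have *: "cls k x z (s' @ t') = cls k x z (s @ t)" if "heq k x y s s'" "heq k y z t t'" for s' t'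
  proof -
    have s': "zz k x y s'" using equivclp_zigzag[OF that(1)] s by simp
    have "heq k x z (s @ t) (s' @ t)"
      using that(1) by (rule equivclp_map) (auto intro: reduces_append_right t)
    moreover have "heq k x z (s' @ t) (s' @ t')"
      using that(2) by (rule equivclp_map) (auto intro: reduces_append_left s')
    ultimately show ?thesis
      using hammock_class_eq_iff equivclp_trans by metis
  qed
  have inner: "(\<Union>t'\<in>cls k y z t. cls k x z (s' @ t')) = cls k x z (s @ t)"
    if "heq k x y s s'" for s'
    using *[OF that] UN_hammock_class[of k y z t "\<lambda>t'. cls k x z (s' @ t')"] equivclp_refl by metis
  have "(\<Union>s'\<in>cls k x y s. \<Union>t'\<in>cls k y z t. cls k x z (s' @ t')) = cls k x z (s @ t)"
    using inner UN_hammock_class[of k x y s "\<lambda>s'. \<Union>t'\<in>cls k y z t. cls k x z (s' @ t')"]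
      equivclp_refl by metis
  then show ?thesis
    by (simp add: hammock_localisation_def)
qed

lemma hammock_simplex:
  "c \<in> smp (hammock_space C W x y) k \<longleftrightarrow> (\<exists>s. zz k x y s \<and> c = cls k x y s)"
  by (auto simp: hammock_space_def)

lemma pull_zz:
  assumes \<theta>: "\<theta> \<in> dmap m k" and "zz k x y s" shows "zz m x y (map (pull_step m \<theta>) s)"
  using pull_zigzag[OF assms] by (simp add: pull_chain_const[OF \<theta>])

text \<open>Restriction cuts chains and components down to \<open>{..k}\<close>, so the typing of
  \<open>s\<close> is what provides the extensionality that makes the cut invisible.\<close>

lemma pull_step_id:
  assumes "is_zigzag (Ch k) (chw k) x s y"
  shows "map (pull_step k (\<lambda>i\<in>{..k}. i)) s = s"
  using assms
proof (induction s arbitrary: x)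
  case (Cons a s)
  obtain b z h where [simp]: "a = (b, z, h)" by (cases a)
  have "z \<in> Ob (Ch k)" using Cons.prems by (auto dest: is_zigzag_Ob)
  moreover have "(\<lambda>i\<in>{..k}. h ((\<lambda>i\<in>{..k}. i) i)) = h"
    using Cons.prems by (auto simp: chain_Hom_iff fun_eq_iff PiE_def extensional_def split:
      if_splits)
  ultimately have "pull_step k (\<lambda>i\<in>{..k}. i) a = a"
    unfolding pull_step_def by (simp add: pull_chain_id)
  moreover have "map (pull_step k (\<lambda>i\<in>{..k}. i)) s = s"
    using Cons.prems by (intro Cons.IH[of z]) simp
  ultimately show ?case by (simp only: list.map)
qed simp

lemma pull_step_compose:
  assumes "\<phi> \<in> dmap l m"
  shows "pull_step l (compose {..l} \<theta> \<phi>) a = pull_step l \<phi> (pull_step m \<theta> a)"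
proof -
  have "(\<lambda>i\<in>{..l}. h (compose {..l} \<theta> \<phi> i)) = (\<lambda>i\<in>{..l}. (\<lambda>i\<in>{..m}. h (\<theta> i)) (\<phi> i))"
    for h :: "nat \<Rightarrow> 'a"
    using dmap_bound[OF assms] by (auto simp: compose_def fun_eq_iff)
  then show ?thesis
    by (cases a) (simp add: pull_step_def pull_chain_compose[OF assms])
qed

lemma hammock_space_sset: "is_sset (hammock_space C W x y)"
proof -
  have 1: "sop (hammock_space C W x y) m n \<theta> c \<in> smp (hammock_space C W x y) m"
    if "\<theta> \<in> dmap m n" "c \<in> smp (hammock_space C W x y) n" for m n \<theta> c
    using that pull_zz[OF that(1)] unfolding hammock_simplex by (metis hammock_pull)
  have 2: "sop (hammock_space C W x y) n n (\<lambda>i\<in>{..n}. i) c = c"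
    if "c \<in> smp (hammock_space C W x y) n" for n c
    using that pull_step_id unfolding hammock_simplex by (metis hammock_pull dmap_id)
  have 3: "sop (hammock_space C W x y) l n (compose {..l} \<theta> \<phi>) c =
      sop (hammock_space C W x y) l m \<phi> (sop (hammock_space C W x y) m n \<theta> c)"
    if "\<phi> \<in> dmap l m" "\<theta> \<in> dmap m n" "c \<in> smp (hammock_space C W x y) n" for l m n \<phi> \<theta> c
  proof -
    have "map (pull_step l (compose {..l} \<theta> \<phi>)) s = map (pull_step l \<phi>) (map (pull_step m \<theta>) s)"
      for s
      using pull_step_compose[OF that(1)] by simp
    then show ?thesis
      using that(3) unfolding hammock_simplex
      by (auto simp only: hammock_pull[OF that(1)] hammock_pull[OF that(2)]
        hammock_pull[OF dmap_compose[OF that(1,2)]])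
  qed
  show ?thesis
    by (intro is_ssetI; rule 1 2 3; assumption)
qed

lemma zz_Nil: "x \<in> Ob C \<Longrightarrow> zz k x x []"
  by (simp add: const_chain_Ob)

lemma zz_append: "zz k x y s \<Longrightarrow> zz k y z t \<Longrightarrow> zz k x z (s @ t)"
  unfolding is_zigzag_append by blast

lemma hammock_degen:
  "degen (hammock_space C W x y) n (cls 0 x y s) =
    cls n x y (map (pull_step n (\<lambda>i\<in>{..n}. 0)) s)"
  unfolding degen_def by (rule hammock_pull) (rule dmap_zero)

lemma hammock_localisation_simps [simp]:
  "SOb (hammock_localisation C W) = Ob C" "SHom (hammock_localisation C W) = hammock_space C W"
  "SId (hammock_localisation C W) x = cls 0 x x []"
  by (simp_all add: hammock_localisation_def)

text \<open>Composition is concatenation and the unit is the empty zigzag, so the unit laws and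
  associativity are those of lists and hold before passing to classes.\<close>

theorem simplicial_category_hammock: "simplicial_category (hammock_localisation C W)"
proof (rule simplicial_categoryI; simp only: hammock_localisation_simps)
  show "is_sset (hammock_space C W x y)" for x y
    by (rule hammock_space_sset)
  show "cls 0 x x [] \<in> smp (hammock_space C W x x) 0" if "x \<in> Ob C" for x
    using zz_Nil[OF that] unfolding hammock_simplex by blast
next
  fix x y z n f g
  assume "f \<in> smp (hammock_space C W x y) n" "g \<in> smp (hammock_space C W y z) n"
  then obtain s t where s: "zz n x y s" "f = cls n x y s" and t: "zz n y z t" "g = cls n y z t"
    unfolding hammock_simplex by blast
  have st: "zz n x z (s @ t)"
    by (rule zz_append[OF s(1) t(1)])
  then show "SCmp (hammock_localisation C W) x y z n g f \<in> smp (hammock_space C W x z) n"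
    unfolding s(2) t(2) hammock_comp[OF s(1) t(1)] hammock_simplex by blast
  show "sop (hammock_space C W x z) m n \<theta> (SCmp (hammock_localisation C W) x y z n g f) =
        SCmp (hammock_localisation C W) x y z m (sop (hammock_space C W y z) m n \<theta> g)
          (sop (hammock_space C W x y) m n \<theta> f)" if "\<theta> \<in> dmap m n" for m \<theta>
    unfolding s(2) t(2) hammock_comp[OF s(1) t(1)] hammock_pull[OF that]
      hammock_comp[OF pull_zz[OF that s(1)] pull_zz[OF that t(1)]]
    by simp
next
  fix x y n f
  assume x: "x \<in> Ob C" and y: "y \<in> Ob C" and "f \<in> smp (hammock_space C W x y) n"
  then obtain s where s: "zz n x y s" "f = cls n x y s"
    unfolding hammock_simplex by blast
  show "SCmp (hammock_localisation C W) x y y n (degen (hammock_space C W y y) n (cls 0 y y [])) f =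
    f"
    unfolding s(2) hammock_degen list.map hammock_comp[OF s(1) zz_Nil[OF y]] by simp
  show "SCmp (hammock_localisation C W) x x y n f (degen (hammock_space C W x x) n (cls 0 x x [])) =
    f"
    unfolding s(2) hammock_degen list.map hammock_comp[OF zz_Nil[OF x] s(1)] by simp
next
  fix w x y z n f g h
  assume "f \<in> smp (hammock_space C W w x) n" "g \<in> smp (hammock_space C W x y) n"
    "h \<in> smp (hammock_space C W y z) n"
  then obtain s t u where s: "zz n w x s" "f = cls n w x s" and t: "zz n x y t" "g = cls n x y t"
    and u: "zz n y z u" "h = cls n y z u"
    unfolding hammock_simplex by blast
  show "SCmp (hammock_localisation C W) w y z n h (SCmp (hammock_localisation C W) w x y n g f) =
      SCmp (hammock_localisation C W) w x z n (SCmp (hammock_localisation C W) x y z n h g) f"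
    unfolding s(2) t(2) u(2) hammock_comp[OF s(1) t(1)] hammock_comp[OF t(1) u(1)]
      hammock_comp[OF zz_append[OF s(1) t(1)] u(1)] hammock_comp[OF s(1) zz_append[OF t(1) u(1)]]
    by simp
qed

text \<open>A single forward step with constant columns: for \<open>k = 0\<close> its class is
  \<open>localise\<close>, and by \<open>pull_arrow\<close> the higher ones are the degeneracies of
  that vertex.\<close>

definition arrow_step :: "nat \<Rightarrow> 'o \<Rightarrow> 'a \<Rightarrow> (('o, 'a) chain, nat \<Rightarrow> 'a) zigzag" where
  "arrow_step k y f = [(True, cst k y, \<lambda>i\<in>{..k}. f)]"

lemma const_Hom:
  assumes "x \<in> Ob C" "y \<in> Ob C" "f \<in> Hom C x y"
  shows "(\<lambda>i\<in>{..k}. f) \<in> Hom (Ch k) (cst k x) (cst k y)"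
  using assms by (auto simp: chain_Hom_iff const_chain_def category_Idn_left[OF cat]
    category_Idn_right[OF cat])

lemma zz_arrow:
  "x \<in> Ob C \<Longrightarrow> y \<in> Ob C \<Longrightarrow> f \<in> Hom C x y \<Longrightarrow> zz k x y (arrow_step k y f)"
  by (auto simp: arrow_step_def const_chain_Ob const_Hom)

lemma pull_arrow: "\<theta> \<in> dmap m k \<Longrightarrow> map (pull_step m \<theta>) (arrow_step k y f) = arrow_step m y f"
  using dmap_bound[of \<theta> m k] by (auto simp: arrow_step_def pull_step_def pull_chain_const
    fun_eq_iff)

text \<open>This and \<open>arrow_Cmp\<close> are the functoriality of localisation: the rule
  \<open>omit\<close> deletes an identity column, the rule \<open>forward\<close> merges two forward
  ones.\<close>

lemma arrow_Idn:
  assumes "x \<in> Ob C" shows "cls k x x (arrow_step k x (Idn C x)) = cls k x x []"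
proof -
  have "Idn (Ch k) (cst k x) = (\<lambda>i\<in>{..k}. Idn C x)"
    by (auto simp: chain_Idn const_chain_def fun_eq_iff)
  then show ?thesis
    using reduces.omit[of "Ch k" "chw k" "cst k x" "[]" "cst k x" True "[]" "cst k x"]
      zz_arrow[OF assms assms category_Idn[OF cat assms], of k] zz_Nil[OF assms, of k]
    by (auto simp: hammock_class_eq_iff arrow_step_def)
qed

lemma arrow_Cmp:
  assumes "x \<in> Ob C" "y \<in> Ob C" "z \<in> Ob C" "f \<in> Hom C x y" "g \<in> Hom C y z"
  shows "cls k x z (arrow_step k y f @ arrow_step k z g) =
    cls k x z (arrow_step k z (Cmp C x y z g f))"
proof -
  have *: "Cmp (Ch k) (cst k x) (cst k y) (cst k z) (\<lambda>i\<in>{..k}. g) (\<lambda>i\<in>{..k}. f) =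
    (\<lambda>i\<in>{..k}. Cmp C x y z g f)"
    by (auto simp: chain_Cmp const_chain_def fun_eq_iff)
  have "heq k x z (arrow_step k y f @ arrow_step k z g) (arrow_step k z (Cmp C x y z g f))"
    using reduces.forward[of "Ch k" "chw k" "cst k x" "[]" "cst k x" "cst k y" "\<lambda>i\<in>{..k}.
      f" "cst k z"
        "\<lambda>i\<in>{..k}. g" "[]" "cst k z"]
      zz_append[OF zz_arrow[OF assms(1,2,4)] zz_arrow[OF assms(2,3,5)], of k] zz_Nil[OF assms(1),
        of k]
    by (auto simp: arrow_step_def *)
  then show ?thesis by (simp add: hammock_class_eq_iff)
qed

end

lemma simplicial_category_full_sub:
  assumes "simplicial_category A" "S \<subseteq> SOb A"
  shows "simplicial_category (full_sub A S)"
proof -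
  have [simp]: "SOb (full_sub A S) = S" "SHom (full_sub A S) = SHom A" "SCmp (full_sub A S) =
    SCmp A"
    "SId (full_sub A S) = SId A"
    by (auto simp: full_sub_def)
  show ?thesis
    by (rule simplicial_categoryI; simp; rule simplicial_categoryD[OF assms(1)];
        use subsetD[OF assms(2)] in simp)
qed


section \<open>Simplicial sets and simplicial presheaves\<close>

lemma sset_degen: "is_sset X \<Longrightarrow> v \<in> smp X 0 \<Longrightarrow> degen X n v \<in> smp X n"
  unfolding degen_def by (rule sset_sop[OF _ dmap_zero])

text \<open>There is only one map to \<open>[0]\<close>, so \<open>\<theta>\<close> followed by it
  is that map again.\<close>

lemma sop_degen:
  assumes "is_sset X" "v \<in> smp X 0" "\<theta> \<in> dmap m n"
  shows "sop X m n \<theta> (degen X n v) = degen X m v"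
  using sset_compose[OF assms(1) assms(3) dmap_zero assms(2)] assms(3) by (simp add: degen_def)

lemma degen_0: "is_sset X \<Longrightarrow> v \<in> smp X 0 \<Longrightarrow> degen X 0 v = v"
  using sset_id[of X v 0] unfolding degen_def by (metis atMost_0 restrict_ext singletonD)

section \<open>Mapping spaces of simplicial sets\<close>

lemma smp_sprod_std [simp]: "smp (sprod X (std n)) p = smp X p \<times> dmap p n"
  by (simp add: sprod_def std_def)

text \<open>A normal form for simplices of mapping spaces. Operators and composites all take it, so
  equations between them become pointwise by \<open>mapping_simplex_cong\<close>.\<close>

definition mapping_simplex ::
    "'v sset \<Rightarrow> nat \<Rightarrow> (nat \<Rightarrow> 'v \<Rightarrow> (nat \<Rightarrow> nat) \<Rightarrow> 'v) \<Rightarrow> 'v msimp" where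
  "mapping_simplex X n F = (\<lambda>p. \<lambda>(x, \<phi>)\<in>smp X p \<times> dmap p n. F p x \<phi>)"

lemma mapping_simplex_apply [simp]:
  "x \<in> smp X p \<Longrightarrow> \<phi> \<in> dmap p n \<Longrightarrow> mapping_simplex X n F p (x, \<phi>) = F p x \<phi>"
  by (simp add: mapping_simplex_def)

lemma mapping_simplex_cong:
  "(\<And>p x \<phi>. x \<in> smp X p \<Longrightarrow> \<phi> \<in> dmap p n \<Longrightarrow> F p x \<phi> = G p x \<phi>) \<Longrightarrow>
    mapping_simplex X n F = mapping_simplex X n G"
  by (auto simp: mapping_simplex_def fun_eq_iff restrict_def)

text \<open>The first conjunct is extensionality written as an eta rule, which brings an arbitrary
  simplex into the normal form.\<close>

lemma mapping_space_iff:
  "f \<in> smp (mapping_space X Y) n \<longleftrightarrow>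
    f = mapping_simplex X n (\<lambda>p x \<phi>. f p (x, \<phi>)) \<and>
    (\<forall>p x \<phi>. x \<in> smp X p \<longrightarrow> \<phi> \<in> dmap p n \<longrightarrow> f p (x, \<phi>) \<in> smp Y p) \<and>
    (\<forall>q p \<psi> x \<phi>. \<psi> \<in> dmap q p \<longrightarrow> x \<in> smp X p \<longrightarrow> \<phi> \<in> dmap p n \<longrightarrow>
      f q (sop X q p \<psi> x, compose {..q} \<phi> \<psi>) = sop Y q p \<psi> (f p (x, \<phi>)))" (is "_ \<longleftrightarrow> ?R")
proof
  assume "f \<in> smp (mapping_space X Y) n"
  then have f: "\<And>p. f p \<in> smp X p \<times> dmap p n \<rightarrow>\<^sub>E smp Y p"
    and nat: "\<And>q p \<psi> z. \<psi> \<in> dmap q p \<Longrightarrow> z \<in> smp X p \<times> dmap p n \<Longrightarrow>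
      f q (sop (sprod X (std n)) q p \<psi> z) = sop Y q p \<psi> (f p z)"
    by (auto simp: mapping_space_def smap_def)
  have "f p z = mapping_simplex X n (\<lambda>p x \<phi>. f p (x, \<phi>)) p z" for p z
    using f[of p] by (cases z) (auto simp: mapping_simplex_def PiE_def extensional_def restrict_def)
  then have "f = mapping_simplex X n (\<lambda>p x \<phi>. f p (x, \<phi>))" by blast
  moreover have "f q (sop X q p \<psi> x, compose {..q} \<phi> \<psi>) = sop Y q p \<psi> (f p (x, \<phi>))"
    if "\<psi> \<in> dmap q p" "x \<in> smp X p" "\<phi> \<in> dmap p n" for q p \<psi> x \<phi>
    using nat[of \<psi> q p "(x, \<phi>)"] that by (simp add: sprod_def std_def)
  ultimately show ?R using f by blast
next
  assume R: ?R
  then have f: "f = mapping_simplex X n (\<lambda>p x \<phi>. f p (x, \<phi>))" by blast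
  have "f p \<in> smp X p \<times> dmap p n \<rightarrow>\<^sub>E smp Y p" for p
    using R[THEN conjunct2] by (subst f) (auto simp: mapping_simplex_def)
  moreover have "f q (sop (sprod X (std n)) q p \<psi> z) = sop Y q p \<psi> (f p z)"
    if "\<psi> \<in> dmap q p" "z \<in> smp X p \<times> dmap p n" for q p \<psi> z
  proof (cases z)
    case (Pair x \<phi>)
    then show ?thesis using that R[THEN conjunct2] by (simp add: sprod_def std_def)
  qed
  ultimately show "f \<in> smp (mapping_space X Y) n"
    by (simp add: mapping_space_def smap_def)
qed

lemma mapping_simplexI:
  assumes "is_sset X"
    and "\<And>p x \<phi>. x \<in> smp X p \<Longrightarrow> \<phi> \<in> dmap p n \<Longrightarrow> F p x \<phi> \<in> smp Y p"
    and "\<And>q p \<psi> x \<phi>. \<psi> \<in> dmap q p \<Longrightarrow> x \<in> smp X p \<Longrightarrow> \<phi> \<in> dmap p n \<Longrightarrow>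
      F q (sop X q p \<psi> x) (compose {..q} \<phi> \<psi>) = sop Y q p \<psi> (F p x \<phi>)"
  shows "mapping_simplex X n F \<in> smp (mapping_space X Y) n"
  unfolding mapping_space_iff
  by (auto simp: assms dmap_compose sset_sop[OF assms(1)] intro!: mapping_simplex_cong)

lemma mapping_space_closed:
  "f \<in> smp (mapping_space X Y) n \<Longrightarrow> x \<in> smp X p \<Longrightarrow> \<phi> \<in> dmap p n \<Longrightarrow> f p (x, \<phi>) \<in> smp Y p"
  unfolding mapping_space_iff by blast

lemma mapping_space_nat:
  "f \<in> smp (mapping_space X Y) n \<Longrightarrow> \<psi> \<in> dmap q p \<Longrightarrow> x \<in> smp X p \<Longrightarrow> \<phi> \<in> dmap p n \<Longrightarrow>
    f q (sop X q p \<psi> x, compose {..q} \<phi> \<psi>) = sop Y q p \<psi> (f p (x, \<phi>))"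
  unfolding mapping_space_iff by blast

lemma mapping_space_eta:
  "f \<in> smp (mapping_space X Y) n \<Longrightarrow> mapping_simplex X n (\<lambda>p x \<phi>. f p (x, \<phi>)) = f"
  unfolding mapping_space_iff by simp

lemma mapping_space_ext:
  assumes "f \<in> smp (mapping_space X Y) n" "g \<in> smp (mapping_space X Y) n"
    and "\<And>p x \<phi>. x \<in> smp X p \<Longrightarrow> \<phi> \<in> dmap p n \<Longrightarrow> f p (x, \<phi>) = g p (x, \<phi>)"
  shows "f = g"
proof -
  have "mapping_simplex X n (\<lambda>p x \<phi>. f p (x, \<phi>)) = mapping_simplex X n (\<lambda>p x \<phi>. g p (x, \<phi>))"
    by (rule mapping_simplex_cong) (rule assms(3))
  then show ?thesis
    by (simp add: mapping_space_eta[OF assms(1)] mapping_space_eta[OF assms(2)])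
qed

lemma sop_mapping_space:
  "sop (mapping_space X Y) m n \<theta> f = mapping_simplex X m (\<lambda>p x \<phi>. f p (x, compose {..p} \<theta> \<phi>))"
  by (simp add: mapping_space_def mapping_simplex_def)

lemma SCmp_sSet:
  "SCmp (sSet T) X Y Z n g f = mapping_simplex X n (\<lambda>p x \<phi>. g p (f p (x, \<phi>), \<phi>))"
  by (simp add: sSet_def mapping_simplex_def)

lemma SId_sSet: "SId (sSet T) X = mapping_simplex X 0 (\<lambda>p x \<phi>. x)"
  by (simp add: sSet_def mapping_simplex_def)

lemma sSet_simps [simp]: "SOb (sSet T) = {X. is_sset X}" "SHom (sSet T) = mapping_space"
  by (simp_all add: sSet_def)

lemma is_sset_mapping_space:
  assumes X: "is_sset X"
  shows "is_sset (mapping_space X Y)"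
proof (rule is_ssetI)
  show "sop (mapping_space X Y) m n \<theta> f \<in> smp (mapping_space X Y) m"
    if "\<theta> \<in> dmap m n" "f \<in> smp (mapping_space X Y) n" for m n \<theta> f
    unfolding sop_mapping_space
    using mapping_space_nat[OF that(2)]
    by (intro mapping_simplexI) (auto simp: X mapping_space_closed[OF that(2)] dmap_compose that
        dmap_compose_assoc[symmetric])
  show "sop (mapping_space X Y) n n (\<lambda>i\<in>{..n}. i) f = f" if "f \<in> smp (mapping_space X Y) n" for n f
  proof -
    have "sop (mapping_space X Y) n n (\<lambda>i\<in>{..n}. i) f = mapping_simplex X n (\<lambda>p x \<phi>. f p (x, \<phi>))"
      unfolding sop_mapping_space by (rule mapping_simplex_cong) simp
    then show ?thesis by (simp add: mapping_space_eta[OF that])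
  qed
  show "sop (mapping_space X Y) l n (compose {..l} \<theta> \<phi>) f =
      sop (mapping_space X Y) l m \<phi> (sop (mapping_space X Y) m n \<theta> f)"
    if "\<phi> \<in> dmap l m" "\<theta> \<in> dmap m n" for l m n \<phi> \<theta> f
    unfolding sop_mapping_space
    by (rule mapping_simplex_cong) (simp add: that dmap_compose dmap_compose_assoc)
qed

lemma degen_SId_sSet:
  "is_sset X \<Longrightarrow> degen (mapping_space X X) n (SId (sSet T) X) = mapping_simplex X n (\<lambda>p x \<phi>. x)"
  unfolding degen_def sop_mapping_space SId_sSet
  by (rule mapping_simplex_cong) (simp add: dmap_zero)

lemma simplicial_category_sSet: "simplicial_category (sSet T)"
proof (rule simplicial_categoryI; unfold sSet_simps mem_Collect_eq)
  show "is_sset (mapping_space X Y)" if "is_sset X" for X Y :: "'a sset"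
    using that by (rule is_sset_mapping_space)
  show "SId (sSet T) X \<in> smp (mapping_space X X) 0" if "is_sset X" for X
    unfolding SId_sSet using that by (intro mapping_simplexI) auto
next
  fix X Y Z :: "'a sset" and n f g
  assume X: "is_sset X" and "is_sset Y" "is_sset Z"
    and f: "f \<in> smp (mapping_space X Y) n" and g: "g \<in> smp (mapping_space Y Z) n"
  show "SCmp (sSet T) X Y Z n g f \<in> smp (mapping_space X Z) n"
    unfolding SCmp_sSet
    by (intro mapping_simplexI) (auto simp: X mapping_space_closed[OF f] mapping_space_closed[OF g]
        mapping_space_nat[OF f] mapping_space_nat[OF g])
  show "sop (mapping_space X Z) m n \<theta> (SCmp (sSet T) X Y Z n g f) =
        SCmp (sSet T) X Y Z m (sop (mapping_space Y Z) m n \<theta> g) (sop (mapping_space X Y) m n \<theta> f)"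
    if "\<theta> \<in> dmap m n" for m \<theta>
    unfolding SCmp_sSet sop_mapping_space
    by (rule mapping_simplex_cong) (simp add: that dmap_compose mapping_space_closed[OF f])
next
  fix X Y :: "'a sset" and n f
  assume X: "is_sset X" and Y: "is_sset Y" and f: "f \<in> smp (mapping_space X Y) n"
  show "SCmp (sSet T) X Y Y n (degen (mapping_space Y Y) n (SId (sSet T) Y)) f = f"
    unfolding SCmp_sSet degen_SId_sSet[OF Y]
    \<comment> \<open>The bare \<open>f\<close> on the right is expanded, so that both sides are in
      normal form.\<close>
    by (subst (2) mapping_space_eta[OF f, symmetric], rule mapping_simplex_cong)
      (simp add: mapping_space_closed[OF f])
  show "SCmp (sSet T) X X Y n f (degen (mapping_space X X) n (SId (sSet T) X)) = f"
    unfolding SCmp_sSet degen_SId_sSet[OF X]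
    by (subst (2) mapping_space_eta[OF f, symmetric], rule mapping_simplex_cong) simp
next
  fix W X Y Z :: "'a sset" and n f g h
  assume "f \<in> smp (mapping_space W X) n"
  then show "SCmp (sSet T) W Y Z n h (SCmp (sSet T) W X Y n g f) =
      SCmp (sSet T) W X Z n (SCmp (sSet T) X Y Z n h g) f"
    unfolding SCmp_sSet by (intro mapping_simplex_cong) (simp add: mapping_space_closed)
qed

section \<open>Simplicial functors, opposite and discrete simplicial categories\<close>

lemma simplicial_functorI:
  assumes "simplicial_category A" "simplicial_category B"
    and "\<And>x. x \<in> SOb A \<Longrightarrow> SFOb F x \<in> SOb B"
    and "\<And>x y n f. \<lbrakk>x \<in> SOb A; y \<in> SOb A; f \<in> smp (SHom A x y) n\<rbrakk> \<Longrightarrow>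
      SFAr F x y n f \<in> smp (SHom B (SFOb F x) (SFOb F y)) n"
    and "\<And>x y n f m \<theta>. \<lbrakk>x \<in> SOb A; y \<in> SOb A; f \<in> smp (SHom A x y) n; \<theta> \<in> dmap m n\<rbrakk> \<Longrightarrow>
      SFAr F x y m (sop (SHom A x y) m n \<theta> f) =
        sop (SHom B (SFOb F x) (SFOb F y)) m n \<theta> (SFAr F x y n f)"
    and "\<And>x. x \<in> SOb A \<Longrightarrow> SFAr F x x 0 (SId A x) = SId B (SFOb F x)"
    and "\<And>x y z n f g. \<lbrakk>x \<in> SOb A; y \<in> SOb A; z \<in> SOb A; f \<in> smp (SHom A x y) n;
      g \<in> smp (SHom A y z) n\<rbrakk> \<Longrightarrow>
      SFAr F x z n (SCmp A x y z n g f) =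
      SCmp B (SFOb F x) (SFOb F y) (SFOb F z) n (SFAr F y z n g) (SFAr F x y n f)"
  shows "simplicial_functor A B F"
  unfolding simplicial_functor_def by (intro conjI allI ballI; (rule assms; assumption)?)

lemma simplicial_functorD:
  assumes "simplicial_functor A B F"
  shows "simplicial_category A" "simplicial_category B"
    and "\<And>x. x \<in> SOb A \<Longrightarrow> SFOb F x \<in> SOb B"
    and "\<And>x y n f. \<lbrakk>x \<in> SOb A; y \<in> SOb A; f \<in> smp (SHom A x y) n\<rbrakk> \<Longrightarrow>
      SFAr F x y n f \<in> smp (SHom B (SFOb F x) (SFOb F y)) n"
    and "\<And>x y n f m \<theta>. \<lbrakk>x \<in> SOb A; y \<in> SOb A; f \<in> smp (SHom A x y) n; \<theta> \<in> dmap m n\<rbrakk> \<Longrightarrow>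
      SFAr F x y m (sop (SHom A x y) m n \<theta> f) =
        sop (SHom B (SFOb F x) (SFOb F y)) m n \<theta> (SFAr F x y n f)"
    and "\<And>x. x \<in> SOb A \<Longrightarrow> SFAr F x x 0 (SId A x) = SId B (SFOb F x)"
    and "\<And>x y z n f g. \<lbrakk>x \<in> SOb A; y \<in> SOb A; z \<in> SOb A; f \<in> smp (SHom A x y) n;
      g \<in> smp (SHom A y z) n\<rbrakk> \<Longrightarrow>
      SFAr F x z n (SCmp A x y z n g f) =
      SCmp B (SFOb F x) (SFOb F y) (SFOb F z) n (SFAr F y z n g) (SFAr F x y n f)"
  using assms unfolding simplicial_functor_def by simp_all

lemma opposite_simps [simp]:
  "SOb (opposite A) = SOb A" "SHom (opposite A) x y = SHom A y x"
  "SCmp (opposite A) x y z n g f = SCmp A z y x n f g" "SId (opposite A) = SId A"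
  by (simp_all add: opposite_def)

lemma simplicial_category_opposite:
  assumes "simplicial_category A" shows "simplicial_category (opposite A)"
  by (rule simplicial_categoryI; simp add: simplicial_categoryD[OF assms])

lemma simplicial_category_discrete:
  assumes "category C" shows "simplicial_category (discrete C)"
  by (rule simplicial_categoryI)
    (auto simp: discrete_def is_sset_def degen_def category_Idn[OF assms] category_Cmp[OF assms]
      category_Idn_left[OF assms] category_Idn_right[OF assms] intro: category_assoc[OF assms])

lemma category_Delta: "category Delta"
  unfolding category_def
  by (auto simp: Delta_def dmap_id dmap_compose dmap_compose_assoc)

lemma degen_SCmp:
  assumes A: "simplicial_category A" and "x \<in> SOb A" "y \<in> SOb A" "z \<in> SOb A"
    and "f \<in> smp (SHom A x y) 0" "g \<in> smp (SHom A y z) 0"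
  shows "degen (SHom A x z) n (SCmp A x y z 0 g f) =
    SCmp A x y z n (degen (SHom A y z) n g) (degen (SHom A x y) n f)"
  unfolding degen_def using assms by (intro simplicial_categoryD(4)[OF A] dmap_zero)

lemma SFAr_degen_SId:
  assumes F: "simplicial_functor A B F" and "x \<in> SOb A"
  shows "SFAr F x x n (degen (SHom A x x) n (SId A x)) =
    degen (SHom B (SFOb F x) (SFOb F x)) n (SId B (SFOb F x))"
  unfolding degen_def using assms simplicial_functorD[OF F] simplicial_categoryD(2)[of A]
  by (simp add: dmap_zero)

section \<open>Simplicial transformations and functor categories\<close>

lemma simplicial_natD:
  assumes "t \<in> simplicial_nat A B F G"
  shows "\<And>a. a \<in> SOb A \<Longrightarrow> t a \<in> smp (SHom B (SFOb F a) (SFOb G a)) 0"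
    and "\<And>a b n f. a \<in> SOb A \<Longrightarrow> b \<in> SOb A \<Longrightarrow> f \<in> smp (SHom A a b) n \<Longrightarrow>
        SCmp B (SFOb F a) (SFOb G a) (SFOb G b) n
          (SFAr G a b n f) (degen (SHom B (SFOb F a) (SFOb G a)) n (t a)) =
        SCmp B (SFOb F a) (SFOb F b) (SFOb G b) n
          (degen (SHom B (SFOb F b) (SFOb G b)) n (t b)) (SFAr F a b n f)"
    and "t \<in> extensional (SOb A)"
  using assms unfolding simplicial_nat_def by (auto simp: PiE_def)

lemma simplicial_natI:
  assumes "\<And>a. a \<in> SOb A \<Longrightarrow> t a \<in> smp (SHom B (SFOb F a) (SFOb G a)) 0"
    and "\<And>a b n f. a \<in> SOb A \<Longrightarrow> b \<in> SOb A \<Longrightarrow> f \<in> smp (SHom A a b) n \<Longrightarrow>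
        SCmp B (SFOb F a) (SFOb G a) (SFOb G b) n
          (SFAr G a b n f) (degen (SHom B (SFOb F a) (SFOb G a)) n (t a)) =
        SCmp B (SFOb F a) (SFOb F b) (SFOb G b) n
          (degen (SHom B (SFOb F b) (SFOb G b)) n (t b)) (SFAr F a b n f)"
    and "t \<in> extensional (SOb A)"
  shows "t \<in> simplicial_nat A B F G"
  using assms unfolding simplicial_nat_def by (auto simp: PiE_def)

lemma simplicial_nat_Idn:
  assumes F: "simplicial_functor A B F"
  shows "(\<lambda>a\<in>SOb A. SId B (SFOb F a)) \<in> simplicial_nat A B F F"
  using simplicial_categoryD[OF simplicial_functorD(2)[OF F]] simplicial_functorD[OF F]
  by (intro simplicial_natI) auto

text \<open>The naturality squares of \<open>t\<close> and \<open>s\<close> are pasted in each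
  degree; \<open>degen_SCmp\<close> identifies the degeneracy of the composite vertex with the
  composite of the degeneracies.\<close>

lemma simplicial_nat_Cmp:
  assumes F: "simplicial_functor A B F" and G: "simplicial_functor A B G" and H: "simplicial_functor
    A B H"
    and t: "t \<in> simplicial_nat A B F G" and s: "s \<in> simplicial_nat A B G H"
  shows "(\<lambda>a\<in>SOb A. SCmp B (SFOb F a) (SFOb G a) (SFOb H a) 0 (s a) (t a)) \<in> simplicial_nat A B F H"
proof (rule simplicial_natI)
  note B = simplicial_functorD(2)[OF F]
  note Bs = simplicial_categoryD[OF B]
  note FD = simplicial_functorD[OF F] and GD = simplicial_functorD[OF G] and HD =
    simplicial_functorD[OF H]
  show "(\<lambda>a\<in>SOb A. SCmp B (SFOb F a) (SFOb G a) (SFOb H a) 0 (s a) (t a)) a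
      \<in> smp (SHom B (SFOb F a) (SFOb H a)) 0" if "a \<in> SOb A" for a
    using that simplicial_natD(1)[OF t] simplicial_natD(1)[OF s] FD GD HD Bs by simp
  fix a b n f assume a: "a \<in> SOb A" and b: "b \<in> SOb A" and f: "f \<in> smp (SHom A a b) n"
  let ?Fa = "SFOb F a" and ?Fb = "SFOb F b" and ?Ga = "SFOb G a" and ?Gb = "SFOb G b"
    and ?Ha = "SFOb H a" and ?Hb = "SFOb H b"
  note ob = FD(3)[OF a] FD(3)[OF b] GD(3)[OF a] GD(3)[OF b] HD(3)[OF a] HD(3)[OF b]
  note ta = simplicial_natD(1)[OF t a] and tb = simplicial_natD(1)[OF t b]
    and sa = simplicial_natD(1)[OF s a] and sb = simplicial_natD(1)[OF s b]
  define dt where "dt c = degen (SHom B (SFOb F c) (SFOb G c)) n (t c)" for c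
  define ds where "ds c = degen (SHom B (SFOb G c) (SFOb H c)) n (s c)" for c
  have dt: "dt a \<in> smp (SHom B ?Fa ?Ga) n" "dt b \<in> smp (SHom B ?Fb ?Gb) n"
    and ds: "ds a \<in> smp (SHom B ?Ga ?Ha) n" "ds b \<in> smp (SHom B ?Gb ?Hb) n"
    unfolding dt_def ds_def using ta tb sa sb Bs(1) ob by (auto intro!: sset_degen)
  note Ff = FD(4)[OF a b f] and Gf = GD(4)[OF a b f] and Hf = HD(4)[OF a b f]
  have "SCmp B ?Fa ?Ha ?Hb n (SFAr H a b n f) (SCmp B ?Fa ?Ga ?Ha n (ds a) (dt a)) =
      SCmp B ?Fa ?Ga ?Hb n (SCmp B ?Ga ?Ha ?Hb n (SFAr H a b n f) (ds a)) (dt a)"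
    by (rule Bs(7)) (use ob dt ds Hf in auto)
  also have "SCmp B ?Ga ?Ha ?Hb n (SFAr H a b n f) (ds a) =
    SCmp B ?Ga ?Gb ?Hb n (ds b) (SFAr G a b n f)"
    unfolding ds_def by (rule simplicial_natD(2)[OF s a b f])
  also have "SCmp B ?Fa ?Ga ?Hb n (SCmp B ?Ga ?Gb ?Hb n (ds b) (SFAr G a b n f)) (dt a) =
      SCmp B ?Fa ?Gb ?Hb n (ds b) (SCmp B ?Fa ?Ga ?Gb n (SFAr G a b n f) (dt a))"
    by (rule Bs(7)[symmetric]) (use ob dt ds Gf in auto)
  also have "SCmp B ?Fa ?Ga ?Gb n (SFAr G a b n f) (dt a) =
    SCmp B ?Fa ?Fb ?Gb n (dt b) (SFAr F a b n f)"
    unfolding dt_def by (rule simplicial_natD(2)[OF t a b f])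
  also have "SCmp B ?Fa ?Gb ?Hb n (ds b) (SCmp B ?Fa ?Fb ?Gb n (dt b) (SFAr F a b n f)) =
      SCmp B ?Fa ?Fb ?Hb n (SCmp B ?Fb ?Gb ?Hb n (ds b) (dt b)) (SFAr F a b n f)"
    by (rule Bs(7)) (use ob dt ds Ff in auto)
  finally show "SCmp B ?Fa ?Ha ?Hb n (SFAr H a b n f) (degen (SHom B ?Fa ?Ha) n
        ((\<lambda>a\<in>SOb A. SCmp B (SFOb F a) (SFOb G a) (SFOb H a) 0 (s a) (t a)) a)) =
      SCmp B ?Fa ?Fb ?Hb n (degen (SHom B ?Fb ?Hb) n
        ((\<lambda>a\<in>SOb A. SCmp B (SFOb F a) (SFOb G a) (SFOb H a) 0 (s a) (t a)) b)) (SFAr F a b n f)"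
    using a b ob ta tb sa sb by (simp add: degen_SCmp[OF B] dt_def ds_def)
qed auto

lemma FunS_simps [simp]:
  "Ob (FunS A B) = {F. simplicial_functor A B F}" "Hom (FunS A B) = simplicial_nat A B"
  "Cmp (FunS A B) F G H s t = (\<lambda>a\<in>SOb A. SCmp B (SFOb F a) (SFOb G a) (SFOb H a) 0 (s a) (t a))"
  "Idn (FunS A B) F = (\<lambda>a\<in>SOb A. SId B (SFOb F a))"
  by (simp_all add: FunS_def)

lemma SCmp_SId_left:
  assumes A: "simplicial_category A" and "x \<in> SOb A" "y \<in> SOb A" "f \<in> smp (SHom A x y) 0"
  shows "SCmp A x y y 0 (SId A y) f = f"
  using simplicial_categoryD(5)[OF assms] degen_0[of "SHom A y y" "SId A y"] assms
    simplicial_categoryD(1,2)[OF A] by simp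

lemma SCmp_SId_right:
  assumes A: "simplicial_category A" and "x \<in> SOb A" "y \<in> SOb A" "f \<in> smp (SHom A x y) 0"
  shows "SCmp A x x y 0 f (SId A x) = f"
  using simplicial_categoryD(6)[OF assms] degen_0[of "SHom A x x" "SId A x"] assms
    simplicial_categoryD(1,2)[OF A] by simp

lemma category_FunS: "category (FunS A B)"
  unfolding category_def FunS_simps mem_Collect_eq
proof (intro conjI ballI; (unfold mem_Collect_eq)?)
  fix F assume "simplicial_functor A B F"
  then show "(\<lambda>a\<in>SOb A. SId B (SFOb F a)) \<in> simplicial_nat A B F F"
    by (rule simplicial_nat_Idn)
next
  fix F G H s t
  assume "simplicial_functor A B F" "simplicial_functor A B G" "simplicial_functor A B H"
    "t \<in> simplicial_nat A B F G" "s \<in> simplicial_nat A B G H"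
  then show "(\<lambda>a\<in>SOb A. SCmp B (SFOb F a) (SFOb G a) (SFOb H a) 0 (s a) (t a))
    \<in> simplicial_nat A B F H"
    by (rule simplicial_nat_Cmp)
next
  fix F G t
  assume F: "simplicial_functor A B F" and G: "simplicial_functor A B G" and t: "t
    \<in> simplicial_nat A B F G"
  note * = simplicial_functorD(2)[OF F] simplicial_functorD(3)[OF F] simplicial_functorD(3)[OF G]
    simplicial_natD[OF t]
  show "(\<lambda>a\<in>SOb A. SCmp B (SFOb F a) (SFOb G a) (SFOb G a) 0 ((\<lambda>a\<in>SOb A. SId B (SFOb G a)) a) (t a))
    = t"
    by (rule extensionalityI[of _ "SOb A"]) (auto simp: * SCmp_SId_left)
  show "(\<lambda>a\<in>SOb A. SCmp B (SFOb F a) (SFOb F a) (SFOb G a) 0 (t a) ((\<lambda>a\<in>SOb A. SId B (SFOb F a)) a))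
    = t"
    by (rule extensionalityI[of _ "SOb A"]) (auto simp: * SCmp_SId_right)
next
  fix F G H I r s t
  assume F: "simplicial_functor A B F" "simplicial_functor A B G" "simplicial_functor A B H"
    "simplicial_functor A B I" and t: "r \<in> simplicial_nat A B F G"  "s \<in> simplicial_nat A B G H"
    "t \<in> simplicial_nat A B H I"
  show "(\<lambda>a\<in>SOb A. SCmp B (SFOb F a) (SFOb H a) (SFOb I a) 0 (t a)
            ((\<lambda>a\<in>SOb A. SCmp B (SFOb F a) (SFOb G a) (SFOb H a) 0 (s a) (r a)) a)) =
        (\<lambda>a\<in>SOb A. SCmp B (SFOb F a) (SFOb G a) (SFOb I a) 0
            ((\<lambda>a\<in>SOb A. SCmp B (SFOb G a) (SFOb H a) (SFOb I a) 0 (t a) (s a)) a) (r a))"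
    using F[THEN simplicial_functorD(3)] t[THEN simplicial_natD(1)]
    by (intro restrict_ext) (simp add: simplicial_categoryD(7)[OF simplicial_functorD(2)[OF F(1)]])
qed

section \<open>Presheaves and restriction\<close>

lemma presheaves_simps [simp]:
  "Ob (presheaves T A) = {F. simplicial_functor (opposite A) (sSet T) F}"
  "Hom (presheaves T A) = simplicial_nat (opposite A) (sSet T)"
  "Cmp (presheaves T A) F G H s t =
    (\<lambda>a\<in>SOb A. SCmp (sSet T) (SFOb F a) (SFOb G a) (SFOb H a) 0 (s a) (t a))"
  "Idn (presheaves T A) F = (\<lambda>a\<in>SOb A. SId (sSet T) (SFOb F a))"
  "weq (presheaves T A) F G t = (\<forall>a\<in>SOb A.
      weak_equivalence (SFOb F a) (SFOb G a) (underlying_map (SFOb F a) (t a)))"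
  "fib (presheaves T A) F G t = (\<forall>a\<in>SOb A.
      kan_fibration (SFOb F a) (SFOb G a) (underlying_map (SFOb F a) (t a)))"
  by (simp_all add: presheaves_def cat.defs FunS_def)

lemma category_presheaves: "category (presheaves T A)"
  using category_FunS[of "opposite A" "sSet T"] unfolding category_def by simp

lemma restriction_simps [simp]:
  "SFOb (FOb (restriction A j) F) a = SFOb F (SFOb j a)"
  "SFAr (FOb (restriction A j) F) a b n f = SFAr F (SFOb j a) (SFOb j b) n (SFAr j b a n f)"
  "FAr (restriction A j) F G t = (\<lambda>a\<in>SOb A. t (SFOb j a))"
  by (simp_all add: restriction_def)

lemma simplicial_functor_restriction:
  assumes j: "simplicial_functor A B j" and F: "simplicial_functor (opposite B) C F"
  shows "simplicial_functor (opposite A) C (FOb (restriction A j) F)"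
proof -
  note jD = simplicial_functorD[OF j] and FD = simplicial_functorD[OF F, simplified]
  show ?thesis
    by (rule simplicial_functorI; simp add: jD FD simplicial_category_opposite)
qed

lemma simplicial_nat_restriction:
  assumes j: "simplicial_functor A B j" and t: "t \<in> simplicial_nat (opposite B) C F G"
  shows "FAr (restriction A j) F G t \<in> simplicial_nat (opposite A) C (FOb (restriction A j) F) (FOb
    (restriction A j) G)"
proof -
  note jD = simplicial_functorD[OF j] and tD = simplicial_natD[OF t, simplified]
  show ?thesis
    by (rule simplicial_natI; simp add: jD tD)
qed

lemma is_functor_restriction:
  assumes j: "simplicial_functor A B j"
  shows "is_functor (presheaves T B) (presheaves T A) (restriction A j)"
  unfolding is_functor_def
  using simplicial_functorD(3)[OF j]
  by (auto simp: category_presheaves simplicial_functor_restriction[OF j] fun_eq_iff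
      simp del: restriction_simps(3) intro: simplicial_nat_restriction[OF j])
    (auto simp: restrict_def)


section \<open>Simplicial functors as actions\<close>

text \<open>A \<open>p\<close>-simplex \<open>f\<close> of the Hom space is sent to a map from the
  product of \<open>F a\<close> with the standard \<open>p\<close>-simplex. Evaluating it at the
  fundamental simplex, the identity of \<open>[p]\<close>, lets \<open>f\<close> act on the
  \<open>p\<close>-simplices of \<open>F a\<close>.\<close>

definition act :: "('o, 's, 'v sset, 'v msimp) sfun \<Rightarrow> 'o \<Rightarrow> 'o \<Rightarrow> nat \<Rightarrow> 's \<Rightarrow> 'v \<Rightarrow> 'v" where
  "act F a b p f x = SFAr F a b p f p (x, \<lambda>i\<in>{..p}. i)"

context
  fixes A :: "('o, 's) scat" and F :: "('o, 's, 'v sset, 'v msimp) sfun" and T :: "'v itself"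
  assumes F: "simplicial_functor A (sSet T) F"
begin

lemma functor_sset: "a \<in> SOb A \<Longrightarrow> is_sset (SFOb F a)"
  using simplicial_functorD(3)[OF F] by simp

text \<open>Yoneda: the value at \<open>\<phi>\<close> is the value at the fundamental simplex after
  restricting \<open>f\<close> along \<open>\<phi>\<close>. Hence \<open>act\<close> determines
  \<open>SFAr\<close>.\<close>

lemma SFAr_act:
  assumes "a \<in> SOb A" "b \<in> SOb A" "f \<in> smp (SHom A a b) n" "x \<in> smp (SFOb F a) p" "\<phi> \<in> dmap p n"
  shows "SFAr F a b n f p (x, \<phi>) = act F a b p (sop (SHom A a b) p n \<phi> f) x"
  using simplicial_functorD(5)[OF F assms(1,2,3,5)] assms(4,5)
  by (simp add: act_def sop_mapping_space dmap_id)

lemma act_closed: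
  assumes "a \<in> SOb A" "b \<in> SOb A" "f \<in> smp (SHom A a b) p" "x \<in> smp (SFOb F a) p"
  shows "act F a b p f x \<in> smp (SFOb F b) p"
  unfolding act_def
  using mapping_space_closed[OF simplicial_functorD(4)[OF F assms(1-3),
    simplified] assms(4) dmap_id] .

lemma act_sop:
  assumes "a \<in> SOb A" "b \<in> SOb A" "f \<in> smp (SHom A a b) n" "x \<in> smp (SFOb F a) n" "\<theta> \<in> dmap m n"
  shows "sop (SFOb F b) m n \<theta> (act F a b n f x) =
    act F a b m (sop (SHom A a b) m n \<theta> f) (sop (SFOb F a) m n \<theta> x)"
  using mapping_space_nat[OF simplicial_functorD(4)[OF F assms(1-3), simplified] assms(5,4) dmap_id]
    SFAr_act[OF assms(1-3) sset_sop[OF functor_sset[OF assms(1)] assms(5,4)] assms(5)] assms(5)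
  by (simp add: act_def)

lemma act_degen_SId:
  assumes "a \<in> SOb A" "x \<in> smp (SFOb F a) n"
  shows "act F a a n (degen (SHom A a a) n (SId A a)) x = x"
  using assms functor_sset[OF assms(1)]
  by (simp add: act_def SFAr_degen_SId[OF F] degen_SId_sSet dmap_id)

lemma act_SCmp:
  assumes "a \<in> SOb A" "b \<in> SOb A" "c \<in> SOb A" "f \<in> smp (SHom A a b) n" "g \<in> smp (SHom A b c) n"
    and "x \<in> smp (SFOb F a) n"
  shows "act F a c n (SCmp A a b c n g f) x = act F b c n g (act F a b n f x)"
  using assms by (simp add: act_def simplicial_functorD(7)[OF F] SCmp_sSet dmap_id)

end

text \<open>The formula of \<open>SFAr_act\<close> read backwards. It rebuilds a simplicial functor
  from a degreewise action, the form in which the Kan extension is obtained.\<close>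

definition functor_of_action ::
    "('o, 's) scat \<Rightarrow> ('o \<Rightarrow> 'v sset) \<Rightarrow> ('o \<Rightarrow> 'o \<Rightarrow> nat \<Rightarrow> 's \<Rightarrow> 'v \<Rightarrow> 'v) \<Rightarrow>
     ('o, 's, 'v sset, 'v msimp) sfun" where
  "functor_of_action A S \<alpha> = \<lparr>SFOb = S,
    SFAr = (\<lambda>a b n f. mapping_simplex (S a) n (\<lambda>p x \<phi>. \<alpha> a b p (sop (SHom A a b) p n \<phi> f) x))\<rparr>"

lemma SFOb_functor_of_action [simp]: "SFOb (functor_of_action A S \<alpha>) = S"
  by (simp add: functor_of_action_def)

lemma simplicial_functor_of_action:
  assumes A: "simplicial_category A" and S: "\<And>a. a \<in> SOb A \<Longrightarrow> is_sset (S a)"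
    and cl: "\<And>a b n f x. \<lbrakk>a \<in> SOb A; b \<in> SOb A; f \<in> smp (SHom A a b) n; x \<in> smp (S a) n\<rbrakk> \<Longrightarrow>
      \<alpha> a b n f x \<in> smp (S b) n"
    and nat: "\<And>a b n f x m \<theta>. \<lbrakk>a \<in> SOb A; b \<in> SOb A; f \<in> smp (SHom A a b) n; x \<in> smp (S a) n;
      \<theta> \<in> dmap m n\<rbrakk> \<Longrightarrow>
      sop (S b) m n \<theta> (\<alpha> a b n f x) = \<alpha> a b m (sop (SHom A a b) m n \<theta> f) (sop (S a) m n \<theta> x)"
    and id: "\<And>a n x. \<lbrakk>a \<in> SOb A; x \<in> smp (S a) n\<rbrakk> \<Longrightarrow>
      \<alpha> a a n (degen (SHom A a a) n (SId A a)) x = x"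
    and comp: "\<And>a b c n f g x. \<lbrakk>a \<in> SOb A; b \<in> SOb A; c \<in> SOb A; f \<in> smp (SHom A a b) n;
      g \<in> smp (SHom A b c) n; x \<in> smp (S a) n\<rbrakk> \<Longrightarrow>
      \<alpha> a c n (SCmp A a b c n g f) x = \<alpha> b c n g (\<alpha> a b n f x)"
  shows "simplicial_functor A (sSet T) (functor_of_action A S \<alpha>)"
proof (rule simplicial_functorI)
  let ?F = "functor_of_action A S \<alpha>"
  note AD = simplicial_categoryD[OF A]
  show "simplicial_category A" by fact
  show "simplicial_category (sSet T)" by (rule simplicial_category_sSet)
  show "SFOb ?F a \<in> SOb (sSet T)" if "a \<in> SOb A" for a
    using S that by simp
  show "SFAr ?F a a 0 (SId A a) = SId (sSet T) (SFOb ?F a)" if a: "a \<in> SOb A" for a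
  proof -
    \<comment> \<open>\<open>[0]\<close> receives a single map from \<open>[p]\<close>, so every
      restriction of the unit vertex is its degeneracy and \<open>id\<close> applies.\<close>
    have "\<alpha> a a p (sop (SHom A a a) p 0 \<phi> (SId A a)) x = x"
      if "x \<in> smp (S a) p" "\<phi> \<in> dmap p 0" for p x \<phi>
      using id[OF a that(1)] dmap_to_0[OF that(2)] by (simp add: degen_def)
    then show ?thesis
      unfolding SId_sSet by (auto simp: functor_of_action_def intro!: mapping_simplex_cong)
  qed
  show "SFAr ?F a b n f \<in> smp (SHom (sSet T) (SFOb ?F a) (SFOb ?F b)) n"
    if ab: "a \<in> SOb A" "b \<in> SOb A" and f: "f \<in> smp (SHom A a b) n" for a b n f
    unfolding functor_of_action_def sSet_simps sfun.simps
    using sset_sop[OF AD(1)[OF ab]] f nat[OF ab] sset_compose[OF AD(1)[OF ab] _ _ f]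
    by (intro mapping_simplexI) (auto simp: S ab cl)
  show "SFAr ?F a b m (sop (SHom A a b) m n \<theta> f) =
        sop (SHom (sSet T) (SFOb ?F a) (SFOb ?F b)) m n \<theta> (SFAr ?F a b n f)"
    if ab: "a \<in> SOb A" "b \<in> SOb A" and f: "f \<in> smp (SHom A a b) n" and "\<theta> \<in> dmap m n"
      for a b n f m \<theta>
    unfolding sSet_simps sop_mapping_space
    using that sset_compose[OF AD(1)[OF ab] _ _ f]
    by (auto simp: functor_of_action_def dmap_compose intro!: mapping_simplex_cong)
  show "SFAr ?F a c n (SCmp A a b c n g f) =
      SCmp (sSet T) (SFOb ?F a) (SFOb ?F b) (SFOb ?F c) n (SFAr ?F b c n g) (SFAr ?F a b n f)"
    if "a \<in> SOb A" "b \<in> SOb A" "c \<in> SOb A" "f \<in> smp (SHom A a b) n" "g \<in> smp (SHom A b c) n"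
      for a b c n f g
    unfolding SCmp_sSet using that sset_sop[OF AD(1)]
    by (auto simp: functor_of_action_def AD(4) cl comp intro!: mapping_simplex_cong)
qed

lemma act_functor_of_action:
  assumes "is_sset (SHom A a b)" "f \<in> smp (SHom A a b) n" "x \<in> smp (S a) n"
  shows "act (functor_of_action A S \<alpha>) a b n f x = \<alpha> a b n f x"
  using assms by (simp add: act_def functor_of_action_def dmap_id sset_id)

section \<open>Vertices of mapping spaces as simplicial maps\<close>

lemma underlying_map_apply: "x \<in> smp X p \<Longrightarrow> underlying_map X t p x = t p (x, \<lambda>i\<in>{..p}. 0)"
  by (simp add: underlying_map_def)

lemma vertex_apply:
  "x \<in> smp X p \<Longrightarrow> \<phi> \<in> dmap p 0 \<Longrightarrow> t p (x, \<phi>) = underlying_map X t p x"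
  using dmap_to_0[of \<phi> p] by (simp add: underlying_map_def)

text \<open>Naturality is an equation between simplices of a mapping space. Evaluated at
  \<open>(x, \<phi>)\<close> it is equivariance under the restriction of \<open>f\<close> along
  \<open>\<phi>\<close>; the case of the identity \<open>\<phi>\<close>, for all \<open>f\<close> in
  all degrees, contains the others.\<close>

lemma simplicial_nat_sSet_iff:
  assumes F: "simplicial_functor A (sSet T) F" and G: "simplicial_functor A (sSet T) G"
  shows "t \<in> simplicial_nat A (sSet T) F G \<longleftrightarrow> t \<in> extensional (SOb A) \<and>
    (\<forall>a\<in>SOb A. t a \<in> smp (mapping_space (SFOb F a) (SFOb G a)) 0) \<and>
    (\<forall>a\<in>SOb A. \<forall>b\<in>SOb A. \<forall>n. \<forall>f\<in>smp (SHom A a b) n. \<forall>x\<in>smp (SFOb F a) n.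
      underlying_map (SFOb F b) (t b) n (act F a b n f x) =
      act G a b n f (underlying_map (SFOb F a) (t a) n x))" (is "?L \<longleftrightarrow> ?R")
proof -
  have A: "simplicial_category A" using simplicial_functorD(1)[OF F] .
  have key: "SCmp (sSet T) (SFOb F a) (SFOb G a) (SFOb G b) n
          (SFAr G a b n f) (degen (mapping_space (SFOb F a) (SFOb G a)) n (t a)) =
        SCmp (sSet T) (SFOb F a) (SFOb F b) (SFOb G b) n
          (degen (mapping_space (SFOb F b) (SFOb G b)) n (t b)) (SFAr F a b n f) \<longleftrightarrow>
      (\<forall>p \<phi>. \<forall>x\<in>smp (SFOb F a) p. \<phi> \<in> dmap p n \<longrightarrow>
      underlying_map (SFOb F b) (t b) p (act F a b p (sop (SHom A a b) p n \<phi> f) x) =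
      act G a b p (sop (SHom A a b) p n \<phi> f) (underlying_map (SFOb F a) (t a) p x))" (is "?l = ?r \<longleftrightarrow>
        ?s")
    if ta: "t a \<in> smp (mapping_space (SFOb F a) (SFOb G a)) 0"
    and tb: "t b \<in> smp (mapping_space (SFOb F b) (SFOb G b)) 0"
    and ab: "a \<in> SOb A" "b \<in> SOb A" and f: "f \<in> smp (SHom A a b) n" for a b n f
  proof -
    have fp: "sop (SHom A a b) p n \<phi> f \<in> smp (SHom A a b) p" if "\<phi> \<in> dmap p n" for p \<phi>
      by (rule sset_sop[OF simplicial_categoryD(1)[OF A ab] that f])
    have l: "?l = mapping_simplex (SFOb F a) n (\<lambda>p x \<phi>.
        act G a b p (sop (SHom A a b) p n \<phi> f) (underlying_map (SFOb F a) (t a) p x))"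
      unfolding SCmp_sSet degen_def sop_mapping_space
      using mapping_space_closed[OF ta]
      by (intro mapping_simplex_cong)
        (simp add: underlying_map_apply dmap_zero SFAr_act[OF G ab f])
    have r: "?r = mapping_simplex (SFOb F a) n (\<lambda>p x \<phi>.
        underlying_map (SFOb F b) (t b) p (act F a b p (sop (SHom A a b) p n \<phi> f) x))"
      unfolding SCmp_sSet degen_def sop_mapping_space
      using act_closed[OF F ab fp]
      by (intro mapping_simplex_cong)
        (simp add: underlying_map_apply dmap_zero SFAr_act[OF F ab f])
    show ?thesis
    proof
      assume eq: "?l = ?r"
      show ?s
      proof (intro allI ballI impI)
        fix p x \<phi> assume "x \<in> smp (SFOb F a) p" "\<phi> \<in> dmap p n"
        then show "underlying_map (SFOb F b) (t b) p (act F a b p (sop (SHom A a b) p n \<phi> f) x) =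
            act G a b p (sop (SHom A a b) p n \<phi> f) (underlying_map (SFOb F a) (t a) p x)"
          using fun_cong[OF fun_cong[OF eq[unfolded l r]], of p "(x, \<phi>)"] by simp
      qed
    next
      assume ?s
      then show "?l = ?r" unfolding l r by (intro mapping_simplex_cong) auto
    qed
  qed
  show ?thesis
  proof
    assume t: ?L
    note tD = simplicial_natD[OF t, simplified]
    have "underlying_map (SFOb F b) (t b) n (act F a b n f x) =
      act G a b n f (underlying_map (SFOb F a) (t a) n x)"
      if ab: "a \<in> SOb A" "b \<in> SOb A" and f: "f \<in> smp (SHom A a b) n" and x: "x \<in> smp (SFOb F a) n"
      for a b n f x
      using key[THEN iffD1, OF tD(1)[OF ab(1)] tD(1)[OF ab(2)] ab f tD(2)[OF ab f]] x dmap_id[of n]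
        sset_id[OF simplicial_categoryD(1)[OF A ab] f] by metis
    then show ?R using tD by blast
  next
    assume R: ?R
    show ?L
    proof (rule simplicial_natI)
      fix a b n f assume ab: "a \<in> SOb A" "b \<in> SOb A" and f: "f \<in> smp (SHom A a b) n"
      show "SCmp (sSet T) (SFOb F a) (SFOb G a) (SFOb G b) n
          (SFAr G a b n f) (degen (SHom (sSet T) (SFOb F a) (SFOb G a)) n (t a)) =
        SCmp (sSet T) (SFOb F a) (SFOb F b) (SFOb G b) n
          (degen (SHom (sSet T) (SFOb F b) (SFOb G b)) n (t b)) (SFAr F a b n f)"
        unfolding sSet_simps
        by (rule key[THEN iffD2]) (use R ab f sset_sop[OF simplicial_categoryD(1)[OF A ab]] in auto)
    qed (use R in auto)
  qed
qed

text \<open>A vertex of a mapping space is a simplicial map with a dummy argument in the standard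
  \<open>0\<close>-simplex; this inserts the argument that \<open>underlying_map\<close>
  removes.\<close>

definition vertex_map :: "'v sset \<Rightarrow> (nat \<Rightarrow> 'v \<Rightarrow> 'v) \<Rightarrow> 'v msimp" where
  "vertex_map X u = mapping_simplex X 0 (\<lambda>p x \<phi>. u p x)"

lemma vertex_map_closed:
  assumes "is_sset X" "\<And>p x. x \<in> smp X p \<Longrightarrow> u p x \<in> smp Y p"
    and "\<And>q p \<psi> x. \<psi> \<in> dmap q p \<Longrightarrow> x \<in> smp X p \<Longrightarrow> u q (sop X q p \<psi> x) = sop Y q p \<psi> (u p x)"
  shows "vertex_map X u \<in> smp (mapping_space X Y) 0"
  unfolding vertex_map_def using assms by (intro mapping_simplexI)

lemma underlying_map_vertex_map [simp]:
  "x \<in> smp X p \<Longrightarrow> underlying_map X (vertex_map X u) p x = u p x"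
  by (simp add: underlying_map_def vertex_map_def dmap_zero)

lemma underlying_map_closed:
  "t \<in> smp (mapping_space X Y) 0 \<Longrightarrow> x \<in> smp X p \<Longrightarrow> underlying_map X t p x \<in> smp Y p"
  by (simp add: underlying_map_def mapping_space_closed dmap_zero)

lemma underlying_map_sop:
  "t \<in> smp (mapping_space X Y) 0 \<Longrightarrow> is_sset X \<Longrightarrow> \<psi> \<in> dmap q p \<Longrightarrow> x \<in> smp X p \<Longrightarrow>
    underlying_map X t q (sop X q p \<psi> x) = sop Y q p \<psi> (underlying_map X t p x)"
  using mapping_space_nat[of t X Y 0 \<psi> q p x "\<lambda>i\<in>{..p}. 0"]
  by (simp add: underlying_map_def sset_sop dmap_zero)

lemma underlying_map_SCmp:
  "t \<in> smp (mapping_space X Y) 0 \<Longrightarrow> x \<in> smp X p \<Longrightarrow>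
    underlying_map X (SCmp (sSet T) X Y Z 0 s t) p x
      = underlying_map Y s p (underlying_map X t p x)"
  by (simp add: underlying_map_def SCmp_sSet mapping_space_closed dmap_zero)

lemma underlying_map_ext:
  assumes "s \<in> smp (mapping_space X Y) 0" "t \<in> smp (mapping_space X Y) 0"
    and "\<And>p x. x \<in> smp X p \<Longrightarrow> underlying_map X s p x = underlying_map X t p x"
  shows "s = t"
  using assms(1,2) by (rule mapping_space_ext) (simp add: vertex_apply assms(3))

lemma simplicial_nat_sSetD:
  assumes "simplicial_functor A (sSet T) F" "simplicial_functor A (sSet T) G"
    and "t \<in> simplicial_nat A (sSet T) F G"
  shows "\<And>a. a \<in> SOb A \<Longrightarrow> t a \<in> smp (mapping_space (SFOb F a) (SFOb G a)) 0"
    and "\<And>a b n f x. \<lbrakk>a \<in> SOb A; b \<in> SOb A; f \<in> smp (SHom A a b) n; x \<in> smp (SFOb F a) n\<rbrakk> \<Longrightarrow>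
      underlying_map (SFOb F b) (t b) n (act F a b n f x) =
      act G a b n f (underlying_map (SFOb F a) (t a) n x)"
  using assms(3) unfolding simplicial_nat_sSet_iff[OF assms(1,2)] by simp_all


section \<open>Left Kan extension of presheaves\<close>

text \<open>The left Kan extension of \<open>X\<close> along \<open>j\<close> is computed levelwise: its \<open>p\<close>-simplices at \<open>b\<close> are
  the triples \<open>(a, h, x)\<close> with \<open>h : b \<rightarrow> j a\<close> and \<open>x \<in> X a\<close> in degree \<open>p\<close>, modulo
  \<open>(a', j \<theta> \<circ> h, x) \<sim> (a, h, \<theta>\<^sup>* x)\<close>. The encoding \<open>enc\<close> stores a representative of each class in
  the universe \<open>'v\<close>.\<close>

locale left_kan =
  fixes A :: "('o, 's) scat" and B :: "('q, 't) scat" and j :: "('o, 's, 'q, 't) sfun"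
    and X :: "('o, 's, 'v sset, 'v msimp) sfun" and T :: "'v itself"
    and enc :: "'o \<times> 't \<times> 'v \<Rightarrow> 'v"
  assumes j: "simplicial_functor A B j"
    and X: "simplicial_functor (opposite A) (sSet T) X"
    and enc: "inj_on enc (SOb A \<times> (\<Union>x\<in>SOb B. \<Union>y\<in>SOb B. \<Union>n. smp (SHom B x y) n) \<times> UNIV)"
begin

lemmas A = simplicial_functorD(1)[OF j]
lemmas B = simplicial_functorD(2)[OF j]
lemmas Bs = simplicial_categoryD[OF B]
lemmas jD = simplicial_functorD[OF j]
lemmas X_sset = functor_sset[OF X, simplified]
lemmas X_act = act_closed[OF X, simplified] act_sop[OF X, simplified]

section \<open>The quotient of triples and its encoding\<close>

definition triples :: "'q \<Rightarrow> nat \<Rightarrow> ('o \<times> 't \<times> 'v) set" where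
  "triples b p = {(a, h, x). a \<in> SOb A \<and> h \<in> smp (SHom B b (SFOb j a)) p \<and> x \<in> smp (SFOb X a) p}"

inductive glue :: "'q \<Rightarrow> nat \<Rightarrow> 'o \<times> 't \<times> 'v \<Rightarrow> 'o \<times> 't \<times> 'v \<Rightarrow> bool" for b p where
  "\<lbrakk>a \<in> SOb A; a' \<in> SOb A; \<theta> \<in> smp (SHom A a a') p; h \<in> smp (SHom B b (SFOb j a)) p;
    x \<in> smp (SFOb X a') p\<rbrakk> \<Longrightarrow>
    glue b p (a', SCmp B b (SFOb j a) (SFOb j a') p (SFAr j a a' p \<theta>) h, x) (a, h,
      act X a' a p \<theta> x)"

text \<open>\<open>SOME\<close> sees only the predicate of the equivalence class, so equivalent
  triples receive the same representative; its encoding names the class in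
  \<open>'v\<close>.\<close>

definition code :: "'q \<Rightarrow> nat \<Rightarrow> 'o \<times> 't \<times> 'v \<Rightarrow> 'v" where
  "code b p t = enc (SOME s. equivclp (glue b p) t s)"

definition uncode :: "'q \<Rightarrow> nat \<Rightarrow> 'v \<Rightarrow> 'o \<times> 't \<times> 'v" where
  "uncode b p v = (SOME t. t \<in> triples b p \<and> code b p t = v)"

lemma glue_triples: "b \<in> SOb B \<Longrightarrow> glue b p s t \<Longrightarrow> s \<in> triples b p \<and> t \<in> triples b p"
  by (erule glue.cases) (simp add: triples_def jD Bs X_act)

lemma equivclp_triples:
  assumes "b \<in> SOb B" "equivclp (glue b p) s t"
  shows "s \<in> triples b p \<longleftrightarrow> t \<in> triples b p"
  using assms(2)
proof (induction rule: equivclp_induct)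
  case (step y z)
  then show ?case using glue_triples[OF assms(1)] by blast
qed auto

lemma code_cong: "equivclp (glue b p) s t \<Longrightarrow> code b p s = code b p t"
proof -
  assume "equivclp (glue b p) s t"
  then have "equivclp (glue b p) s = equivclp (glue b p) t"
    by (intro ext iffI) (blast intro: equivclp_sym equivclp_trans)+
  then show ?thesis by (simp add: code_def)
qed

text \<open>The chosen representatives stay in \<open>triples b p\<close>, because gluing preserves
  that set, and there \<open>enc\<close> is injective.\<close>

lemma code_inject:
  assumes b: "b \<in> SOb B" and s: "s \<in> triples b p" and t: "t \<in> triples b p" and eq: "code b p s =
    code b p t"
  shows "equivclp (glue b p) s t"
proof -
  define s' where "s' = (SOME u. equivclp (glue b p) s u)"
  define t' where "t' = (SOME u. equivclp (glue b p) t u)"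
  have s': "equivclp (glue b p) s s'" and t': "equivclp (glue b p) t t'"
    unfolding s'_def t'_def by (rule someI, rule equivclp_refl)+
  have *: "triples b p \<subseteq> SOb A \<times> (\<Union>x\<in>SOb B. \<Union>y\<in>SOb B. \<Union>n. smp (SHom B x y) n) \<times> UNIV"
    using b jD(3) by (auto simp: triples_def)
  have "s' = t'"
  proof (rule inj_onD[OF enc])
    show "enc s' = enc t'" using eq by (simp add: code_def s'_def t'_def)
  qed (use * equivclp_triples[OF b s'] equivclp_triples[OF b t'] s t in auto)
  then show ?thesis using s' t' equivclp_sym equivclp_trans by metis
qed

lemma uncode_code:
  assumes "b \<in> SOb B" "t \<in> triples b p"
  shows "uncode b p (code b p t) \<in> triples b p" "equivclp (glue b p) t (uncode b p (code b p t))"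
proof -
  have *: "uncode b p (code b p t) \<in> triples b p \<and> code b p (uncode b p (code b p t)) = code b p t"
    unfolding uncode_def by (rule someI[of _ t]) (use assms in simp)
  then show "uncode b p (code b p t) \<in> triples b p" by blast
  show "equivclp (glue b p) t (uncode b p (code b p t))"
    by (rule code_inject) (use assms * in auto)
qed

text \<open>The universal property of the quotient: a function invariant under single gluings may be
  computed on any representative.\<close>

lemma lift_code:
  assumes "\<And>s t. glue b p s t \<Longrightarrow> f s = f t" and b: "b \<in> SOb B" and t: "t \<in> triples b p"
  shows "f (uncode b p (code b p t)) = f t"
  using uncode_code(2)[OF b t]
proof (induction rule: equivclp_induct)
  case (step y z)
  then show ?case using assms(1) by metis
qed simp

section \<open>Simplicial operators and the action of Hom spaces on classes\<close>

definition tri_sop :: "'q \<Rightarrow> nat \<Rightarrow> nat \<Rightarrow> (nat \<Rightarrow> nat) \<Rightarrow> 'o \<times> 't \<times> 'v \<Rightarrow> 'o \<times> 't \<times> 'v" where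
  "tri_sop b m n \<phi> = (\<lambda>(a, h, x). (a, sop (SHom B b (SFOb j a)) m n \<phi> h, sop (SFOb X a) m n \<phi> x))"

definition tri_act :: "'q \<Rightarrow> 'q \<Rightarrow> nat \<Rightarrow> 't \<Rightarrow> 'o \<times> 't \<times> 'v \<Rightarrow> 'o \<times> 't \<times> 'v" where
  "tri_act b b' p g = (\<lambda>(a, h, x). (a, SCmp B b' b (SFOb j a) p h g, x))"

lemma tri_sop_closed:
  "b \<in> SOb B \<Longrightarrow> \<phi> \<in> dmap m n \<Longrightarrow> t \<in> triples b n \<Longrightarrow> tri_sop b m n \<phi> t \<in> triples b m"
  by (auto simp: triples_def tri_sop_def jD intro!: sset_sop Bs(1) X_sset)

lemma tri_act_closed:
  "b \<in> SOb B \<Longrightarrow> b' \<in> SOb B \<Longrightarrow> g \<in> smp (SHom B b' b) p \<Longrightarrow> t \<in> triples b p \<Longrightarrow>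
    tri_act b b' p g t \<in> triples b' p"
  by (auto simp: triples_def tri_act_def jD Bs)

text \<open>Restrict \<open>\<theta>\<close> along \<open>\<phi>\<close> together with
  \<open>h\<close> and \<open>x\<close>: the result is again an instance of the gluing, as
  composition, \<open>j\<close> and \<open>act\<close> commute with the operators.\<close>

lemma glue_sop:
  assumes b: "b \<in> SOb B" and \<phi>: "\<phi> \<in> dmap m n" and "glue b n s t"
  shows "glue b m (tri_sop b m n \<phi> s) (tri_sop b m n \<phi> t)"
  using assms(3)
proof cases
  case (1 a a' \<theta> h x)
  have "glue b m (a', SCmp B b (SFOb j a) (SFOb j a') m (SFAr j a a' m (sop (SHom A a a') m n \<phi> \<theta>))
      (sop (SHom B b (SFOb j a)) m n \<phi> h), sop (SFOb X a') m n \<phi> x)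
    (a, sop (SHom B b (SFOb j a)) m n \<phi> h, act X a' a m (sop (SHom A a a') m n \<phi> \<theta>) (sop (SFOb X a')
      m n \<phi> x))"
    using 1 b \<phi> by (intro glue.intros sset_sop simplicial_categoryD(1)[OF A] X_sset Bs(1) jD) auto
  then show ?thesis
    using 1 b \<phi> by (simp add: tri_sop_def Bs jD X_act)
qed

text \<open>\<open>g\<close> acts on \<open>h\<close> by precomposition and the gluing by
  postcomposition, so associativity makes them commute.\<close>

lemma glue_act:
  assumes b: "b \<in> SOb B" and b': "b' \<in> SOb B" and g: "g \<in> smp (SHom B b' b) p" and "glue b p s t"
  shows "glue b' p (tri_act b b' p g s) (tri_act b b' p g t)"
  using assms(4)
proof cases
  case (1 a a' \<theta> h x)
  have "glue b' p (a', SCmp B b' (SFOb j a) (SFOb j a') p (SFAr j a a' p \<theta>)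
      (SCmp B b' b (SFOb j a) p h g), x) (a, SCmp B b' b (SFOb j a) p h g, act X a' a p \<theta> x)"
    using 1 b b' g by (intro glue.intros Bs(3) jD) auto
  moreover have "SCmp B b' (SFOb j a) (SFOb j a') p (SFAr j a a' p \<theta>) (SCmp B b' b (SFOb j a) p h g)
    =
      SCmp B b' b (SFOb j a') p (SCmp B b (SFOb j a) (SFOb j a') p (SFAr j a a' p \<theta>) h) g"
    using 1 b b' g by (intro Bs(7) jD) auto
  ultimately show ?thesis
    using 1 by (simp add: tri_act_def)
qed

definition lan_ob :: "'q \<Rightarrow> 'v sset" where
  "lan_ob b = \<lparr>smp = (\<lambda>p. code b p ` triples b p),
    sop = (\<lambda>m n \<phi> v. code b m (tri_sop b m n \<phi> (uncode b n v)))\<rparr>"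

definition lan_act :: "'q \<Rightarrow> 'q \<Rightarrow> nat \<Rightarrow> 't \<Rightarrow> 'v \<Rightarrow> 'v" where
  "lan_act b b' p g v = code b' p (tri_act b b' p g (uncode b p v))"

definition lan :: "('q, 't, 'v sset, 'v msimp) sfun" where
  "lan = functor_of_action (opposite B) lan_ob lan_act"

lemma smp_lan_ob: "smp (lan_ob b) p = code b p ` triples b p"
  by (simp add: lan_ob_def)

lemma sop_lan_ob:
  assumes "b \<in> SOb B" "\<phi> \<in> dmap m n" "t \<in> triples b n"
  shows "sop (lan_ob b) m n \<phi> (code b n t) = code b m (tri_sop b m n \<phi> t)"
  unfolding lan_ob_def sset.simps
  by (rule lift_code) (auto intro!: code_cong r_into_equivclp glue_sop assms)

lemma lan_act_code:
  assumes "b \<in> SOb B" "b' \<in> SOb B" "g \<in> smp (SHom B b' b) p" "t \<in> triples b p"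
  shows "lan_act b b' p g (code b p t) = code b' p (tri_act b b' p g t)"
  unfolding lan_act_def
  by (rule lift_code) (auto intro!: code_cong r_into_equivclp glue_act assms)

lemma lan_ob_sset:
  assumes b: "b \<in> SOb B" shows "is_sset (lan_ob b)"
proof (rule is_ssetI; unfold smp_lan_ob; erule imageE; simp only:)
  show "sop (lan_ob b) m n \<phi> (code b n t) \<in> code b m ` triples b m"
    if "\<phi> \<in> dmap m n" "t \<in> triples b n" for m n \<phi> t
    using that by (simp add: sop_lan_ob b tri_sop_closed)
  show "sop (lan_ob b) n n (\<lambda>i\<in>{..n}. i) (code b n t) = code b n t" if t: "t \<in> triples b n" for n t
  proof -
    have "tri_sop b n n (\<lambda>i\<in>{..n}. i) t = t"
      using t by (auto simp: tri_sop_def triples_def b jD Bs X_sset sset_id)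
    then show ?thesis using sop_lan_ob[OF b dmap_id t] by metis
  qed
  show "sop (lan_ob b) l n (compose {..l} \<theta> \<phi>) (code b n t) =
      sop (lan_ob b) l m \<phi> (sop (lan_ob b) m n \<theta> (code b n t))"
    if d: "\<phi> \<in> dmap l m" "\<theta> \<in> dmap m n" and t: "t \<in> triples b n" for l m n \<phi> \<theta> t
  proof -
    have "tri_sop b l n (compose {..l} \<theta> \<phi>) t = tri_sop b l m \<phi> (tri_sop b m n \<theta> t)"
      using t d by (auto simp: tri_sop_def triples_def b jD Bs X_sset sset_compose)
    then show ?thesis
      using d t by (simp add: sop_lan_ob b dmap_compose tri_sop_closed)
  qed
qed

lemma simplicial_functor_lan: "simplicial_functor (opposite B) (sSet T) lan"
  unfolding lan_def
proof (rule simplicial_functor_of_action; (unfold opposite_simps)?)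
  show "simplicial_category (opposite B)" by (rule simplicial_category_opposite[OF B])
  show "is_sset (lan_ob b)" if "b \<in> SOb B" for b using that by (rule lan_ob_sset)
next
  fix b b' n g v
  assume b: "b \<in> SOb B" "b' \<in> SOb B" and g: "g \<in> smp (SHom B b' b) n" and "v \<in> smp (lan_ob b) n"
  then obtain t where t: "t \<in> triples b n" and v: "v = code b n t" by (auto simp: smp_lan_ob)
  show "lan_act b b' n g v \<in> smp (lan_ob b') n"
    unfolding v lan_act_code[OF b g t] smp_lan_ob using tri_act_closed[OF b g t] by blast
  show "sop (lan_ob b') m n \<theta> (lan_act b b' n g v) =
      lan_act b b' m (sop (SHom B b' b) m n \<theta> g) (sop (lan_ob b) m n \<theta> v)"
    if \<theta>: "\<theta> \<in> dmap m n" for m \<theta>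
  proof -
    have g': "sop (SHom B b' b) m n \<theta> g \<in> smp (SHom B b' b) m"
      by (rule sset_sop[OF Bs(1)[OF b(2,1)] \<theta> g])
    have "tri_sop b' m n \<theta> (tri_act b b' n g t) =
        tri_act b b' m (sop (SHom B b' b) m n \<theta> g) (tri_sop b m n \<theta> t)"
      using t b g \<theta> by (auto simp: triples_def tri_sop_def tri_act_def Bs jD)
    then show ?thesis
      unfolding v lan_act_code[OF b g t] sop_lan_ob[OF b(1) \<theta> t]
        lan_act_code[OF b g' tri_sop_closed[OF b(1) \<theta> t]] sop_lan_ob[OF b(2) \<theta> tri_act_closed[OF b g
          t]]
      by simp
  qed
next
  fix b n v assume b: "b \<in> SOb B" and "v \<in> smp (lan_ob b) n"
  then obtain t where t: "t \<in> triples b n" and v: "v = code b n t" by (auto simp: smp_lan_ob)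
  let ?i = "degen (SHom B b b) n (SId B b)"
  have i: "?i \<in> smp (SHom B b b) n"
    using Bs(1)[OF b b] Bs(2)[OF b] by (rule sset_degen)
  have "tri_act b b n ?i t = t"
    using t b by (auto simp: triples_def tri_act_def Bs jD)
  then show "lan_act b b n ?i v = v"
    unfolding v lan_act_code[OF b b i t] by simp
next
  fix b b' b'' n f g v
  assume b: "b \<in> SOb B" "b' \<in> SOb B" "b'' \<in> SOb B" and f: "f \<in> smp (SHom B b' b) n"
    and g: "g \<in> smp (SHom B b'' b') n" and "v \<in> smp (lan_ob b) n"
  then obtain t where t: "t \<in> triples b n" and v: "v = code b n t" by (auto simp: smp_lan_ob)
  note fg = Bs(3)[OF b(3,2,1) g f]
  have "tri_act b b'' n (SCmp B b'' b' b n f g) t = tri_act b' b'' n g (tri_act b b' n f t)"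
    using t b f g by (auto simp: triples_def tri_act_def Bs jD)
  then show "lan_act b b'' n (SCmp B b'' b' b n f g) v = lan_act b' b'' n g (lan_act b b' n f v)"
    unfolding v lan_act_code[OF b(1,3) fg t] lan_act_code[OF b(1,2) f t]
      lan_act_code[OF b(2,3) g tri_act_closed[OF b(1,2) f t]] by simp
qed

lemma SFOb_lan [simp]: "SFOb lan = lan_ob"
  by (simp add: lan_def)

lemma act_lan:
  "b \<in> SOb B \<Longrightarrow> b' \<in> SOb B \<Longrightarrow> g \<in> smp (SHom B b' b) n \<Longrightarrow> v \<in> smp (lan_ob b) n \<Longrightarrow>
    act lan b b' n g v = lan_act b b' n g v"
  unfolding lan_def by (rule act_functor_of_action) (simp_all add: Bs)

text \<open>The universal element at \<open>j a\<close>: the identity paired with \<open>x\<close>.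
  In degree \<open>p\<close> the identity is the degenerate simplex on \<open>SId\<close>.\<close>

definition unit_triple :: "'o \<Rightarrow> nat \<Rightarrow> 'v \<Rightarrow> 'o \<times> 't \<times> 'v" where
  "unit_triple a p x = (a, degen (SHom B (SFOb j a) (SFOb j a)) p (SId B (SFOb j a)), x)"

definition lan_unit :: "'o \<Rightarrow> 'v msimp" where
  "lan_unit = (\<lambda>a\<in>SOb A. vertex_map (SFOb X a) (\<lambda>p x. code (SFOb j a) p (unit_triple a p x)))"

lemma degen_SId: "b \<in> SOb B \<Longrightarrow> degen (SHom B b b) p (SId B b) \<in> smp (SHom B b b) p"
  using sset_degen[OF Bs(1) Bs(2)] by simp

lemma unit_triple_closed:
  "a \<in> SOb A \<Longrightarrow> x \<in> smp (SFOb X a) p \<Longrightarrow> unit_triple a p x \<in> triples (SFOb j a) p"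
  by (simp add: triples_def unit_triple_def degen_SId jD)

lemma act_restriction:
  "a \<in> SOb A \<Longrightarrow> a' \<in> SOb A \<Longrightarrow>
    act (FOb (restriction A j) F) a a' p f x = act F (SFOb j a) (SFOb j a') p (SFAr j a' a p f) x"
  by (simp add: act_def)

lemma underlying_lan_unit:
  "a \<in> SOb A \<Longrightarrow> x \<in> smp (SFOb X a) p \<Longrightarrow>
    underlying_map (SFOb X a) (lan_unit a) p x = code (SFOb j a) p (unit_triple a p x)"
  by (simp add: lan_unit_def)

lemma lan_unit_nat:
  "lan_unit \<in> simplicial_nat (opposite A) (sSet T) X (FOb (restriction A j) lan)"
  unfolding simplicial_nat_sSet_iff[OF X simplicial_functor_restriction[OF j
    simplicial_functor_lan]]
proof (intro conjI ballI allI; (unfold opposite_simps)?)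
  show "lan_unit \<in> extensional (SOb A)" by (simp add: lan_unit_def)
  show "lan_unit a \<in> smp (mapping_space (SFOb X a) (SFOb (FOb (restriction A j) lan) a)) 0"
    if a: "a \<in> SOb A" for a
  proof -
    have "vertex_map (SFOb X a) (\<lambda>p x. code (SFOb j a) p (unit_triple a p x))
      \<in> smp (mapping_space (SFOb X a) (lan_ob (SFOb j a))) 0"
    proof (rule vertex_map_closed)
      show "is_sset (SFOb X a)" by (rule X_sset[OF a])
      show "code (SFOb j a) p (unit_triple a p x) \<in> smp (lan_ob (SFOb j a)) p"
        if "x \<in> smp (SFOb X a) p" for p x
        unfolding smp_lan_ob using unit_triple_closed[OF a that] by blast
      show "code (SFOb j a) q (unit_triple a q (sop (SFOb X a) q p \<psi> x)) =
        sop (lan_ob (SFOb j a)) q p \<psi> (code (SFOb j a) p (unit_triple a p x))"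
        if "\<psi> \<in> dmap q p" "x \<in> smp (SFOb X a) p" for p q \<psi> x
      proof -
        have "tri_sop (SFOb j a) q p \<psi> (unit_triple a p x) =
          unit_triple a q (sop (SFOb X a) q p \<psi> x)"
          using that a by (simp add: unit_triple_def tri_sop_def sop_degen Bs jD)
        then show ?thesis
          using sop_lan_ob[OF jD(3)[OF a] that(1) unit_triple_closed[OF a that(2)]] by simp
      qed
    qed
    then show ?thesis using a by (simp add: lan_unit_def)
  qed
  show "underlying_map (SFOb X a) (lan_unit a) n (act X a' a n \<theta> x) =
      act (FOb (restriction A j) lan) a' a n \<theta> (underlying_map (SFOb X a') (lan_unit a') n x)"
    if a: "a' \<in> SOb A" "a \<in> SOb A" and \<theta>: "\<theta> \<in> smp (SHom A a a') n" and x: "x \<in> smp (SFOb X a') n"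
    for a a' n \<theta> x
  proof -
    let ?b = "SFOb j a" and ?b' = "SFOb j a'" and ?g = "SFAr j a a' n \<theta>"
    note b = jD(3)[OF a(2)] and b' = jD(3)[OF a(1)] and g = jD(4)[OF a(2,1) \<theta>]
    note u = unit_triple_closed[OF a(1) x]
    have "act lan ?b' ?b n ?g (code ?b' n (unit_triple a' n x)) =
      code ?b n (tri_act ?b' ?b n ?g (unit_triple a' n x))"
      using u by (simp add: act_lan[OF b' b g] smp_lan_ob lan_act_code[OF b' b g])
    also have "tri_act ?b' ?b n ?g (unit_triple a' n x) = (a', ?g, x)"
      using g b b' by (simp add: tri_act_def unit_triple_def Bs)
    \<comment> \<open>This is the gluing along \<open>\<theta>\<close> with \<open>h\<close> the
      identity: \<open>j \<theta>\<close> is traded for the action of \<open>\<theta>\<close> on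
      \<open>x\<close>.\<close>
    also have "code ?b n (a', ?g, x) = code ?b n (unit_triple a n (act X a' a n \<theta> x))"
    proof (rule code_cong, rule r_into_equivclp)
      show "glue ?b n (a', ?g, x) (unit_triple a n (act X a' a n \<theta> x))"
        using glue.intros[OF a(2,1) \<theta> degen_SId[OF b] x] g b b' by (simp add: unit_triple_def Bs)
    qed
    finally show ?thesis
      using a x \<theta> by (simp add: act_restriction underlying_lan_unit X_act)
  qed
qed

section \<open>Extending a transformation along the unit\<close>

context
  fixes Y :: "('q, 't, 'v sset, 'v msimp) sfun" and t :: "'o \<Rightarrow> 'v msimp"
  assumes Y: "simplicial_functor (opposite B) (sSet T) Y"
    and t: "t \<in> simplicial_nat (opposite A) (sSet T) X (FOb (restriction A j) Y)"
begin

lemmas t_D = simplicial_nat_sSetD[OF X simplicial_functor_restriction[OF j Y] t, simplified]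

abbreviation (input) "u a \<equiv> underlying_map (SFOb X a) (t a)"

lemma u_closed: "a \<in> SOb A \<Longrightarrow> x \<in> smp (SFOb X a) p \<Longrightarrow> u a p x \<in> smp (SFOb Y (SFOb j a)) p"
  by (rule underlying_map_closed[OF t_D(1)])

lemma u_sop:
  "a \<in> SOb A \<Longrightarrow> \<psi> \<in> dmap q p \<Longrightarrow> x \<in> smp (SFOb X a) p \<Longrightarrow>
    u a q (sop (SFOb X a) q p \<psi> x) = sop (SFOb Y (SFOb j a)) q p \<psi> (u a p x)"
  by (rule underlying_map_sop[OF t_D(1) X_sset])

lemma u_act:
  "a \<in> SOb A \<Longrightarrow> a' \<in> SOb A \<Longrightarrow> \<theta> \<in> smp (SHom A a a') n \<Longrightarrow> x \<in> smp (SFOb X a') n \<Longrightarrow>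
    u a n (act X a' a n \<theta> x) = act Y (SFOb j a') (SFOb j a) n (SFAr j a a' n \<theta>) (u a' n x)"
  using t_D(2) by (simp add: act_restriction)

text \<open>Forced by naturality: the class of \<open>(a, h, x)\<close> is \<open>h\<close> acting
  on the unit class of \<open>x\<close>, and the unit class has to go to
  \<open>u a p x\<close>.\<close>

definition ext_tri :: "'q \<Rightarrow> nat \<Rightarrow> 'o \<times> 't \<times> 'v \<Rightarrow> 'v" where
  "ext_tri b p = (\<lambda>(a, h, x). act Y (SFOb j a) b p h (u a p x))"

definition lan_ext :: "'q \<Rightarrow> 'v msimp" where
  "lan_ext = (\<lambda>b\<in>SOb B. vertex_map (lan_ob b) (\<lambda>p v. ext_tri b p (uncode b p v)))"

lemmas Y_act = act_closed[OF Y, simplified]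

text \<open>Invariance under gluing: \<open>Y\<close> turns the composite of \<open>h\<close> and
  \<open>j \<theta>\<close> into two successive actions, and \<open>u_act\<close> rewrites the inner
  one as \<open>u\<close> applied to the action of \<open>\<theta>\<close> on
  \<open>x\<close>.\<close>

lemma ext_tri_code:
  assumes b: "b \<in> SOb B" and s: "s \<in> triples b p"
  shows "ext_tri b p (uncode b p (code b p s)) = ext_tri b p s"
proof (rule lift_code[OF _ b s])
  show "ext_tri b p r = ext_tri b p s" if "glue b p r s" for r s
    using that
  proof cases
    case (1 a a' \<theta> h x)
    then show ?thesis
      using act_SCmp[OF Y, simplified, of "SFOb j a'" "SFOb j a" b "SFAr j a a' p \<theta>" p h "u a' p x"]
        b
      by (simp add: ext_tri_def u_act jD u_closed)
  qed
qed

lemma ext_tri_closed: "b \<in> SOb B \<Longrightarrow> s \<in> triples b p \<Longrightarrow> ext_tri b p s \<in> smp (SFOb Y b) p"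
  by (auto simp: ext_tri_def triples_def Y_act jD u_closed)

lemma underlying_lan_ext:
  "b \<in> SOb B \<Longrightarrow> s \<in> triples b p \<Longrightarrow>
    underlying_map (lan_ob b) (lan_ext b) p (code b p s) = ext_tri b p s"
  by (simp add: lan_ext_def smp_lan_ob ext_tri_code)

lemma lan_ext_nat: "lan_ext \<in> simplicial_nat (opposite B) (sSet T) lan Y"
  unfolding simplicial_nat_sSet_iff[OF simplicial_functor_lan Y]
proof (intro conjI ballI allI; (unfold opposite_simps SFOb_lan)?)
  show "lan_ext \<in> extensional (SOb B)" by (simp add: lan_ext_def)
  show "lan_ext b \<in> smp (mapping_space (lan_ob b) (SFOb Y b)) 0" if b: "b \<in> SOb B" for b
  proof -
    have "vertex_map (lan_ob b) (\<lambda>p v. ext_tri b p (uncode b p v))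
      \<in> smp (mapping_space (lan_ob b) (SFOb Y b)) 0"
    proof (rule vertex_map_closed)
      show "is_sset (lan_ob b)" by (rule lan_ob_sset[OF b])
      show "ext_tri b p (uncode b p v) \<in> smp (SFOb Y b) p" if "v \<in> smp (lan_ob b) p" for p v
        using that by (auto simp: smp_lan_ob ext_tri_code b ext_tri_closed)
      show "ext_tri b q (uncode b q (sop (lan_ob b) q p \<psi> v)) =
        sop (SFOb Y b) q p \<psi> (ext_tri b p (uncode b p v))"
        if \<psi>: "\<psi> \<in> dmap q p" and "v \<in> smp (lan_ob b) p" for q p \<psi> v
      proof -
        obtain s where s: "s \<in> triples b p" and v: "v = code b p s" using \<open>v \<in> _\<close> by
          (auto simp: smp_lan_ob)
        have "ext_tri b q (tri_sop b q p \<psi> s) = sop (SFOb Y b) q p \<psi> (ext_tri b p s)"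
          using s by (auto simp: triples_def ext_tri_def tri_sop_def u_sop \<psi> b jD u_closed
              act_sop[OF Y, simplified])
        then show ?thesis
          unfolding v sop_lan_ob[OF b \<psi> s] ext_tri_code[OF b tri_sop_closed[OF b \<psi> s]]
            ext_tri_code[OF b s] .
      qed
    qed
    then show ?thesis using b by (simp add: lan_ext_def)
  qed
  show "underlying_map (lan_ob b') (lan_ext b') n (act lan b b' n g v) =
      act Y b b' n g (underlying_map (lan_ob b) (lan_ext b) n v)"
    if b: "b \<in> SOb B" "b' \<in> SOb B" and g: "g \<in> smp (SHom B b' b) n" and "v \<in> smp (lan_ob b) n"
      for b b' n g v
  proof -
    obtain s where s: "s \<in> triples b n" and v: "v = code b n s" using \<open>v \<in> _\<close> by
      (auto simp: smp_lan_ob)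
    have "ext_tri b' n (tri_act b b' n g s) = act Y b b' n g (ext_tri b n s)"
      using s by (auto simp: triples_def ext_tri_def tri_act_def b g jD u_closed
              act_SCmp[OF Y, simplified])
    then show ?thesis
      using that(4) unfolding v
      by (simp add: act_lan b g lan_act_code s underlying_lan_ext tri_act_closed)
  qed
qed

lemma restriction_lan_ext:
  "Cmp (presheaves T A) X (FOb (restriction A j) lan) (FOb (restriction A j) Y)
    (FAr (restriction A j) lan Y lan_ext) lan_unit = t"
proof (rule extensionalityI[of _ "SOb A"])
  show "t \<in> extensional (SOb A)" using simplicial_natD(3)[OF t] by simp
  fix a assume a: "a \<in> SOb A"
  note ja = jD(3)[OF a]
  note le = simplicial_nat_sSetD[OF simplicial_functor_lan Y lan_ext_nat, simplified]
  note lu = simplicial_nat_sSetD[OF X simplicial_functor_restriction[OF j simplicial_functor_lan]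
      lan_unit_nat, simplified]
  have "SCmp (sSet T) (SFOb X a) (lan_ob (SFOb j a)) (SFOb Y (SFOb j a)) 0 (lan_ext (SFOb j a))
    (lan_unit a) = t a"
  proof (rule underlying_map_ext)
    show "SCmp (sSet T) (SFOb X a) (lan_ob (SFOb j a)) (SFOb Y (SFOb j a)) 0 (lan_ext (SFOb j a))
      (lan_unit a)
        \<in> smp (mapping_space (SFOb X a) (SFOb Y (SFOb j a))) 0"
      using X_sset[OF a] lan_ob_sset[OF ja] functor_sset[OF Y, simplified,
        OF ja] le(1)[OF ja] lu(1)[OF a]
      by (intro simplicial_categoryD(3)[OF simplicial_category_sSet[of T], simplified]) auto
    show "t a \<in> smp (mapping_space (SFOb X a) (SFOb Y (SFOb j a))) 0" by (rule t_D(1)[OF a])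
    fix p x assume x: "x \<in> smp (SFOb X a) p"
    have "ext_tri (SFOb j a) p (unit_triple a p x) = u a p x"
      using act_degen_SId[OF Y, simplified, OF ja] u_closed[OF a x]
      by (simp add: ext_tri_def unit_triple_def)
    then show "underlying_map (SFOb X a) (SCmp (sSet T) (SFOb X a) (lan_ob (SFOb j a)) (SFOb Y (SFOb
      j a)) 0
        (lan_ext (SFOb j a)) (lan_unit a)) p x = u a p x"
      using lu(1)[OF a] a x by (simp add: underlying_map_SCmp underlying_lan_unit underlying_lan_ext
        ja unit_triple_closed)
  qed
  then show "Cmp (presheaves T A) X (FOb (restriction A j) lan) (FOb (restriction A j) Y)
    (FAr (restriction A j) lan Y lan_ext) lan_unit a = t a"
    using a by simp
qed simp

lemma lan_ext_unique:
  assumes w: "w \<in> simplicial_nat (opposite B) (sSet T) lan Y"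
    and eq: "Cmp (presheaves T A) X (FOb (restriction A j) lan) (FOb (restriction A j) Y)
      (FAr (restriction A j) lan Y w) lan_unit = t"
  shows "w = lan_ext"
proof (rule extensionalityI[of _ "SOb B"])
  note le = simplicial_nat_sSetD[OF simplicial_functor_lan Y lan_ext_nat, simplified]
  note wi = simplicial_nat_sSetD[OF simplicial_functor_lan Y w, simplified]
  note lu = simplicial_nat_sSetD[OF X simplicial_functor_restriction[OF j simplicial_functor_lan]
      lan_unit_nat, simplified]
  show "w \<in> extensional (SOb B)" "lan_ext \<in> extensional (SOb B)"
    using simplicial_natD(3)[OF w] simplicial_natD(3)[OF lan_ext_nat] by auto
  fix b assume b: "b \<in> SOb B"
  show "w b = lan_ext b"
  proof (rule underlying_map_ext)
    show "w b \<in> smp (mapping_space (lan_ob b) (SFOb Y b)) 0" by (rule wi(1)[OF b])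
    show "lan_ext b \<in> smp (mapping_space (lan_ob b) (SFOb Y b)) 0" by (rule le(1)[OF b])
    fix p v assume "v \<in> smp (lan_ob b) p"
    then obtain a h x where a: "a \<in> SOb A" and h: "h \<in> smp (SHom B b (SFOb j a)) p"
      and x: "x \<in> smp (SFOb X a) p" and v: "v = code b p (a, h, x)"
      by (auto simp: smp_lan_ob triples_def)
    note ja = jD(3)[OF a]
    have ahx: "(a, h, x) \<in> triples b p" using a h x by (simp add: triples_def)
    \<comment> \<open>Every simplex is \<open>h\<close> applied to a unit class, so \<open>w\<close>
      is determined by its values at unit classes, which \<open>eq\<close> prescribes.\<close>
    have "tri_act (SFOb j a) b p h (unit_triple a p x) = (a, h, x)"
      using h b ja by (simp add: tri_act_def unit_triple_def Bs)
    then have "act lan (SFOb j a) b p h (code (SFOb j a) p (unit_triple a p x)) = code b p (a, h,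
      x)"
      using unit_triple_closed[OF a x] by (simp add: act_lan[OF ja b h] smp_lan_ob lan_act_code[OF
        ja b h])
    then have "underlying_map (lan_ob b) (w b) p v =
        act Y (SFOb j a) b p h (underlying_map (lan_ob (SFOb j a)) (w (SFOb j a)) p (code (SFOb j a)
          p (unit_triple a p x)))"
      using wi(2)[OF ja b h, of "code (SFOb j a) p (unit_triple a p x)"] unit_triple_closed[OF a x]
      by (simp add: v smp_lan_ob)
    also have "underlying_map (lan_ob (SFOb j a)) (w (SFOb j a)) p (code (SFOb j a) p (unit_triple a
      p x)) = u a p x"
    proof -
      have "t a = SCmp (sSet T) (SFOb X a) (lan_ob (SFOb j a)) (SFOb Y (SFOb j a)) 0 (w (SFOb j a))
        (lan_unit a)"
        unfolding eq[symmetric] using a by simp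
      then show ?thesis
        using lu(1)[OF a] a x by (simp add: underlying_map_SCmp underlying_lan_unit)
    qed
    also have "act Y (SFOb j a) b p h (u a p x) = underlying_map (lan_ob b) (lan_ext b) p v"
      unfolding v underlying_lan_ext[OF b ahx] by (simp add: ext_tri_def)
    finally show "underlying_map (lan_ob b) (w b) p v = underlying_map (lan_ob b) (lan_ext b) p v" .
  qed
qed

end

end


section \<open>Adjunctions from universal arrows\<close>

lemma is_functorD:
  assumes "is_functor C D F"
  shows "category C" "category D" "\<And>x. x \<in> Ob C \<Longrightarrow> FOb F x \<in> Ob D"
    and "\<And>x y f. x \<in> Ob C \<Longrightarrow> y \<in> Ob C \<Longrightarrow> f \<in> Hom C x y \<Longrightarrow> FAr F x y f \<in> Hom D (FOb F x) (FOb F y)"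
    and "\<And>x. x \<in> Ob C \<Longrightarrow> FAr F x x (Idn C x) = Idn D (FOb F x)"
    and "\<And>x y z f g. x \<in> Ob C \<Longrightarrow> y \<in> Ob C \<Longrightarrow> z \<in> Ob C \<Longrightarrow> f \<in> Hom C x y \<Longrightarrow> g \<in> Hom C y z \<Longrightarrow>
      FAr F x z (Cmp C x y z g f) =
      Cmp D (FOb F x) (FOb F y) (FOb F z) (FAr F y z g) (FAr F x y f)"
  using assms unfolding is_functor_def by simp_all

lemma adjunction_of_universal_arrows:
  assumes U: "is_functor D C U"
    and F: "\<And>x. x \<in> Ob C \<Longrightarrow> F x \<in> Ob D"
    and \<eta>: "\<And>x. x \<in> Ob C \<Longrightarrow> \<eta> x \<in> Hom C x (FOb U (F x))"
    and univ: "\<And>x y t. x \<in> Ob C \<Longrightarrow> y \<in> Ob D \<Longrightarrow> t \<in> Hom C x (FOb U y) \<Longrightarrow>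
      \<exists>!h. h \<in> Hom D (F x) y \<and> Cmp C x (FOb U (F x)) (FOb U y) (FAr U (F x) y h) (\<eta> x) = t"
  shows "\<exists>F. adjunction C D F U"
proof -
  note UD = is_functorD[OF U]
  note C = UD(2) and D = UD(1)
  define \<phi> where "\<phi> x y h = Cmp C x (FOb U (F x)) (FOb U y) (FAr U (F x) y h) (\<eta> x)" for x y h
  have \<phi>: "\<phi> x y h \<in> Hom C x (FOb U y)" if "x \<in> Ob C" "y \<in> Ob D" "h \<in> Hom D (F x) y" for x y h
    unfolding \<phi>_def using that by (intro category_Cmp[OF C] UD F \<eta>)
  \<comment> \<open>Functor laws for the left adjoint are equations between arrows out of
    \<open>F x\<close>; they are proved by comparing transposes.\<close>
  have inj: "h = k" if "x \<in> Ob C" "y \<in> Ob D" "h \<in> Hom D (F x) y" "k \<in> Hom D (F x) y" "\<phi> x y h =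
    \<phi> x y k" for x y h k
    using univ[OF that(1,2) \<phi>[OF that(1-3)]] that(3-5) unfolding \<phi>_def by metis
  have right: "\<phi> x y' (Cmp D (F x) y y' g h) = Cmp C x (FOb U y) (FOb U y') (FAr U y y' g) (\<phi> x y
    h)"
    if "x \<in> Ob C" "y \<in> Ob D" "y' \<in> Ob D" "h \<in> Hom D (F x) y" "g \<in> Hom D y y'" for x y y' g h
    using category_assoc[OF C, of x "FOb U (F x)" "FOb U y" "FOb U y'" "\<eta> x" "FAr U (F x) y h" "FAr
      U y y' g"] that
    by (simp add: \<phi>_def UD F \<eta>)
  \<comment> \<open>The action on arrows is forced: it is the only one for which the universal
    arrows are natural.\<close>
  define Fa where "Fa x x' f = (THE h. h \<in> Hom D (F x) (F x') \<and>
    \<phi> x (F x') h = Cmp C x x' (FOb U (F x')) (\<eta> x') f)" for x x' f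
  have Fa: "Fa x x' f \<in> Hom D (F x) (F x') \<and> \<phi> x (F x') (Fa x x' f) =
    Cmp C x x' (FOb U (F x')) (\<eta> x') f"
    if "x \<in> Ob C" "x' \<in> Ob C" "f \<in> Hom C x x'" for x x' f
    unfolding Fa_def \<phi>_def
    by (rule theI', rule univ) (use that in \<open>auto intro!: F category_Cmp[OF C] UD \<eta>\<close>)
  \<comment> \<open>Naturality in \<open>x\<close> follows from naturality in \<open>y\<close> and
    the equation that characterises \<open>Fa\<close>.\<close>
  have left: "\<phi> x' y (Cmp D (F x') (F x) y h (Fa x' x f)) = Cmp C x' x (FOb U y) (\<phi> x y h) f"
    if "x \<in> Ob C" "x' \<in> Ob C" "y \<in> Ob D" "f \<in> Hom C x' x" "h \<in> Hom D (F x) y" for x x' y f h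
    using right[of x' "F x" y "Fa x' x f" h] Fa[of x' x f] that
      category_assoc[OF C, of x' x "FOb U (F x)" "FOb U y" f "\<eta> x" "FAr U (F x) y h"]
    by (simp add: F UD \<eta>) (simp add: \<phi>_def)
  let ?F = "\<lparr>FOb = F, FAr = Fa\<rparr>"
  have \<phi>_Idn: "\<phi> x (F x) (Idn D (F x)) = \<eta> x" if "x \<in> Ob C" for x
    using that by (simp add: \<phi>_def UD F \<eta> category_Idn_left[OF C])
  have "is_functor C D ?F"
    unfolding is_functor_def fctr.simps
  proof (intro conjI ballI)
    show "category C" "category D" by (fact C, fact D)
    show "F x \<in> Ob D" if "x \<in> Ob C" for x using that by (rule F)
    show "Fa x y f \<in> Hom D (F x) (F y)" if "x \<in> Ob C" "y \<in> Ob C" "f \<in> Hom C x y" for x y f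
      using Fa[OF that] by blast
    show "Fa x x (Idn C x) = Idn D (F x)" if x: "x \<in> Ob C" for x
      using Fa[OF x x category_Idn[OF C x]]
      by (intro inj[OF x F[OF x]]) (auto simp: \<phi>_Idn x F \<eta> UD category_Idn[OF D]
        category_Idn_right[OF C])
    show "Fa x z (Cmp C x y z g f) = Cmp D (F x) (F y) (F z) (Fa y z g) (Fa x y f)"
      if x: "x \<in> Ob C" "y \<in> Ob C" "z \<in> Ob C" and f: "f \<in> Hom C x y" and g: "g \<in> Hom C y z"
        for x y z f g
    proof (rule inj[OF x(1) F[OF x(3)]])
      note gf = category_Cmp[OF C x f g]
      show "Fa x z (Cmp C x y z g f) \<in> Hom D (F x) (F z)" using Fa[OF x(1,3) gf] by blast
      show "Cmp D (F x) (F y) (F z) (Fa y z g) (Fa x y f) \<in> Hom D (F x) (F z)"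
        using Fa[OF x(1,2) f] Fa[OF x(2,3) g] x by (intro category_Cmp[OF D] F) auto
      show "\<phi> x (F z) (Fa x z (Cmp C x y z g f)) =
          \<phi> x (F z) (Cmp D (F x) (F y) (F z) (Fa y z g) (Fa x y f))"
        using Fa[OF x(1,3) gf] left[OF x(2,1) F[OF x(3)] f, of "Fa y z g"] Fa[OF x(2,3) g]
          category_assoc[OF C x UD(3)[OF F[OF x(3)]] f g \<eta>[OF x(3)]] by simp
    qed
  qed
  moreover have "bij_betw (\<phi> x y) (Hom D (F x) y) (Hom C x (FOb U y))" if "x \<in> Ob C" "y \<in> Ob D"
    for x y
  proof (rule bij_betwI')
    show "(\<phi> x y h = \<phi> x y k) = (h = k)" if "h \<in> Hom D (F x) y" "k \<in> Hom D (F x) y" for h k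
      using inj[OF \<open>x \<in> Ob C\<close> \<open>y \<in> Ob D\<close> that] by blast
    show "\<phi> x y h \<in> Hom C x (FOb U y)" if "h \<in> Hom D (F x) y" for h
      using \<phi>[OF \<open>x \<in> Ob C\<close> \<open>y \<in> Ob D\<close> that] .
    show "\<exists>h\<in>Hom D (F x) y. t = \<phi> x y h" if "t \<in> Hom C x (FOb U y)" for t
      using univ[OF \<open>x \<in> Ob C\<close> \<open>y \<in> Ob D\<close> that] unfolding \<phi>_def by blast
  qed
  moreover have "\<phi> x' y' (Cmp D (F x') y y' g (Cmp D (F x') (F x) y h (Fa x' x f))) =
        Cmp C x' (FOb U y) (FOb U y') (FAr U y y' g) (Cmp C x' x (FOb U y) (\<phi> x y h) f)"
    if "x \<in> Ob C" "x' \<in> Ob C" "y \<in> Ob D" "y' \<in> Ob D" "f \<in> Hom C x' x" "h \<in> Hom D (F x) y" "g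
      \<in> Hom D y y'"
    for x x' y y' f h g
    using right[OF that(2-4) category_Cmp[OF D F[OF that(2)] F[OF that(1)] that(3) _ that(6)]
      that(7)]
      Fa[OF that(2,1,5)] left[OF that(1-3,5,6)] by simp
  ultimately have "adjunction C D ?F U"
    unfolding adjunction_def using U by (intro conjI exI[of _ \<phi>]) auto
  then show ?thesis by blast
qed

text \<open>A cofibration of \<open>N\<close> is tested against trivial fibrations. Transposition
  turns such a lifting problem into one in \<open>M\<close> against the image under
  \<open>U\<close>, which \<open>tfib\<close> makes a trivial fibration.\<close>

lemma quillen_adjunctionI:
  assumes adj: "adjunction M N F U"
    and fib: "\<And>x y f. x \<in> Ob N \<Longrightarrow> y \<in> Ob N \<Longrightarrow> f \<in> Hom N x y \<Longrightarrow> fib N x y f \<Longrightarrow>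
      fib M (FOb U x) (FOb U y) (FAr U x y f)"
    and tfib: "\<And>x y f. x \<in> Ob N \<Longrightarrow> y \<in> Ob N \<Longrightarrow> f \<in> Hom N x y \<Longrightarrow> trivial_fibration N x y f \<Longrightarrow>
      trivial_fibration M (FOb U x) (FOb U y) (FAr U x y f)"
  shows "quillen_adjunction M N F U"
proof -
  have F: "is_functor M N F" and U: "is_functor N M U"
    using adj by (auto simp: adjunction_def)
  note FD = is_functorD[OF F] and UD = is_functorD[OF U]
  note M = FD(1) and N = FD(2)
  obtain \<phi> where bij: "\<forall>x\<in>Ob M. \<forall>y\<in>Ob N. bij_betw (\<phi> x y) (Hom N (FOb F x) y) (Hom M x (FOb U y))"
    and nat: "\<forall>x\<in>Ob M. \<forall>x'\<in>Ob M. \<forall>y\<in>Ob N. \<forall>y'\<in>Ob N.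
       \<forall>f\<in>Hom M x' x. \<forall>h\<in>Hom N (FOb F x) y. \<forall>g\<in>Hom N y y'.
        \<phi> x' y' (Cmp N (FOb F x') y y' g (Cmp N (FOb F x') (FOb F x) y h (FAr F x' x f))) =
        Cmp M x' (FOb U y) (FOb U y') (FAr U y y' g) (Cmp M x' x (FOb U y) (\<phi> x y h) f)"
    using adj unfolding adjunction_def by blast
  note bij = bij[rule_format] and nat = nat[rule_format]
  have \<phi>: "\<phi> x y h \<in> Hom M x (FOb U y)" if "x \<in> Ob M" "y \<in> Ob N" "h \<in> Hom N (FOb F x) y" for x y h
    using bij_betwE[OF bij[OF that(1,2)]] that(3) by blast
  \<comment> \<open>Naturality of the transposition is given in both variables at once; inserting
    identities separates them.\<close>
  have right: "\<phi> x y' (Cmp N (FOb F x) y y' g h) = Cmp M x (FOb U y) (FOb U y') (FAr U y y' g) (\<phi> x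
    y h)"
    if "x \<in> Ob M" "y \<in> Ob N" "y' \<in> Ob N" "h \<in> Hom N (FOb F x) y" "g \<in> Hom N y y'" for x y y' h g
    using nat[of x x y y' "Idn M x" h g] that \<phi>[of x y h]
    by (simp add: FD UD category_Idn[OF M] category_Idn_right[OF M] category_Idn_right[OF N])
  have left: "\<phi> x' y (Cmp N (FOb F x') (FOb F x) y h (FAr F x' x f)) =
    Cmp M x' x (FOb U y) (\<phi> x y h) f"
    if "x \<in> Ob M" "x' \<in> Ob M" "y \<in> Ob N" "f \<in> Hom M x' x" "h \<in> Hom N (FOb F x) y" for x x' y f h
    using nat[of x x' y y f h "Idn N y"] that \<phi>[of x y h]
      category_Cmp[OF N, of "FOb F x'" "FOb F x" y "FAr F x' x f" h]
      category_Cmp[OF M, of x' x "FOb U y" f "\<phi> x y h"]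
    by (simp add: FD UD category_Idn[OF N] category_Idn_left[OF M] category_Idn_left[OF N])
  have "cofibration N (FOb F x) (FOb F y) (FAr F x y f)"
    if x: "x \<in> Ob M" and y: "y \<in> Ob M" and f: "f \<in> Hom M x y" and cof: "cofibration M x y f"
      for x y f
    unfolding cofibration_def
  proof (intro ballI impI)
    fix a b p u v
    assume a: "a \<in> Ob N" and b: "b \<in> Ob N" and p: "p
      \<in> Hom N a b" and tp: "trivial_fibration N a b p"
      and u: "u \<in> Hom N (FOb F x) a" and v: "v \<in> Hom N (FOb F y) b"
      and eq: "Cmp N (FOb F x) a b p u = Cmp N (FOb F x) (FOb F y) b v (FAr F x y f)"
    have "Cmp M x (FOb U a) (FOb U b) (FAr U a b p) (\<phi> x a u) = Cmp M x y (FOb U b) (\<phi> y b v) f"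
      using right[OF x a b u p] left[OF y x b f v] eq by simp
    then obtain k where k: "k \<in> Hom M y (FOb U a)" "Cmp M x y (FOb U a) k f = \<phi> x a u"
        "Cmp M y (FOb U a) (FOb U b) (FAr U a b p) k = \<phi> y b v"
      using cof tfib[OF a b p tp] \<phi>[OF x a u] \<phi>[OF y b v] UD(3)[OF a] UD(3)[OF b] UD(4)[OF a b p]
      unfolding cofibration_def by blast
    \<comment> \<open>The lift found in \<open>M\<close> is transposed back; injectivity of the
      transposition then verifies the two triangles.\<close>
    obtain h where h: "h \<in> Hom N (FOb F y) a" "k = \<phi> y a h"
      using bij[OF y a] k(1) unfolding bij_betw_def by blast
    have "Cmp N (FOb F x) (FOb F y) a h (FAr F x y f) = u"
    proof (rule inj_onD[OF bij_betw_imp_inj_on[OF bij[OF x a]]])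
      show "\<phi> x a (Cmp N (FOb F x) (FOb F y) a h (FAr F x y f)) = \<phi> x a u"
        using left[OF y x a f h(1)] k(2) h(2) by simp
      show "Cmp N (FOb F x) (FOb F y) a h (FAr F x y f) \<in> Hom N (FOb F x) a"
        using x y a f h(1) by (intro category_Cmp[OF N] FD)
    qed (rule u)
    moreover have "Cmp N (FOb F y) a b p h = v"
    proof (rule inj_onD[OF bij_betw_imp_inj_on[OF bij[OF y b]]])
      show "\<phi> y b (Cmp N (FOb F y) a b p h) = \<phi> y b v"
        using right[OF y a b h(1) p] k(3) h(2) by simp
      show "Cmp N (FOb F y) a b p h \<in> Hom N (FOb F y) b"
        using y a b p h(1) by (intro category_Cmp[OF N] FD)
    qed (rule v)
    ultimately show "\<exists>h\<in>Hom N (FOb F y) a. Cmp N (FOb F x) (FOb F y) a h (FAr F x y f) = u \<and>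
        Cmp N (FOb F y) a b p h = v"
      using h(1) by blast
  qed
  then show ?thesis
    unfolding quillen_adjunction_def using adj fib tfib by blast
qed

text \<open>Applied twice, such a pairing packs the code of a triple into one element of
  \<open>'v\<close>.\<close>

lemma infinite_prod_encoding:
  assumes "infinite (UNIV :: 'v set)"
  obtains pr :: "'v \<times> 'v \<Rightarrow> 'v" where "inj pr"
proof -
  have "|UNIV \<times> UNIV :: ('v \<times> 'v) set| =o |UNIV :: 'v set|"
    by (rule card_of_Times_same_infinite[OF assms])
  then obtain f :: "'v \<times> 'v \<Rightarrow> 'v" where "bij_betw f (UNIV \<times> UNIV) UNIV"
    using card_of_ordIso by blast
  then show ?thesis
    using that[of f] by (auto simp: bij_betw_def)
qed

text \<open>A triple of the Kan extension involves objects of \<open>A\<close> and hom simplices of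
  \<open>B\<close>, so these need codes in \<open>'v\<close>; its third entry lies in
  \<open>'v\<close> already.\<close>

theorem quillen_adjunction_restriction:
  fixes A :: "('o, 's) scat" and B :: "('q, 't) scat"
  assumes j: "simplicial_functor A B j" and B: "small_scat TYPE('v) B"
    and \<iota>: "inj_on (\<iota> :: 'o \<Rightarrow> 'v) (SOb A)"
  shows "\<exists>j_shriek. quillen_adjunction (presheaves TYPE('v) A) (presheaves TYPE('v) B)
    j_shriek (restriction A j)"
proof -
  let ?T = "TYPE('v)"
  let ?S = "\<Union>x\<in>SOb B. \<Union>y\<in>SOb B. \<Union>n. smp (SHom B x y) n"
  obtain \<kappa> :: "'t \<Rightarrow> 'v" where \<kappa>: "inj_on \<kappa> ?S" and inf: "infinite (UNIV :: 'v set)"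
    using B by (auto simp: small_scat_def)
  obtain pr :: "'v \<times> 'v \<Rightarrow> 'v" where pr: "inj pr"
    using infinite_prod_encoding[OF inf] .
  define enc :: "'o \<times> 't \<times> 'v \<Rightarrow> 'v" where "enc = (\<lambda>(a, h, x). pr (\<iota> a, pr (\<kappa> h, x)))"
  have enc: "inj_on enc (SOb A \<times> ?S \<times> UNIV)"
  proof (rule inj_onI)
    fix s t assume s: "s \<in> SOb A \<times> ?S \<times> UNIV" and t: "t \<in> SOb A \<times> ?S \<times> UNIV" and eq: "enc s = enc t"
    obtain a h x a' h' x' where st: "s = (a, h, x)" "t = (a', h', x')" by (metis prod_cases3)
    have "(\<iota> a, pr (\<kappa> h, x)) = (\<iota> a', pr (\<kappa> h', x'))"
      using eq by (intro injD[OF pr]) (simp add: enc_def st)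
    moreover from this have "(\<kappa> h, x) = (\<kappa> h', x')"
      by (intro injD[OF pr]) simp
    ultimately show "s = t"
      using s t inj_onD[OF \<iota>, of a a'] inj_onD[OF \<kappa>, of h h'] unfolding st by blast
  qed
  have lk: "left_kan A B j X ?T enc" if "simplicial_functor (opposite A) (sSet ?T) X" for X
    using j that enc by (intro left_kan.intro)
  have "\<exists>F. adjunction (presheaves ?T A) (presheaves ?T B) F (restriction A j)"
  proof (rule adjunction_of_universal_arrows)
    show "is_functor (presheaves ?T B) (presheaves ?T A) (restriction A j)"
      by (rule is_functor_restriction[OF j])
    fix X assume "X \<in> Ob (presheaves ?T A)"
    then interpret left_kan A B j X ?T enc
      by (intro lk) simp
    show "left_kan.lan A B j X enc \<in> Ob (presheaves ?T B)"
      using simplicial_functor_lan by simp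
    show "left_kan.lan_unit A B j X enc \<in> Hom (presheaves ?T A) X (FOb (restriction A j)
      (left_kan.lan A B j X enc))"
      using lan_unit_nat by simp
    show "\<exists>!h. h \<in> Hom (presheaves ?T B) (left_kan.lan A B j X enc) Y \<and>
      Cmp (presheaves ?T A) X (FOb (restriction A j) (left_kan.lan A B j X enc)) (FOb (restriction A
        j) Y)
        (FAr (restriction A j) (left_kan.lan A B j X enc) Y h) (left_kan.lan_unit A B j X enc) = t"
      if "Y \<in> Ob (presheaves ?T B)" "t \<in> Hom (presheaves ?T A) X (FOb (restriction A j) Y)" for Y t
    proof (rule ex1I)
      have Y: "simplicial_functor (opposite B) (sSet ?T) Y"
        and t: "t \<in> simplicial_nat (opposite A) (sSet ?T) X (FOb (restriction A j) Y)"
        using that by simp_all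
      show "lan_ext Y t \<in> Hom (presheaves ?T B) lan Y \<and>
        Cmp (presheaves ?T A) X (FOb (restriction A j) lan) (FOb (restriction A j) Y)
          (FAr (restriction A j) lan Y (lan_ext Y t)) lan_unit = t"
        using lan_ext_nat[OF Y t] restriction_lan_ext[OF Y t] by (simp only: presheaves_simps)
      show "h = lan_ext Y t" if "h \<in> Hom (presheaves ?T B) lan Y \<and>
        Cmp (presheaves ?T A) X (FOb (restriction A j) lan) (FOb (restriction A j) Y)
          (FAr (restriction A j) lan Y h) lan_unit = t" for h
        using that lan_ext_unique[OF Y t, of h] by (simp only: presheaves_simps)
    qed
  qed
  then obtain F where "adjunction (presheaves ?T A) (presheaves ?T B) F (restriction A j)" ..
  then have "quillen_adjunction (presheaves ?T A) (presheaves ?T B) F (restriction A j)"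
    by (rule quillen_adjunctionI) (auto simp: trivial_fibration_def simplicial_functorD(3)[OF j])
  then show ?thesis ..
qed


section \<open>Complexes and dg-categories\<close>

lemma linear_mapsD:
  assumes "f \<in> linear_maps K M N"
  shows "\<And>x. x \<in> carrier M \<Longrightarrow> f x \<in> carrier N"
    and "\<And>x y. x \<in> carrier M \<Longrightarrow> y \<in> carrier M \<Longrightarrow> f (x \<oplus>\<^bsub>M\<^esub> y) = f x \<oplus>\<^bsub>N\<^esub> f y"
    and "\<And>r x. r \<in> carrier K \<Longrightarrow> x \<in> carrier M \<Longrightarrow> f (r \<odot>\<^bsub>M\<^esub> x) = r \<odot>\<^bsub>N\<^esub> f x"
    and "f \<in> extensional (carrier M)"
  using assms by (auto simp: linear_maps_def PiE_def)

lemma linear_mapsI: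
  assumes "\<And>x. x \<in> carrier M \<Longrightarrow> f x \<in> carrier N"
    and "\<And>x y. x \<in> carrier M \<Longrightarrow> y \<in> carrier M \<Longrightarrow> f (x \<oplus>\<^bsub>M\<^esub> y) = f x \<oplus>\<^bsub>N\<^esub> f y"
    and "\<And>r x. r \<in> carrier K \<Longrightarrow> x \<in> carrier M \<Longrightarrow> f (r \<odot>\<^bsub>M\<^esub> x) = r \<odot>\<^bsub>N\<^esub> f x"
    and "f \<in> extensional (carrier M)"
  shows "f \<in> linear_maps K M N"
  using assms by (auto simp: linear_maps_def PiE_def)

lemma module_abelian_group: "Module.module K M \<Longrightarrow> abelian_group M"
  by (simp add: Module.module_def)

lemma linear_zero:
  assumes "Module.module K M" "Module.module K N" "f \<in> linear_maps K M N"
  shows "f \<zero>\<^bsub>M\<^esub> = \<zero>\<^bsub>N\<^esub>"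
proof -
  interpret M: Module.module K M by fact
  interpret N: Module.module K N by fact
  \<comment> \<open>Zero is the multiple of zero by the scalar zero, so compatibility with scalars
    is enough.\<close>
  show ?thesis
    using linear_mapsD(3)[OF assms(3) M.R.zero_closed M.zero_closed]
      linear_mapsD(1)[OF assms(3) M.zero_closed] by simp
qed

lemma linear_a_minus:
  assumes "Module.module K M" "Module.module K N" "f \<in> linear_maps K M N"
    and x: "x \<in> carrier M" and y: "y \<in> carrier M"
  shows "f (x \<ominus>\<^bsub>M\<^esub> y) = f x \<ominus>\<^bsub>N\<^esub> f y"
proof -
  interpret M: Module.module K M by fact
  interpret N: Module.module K N by fact
  note fD = linear_mapsD[OF assms(3)]
  \<comment> \<open>Negatives are multiples by minus one, as linearity is stated for sums and scalar
    multiples.\<close>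
  have 1: "\<ominus>\<^bsub>M\<^esub> y = (\<ominus>\<^bsub>K\<^esub> \<one>\<^bsub>K\<^esub>) \<odot>\<^bsub>M\<^esub> y" "\<ominus>\<^bsub>N\<^esub> f y = (\<ominus>\<^bsub>K\<^esub> \<one>\<^bsub>K\<^esub>) \<odot>\<^bsub>N\<^esub> f y"
    using y fD(1)[OF y] by (simp_all add: M.smult_l_minus N.smult_l_minus M.smult_one N.smult_one)
  have "f (x \<oplus>\<^bsub>M\<^esub> \<ominus>\<^bsub>M\<^esub> y) = f x \<oplus>\<^bsub>N\<^esub> \<ominus>\<^bsub>N\<^esub> f y"
    using x y fD(2)[OF x, of "\<ominus>\<^bsub>M\<^esub> y"] fD(3)[of "\<ominus>\<^bsub>K\<^esub> \<one>\<^bsub>K\<^esub>" y] by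
      (simp add: 1(1)[symmetric]) (simp add: 1)
  then show ?thesis by (simp add: a_minus_def)
qed

lemma linear_compose:
  assumes "f \<in> linear_maps K M N" "g \<in> linear_maps K N P" "Module.module K M"
  shows "(\<lambda>v\<in>carrier M. g (f v)) \<in> linear_maps K M P"
proof -
  interpret M: Module.module K M by fact
  show ?thesis
    by (rule linear_mapsI) (simp_all add: linear_mapsD[OF assms(1)] linear_mapsD[OF assms(2)])
qed

lemma linear_id: "Module.module K M \<Longrightarrow> (\<lambda>v\<in>carrier M. v) \<in> linear_maps K M M"
proof -
  assume "Module.module K M"
  then interpret M: Module.module K M .
  show ?thesis by (rule linear_mapsI) simp_all
qed

section \<open>Cocycles, coboundaries and quasi-isomorphisms\<close>

lemma complexD:
  assumes "is_complex K X"
  shows "Module.module K (cmd X n)"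
    and "restrict (cdf X n) (carrier (cmd X n)) \<in> linear_maps K (cmd X n) (cmd X (n + 1))"
    and "x \<in> carrier (cmd X n) \<Longrightarrow> cdf X n x \<in> carrier (cmd X (n + 1))"
    and "x \<in> carrier (cmd X n) \<Longrightarrow> cdf X (n + 1) (cdf X n x) = \<zero>\<^bsub>cmd X (n + 1 + 1)\<^esub>"
proof -
  show 1: "Module.module K (cmd X n)"
    and 2: "restrict (cdf X n) (carrier (cmd X n)) \<in> linear_maps K (cmd X n) (cmd X (n + 1))"
    using assms by (auto simp: is_complex_def)
  show "x \<in> carrier (cmd X n) \<Longrightarrow> cdf X n x \<in> carrier (cmd X (n + 1))"
    using linear_mapsD(1)[OF 2] by simp
  show "x \<in> carrier (cmd X n) \<Longrightarrow> cdf X (n + 1) (cdf X n x) = \<zero>\<^bsub>cmd X (n + 1 + 1)\<^esub>"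
    using assms by (auto simp: is_complex_def)
qed

lemma cdf_zero: "is_complex K X \<Longrightarrow> cdf X n \<zero>\<^bsub>cmd X n\<^esub> = \<zero>\<^bsub>cmd X (n + 1)\<^esub>"
  using linear_zero[OF complexD(1) complexD(1) complexD(2), of K X n]
    abelian_groupE(2)[OF module_abelian_group[OF complexD(1)], of K X n] by simp

lemma cdf_add:
  assumes "is_complex K X" "x \<in> carrier (cmd X n)" "y \<in> carrier (cmd X n)"
  shows "cdf X n (x \<oplus>\<^bsub>cmd X n\<^esub> y) = cdf X n x \<oplus>\<^bsub>cmd X (n + 1)\<^esub> cdf X n y"
  using linear_mapsD(2)[OF complexD(2)[OF assms(1)] assms(2,3)]
    abelian_groupE(1)[OF module_abelian_group[OF complexD(1)[OF assms(1)]] assms(2,3)] assms by simp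

lemma cdf_smult:
  assumes "is_complex K X" "r \<in> carrier K" "x \<in> carrier (cmd X n)"
  shows "cdf X n (r \<odot>\<^bsub>cmd X n\<^esub> x) = r \<odot>\<^bsub>cmd X (n + 1)\<^esub> cdf X n x"
  using linear_mapsD(3)[OF complexD(2)[OF assms(1)] assms(2,3)]
    module.smult_closed[OF complexD(1)[OF assms(1)] assms(2,3)] assms by simp

lemma coboundary_carrier:
  assumes "is_complex K X" "b \<in> coboundaries X n" shows "b \<in> carrier (cmd X n)"
  using assms(2) complexD(3)[OF assms(1), of _ "n - 1"] by (auto simp: coboundaries_def)

lemma coboundary_cocycle:
  assumes "is_complex K X" "b \<in> coboundaries X n" shows "b \<in> cocycles X n"
proof -
  obtain a where a: "a \<in> carrier (cmd X (n - 1))" "b = cdf X (n - 1) a"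
    using assms(2) by (auto simp: coboundaries_def)
  then show ?thesis
    using complexD(3,4)[OF assms(1) a(1)] by (simp add: cocycles_def)
qed

lemma coboundary_add:
  assumes X: "is_complex K X" and "b \<in> coboundaries X n" "b' \<in> coboundaries X n"
  shows "b \<oplus>\<^bsub>cmd X n\<^esub> b' \<in> coboundaries X n"
proof -
  obtain a a' where a: "a \<in> carrier (cmd X (n - 1))" "b = cdf X (n - 1) a"
    "a' \<in> carrier (cmd X (n - 1))" "b' = cdf X (n - 1) a'"
    using assms by (auto simp: coboundaries_def)
  interpret Module.module K "cmd X (n - 1)" by (rule complexD(1)[OF X])
  have "b \<oplus>\<^bsub>cmd X n\<^esub> b' = cdf X (n - 1) (a \<oplus>\<^bsub>cmd X (n - 1)\<^esub> a')"
    using cdf_add[OF X a(1,3)] a by simp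
  then show ?thesis using a by (auto simp: coboundaries_def)
qed

lemma zero_coboundary:
  assumes X: "is_complex K X" shows "\<zero>\<^bsub>cmd X n\<^esub> \<in> coboundaries X n"
proof -
  interpret Module.module K "cmd X (n - 1)" by (rule complexD(1)[OF X])
  show ?thesis using cdf_zero[OF X, of "n - 1"] by (force simp: coboundaries_def)
qed

lemma cocycle_add:
  assumes X: "is_complex K X" and "x \<in> cocycles X n" "y \<in> cocycles X n"
  shows "x \<oplus>\<^bsub>cmd X n\<^esub> y \<in> cocycles X n"
proof -
  interpret M: Module.module K "cmd X n" by (rule complexD(1)[OF X])
  interpret N: Module.module K "cmd X (n + 1)" by (rule complexD(1)[OF X])
  show ?thesis using assms by (simp add: cocycles_def cdf_add[OF X])
qed

lemma cocycle_carrier: "x \<in> cocycles X n \<Longrightarrow> x \<in> carrier (cmd X n)"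
  by (simp add: cocycles_def)

lemma chain_mapsD:
  assumes "f \<in> chain_maps K X Y"
  shows "f n \<in> linear_maps K (cmd X n) (cmd Y n)"
    and "x \<in> carrier (cmd X n) \<Longrightarrow> f (n + 1) (cdf X n x) = cdf Y n (f n x)"
    and "x \<in> carrier (cmd X n) \<Longrightarrow> f n x \<in> carrier (cmd Y n)"
  using assms linear_mapsD(1)[of "f n" K "cmd X n" "cmd Y n" x] by (auto simp: chain_maps_def)

lemma chain_map_cocycle:
  assumes X: "is_complex K X" and Y: "is_complex K Y" and f: "f \<in> chain_maps K X Y" and x: "x
    \<in> cocycles X n"
  shows "f n x \<in> cocycles Y n"
proof -
  have "cdf Y n (f n x) = f (n + 1) \<zero>\<^bsub>cmd X (n + 1)\<^esub>"
    using chain_mapsD(2)[OF f, of x n] x by (simp add: cocycles_def)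
  then show ?thesis
    using linear_zero[OF complexD(1)[OF X] complexD(1)[OF Y] chain_mapsD(1)[OF f]]
      chain_mapsD(3)[OF f] x by (simp add: cocycles_def)
qed

lemma chain_map_coboundary:
  assumes "f \<in> chain_maps K X Y" "b \<in> coboundaries X n"
  shows "f n b \<in> coboundaries Y n"
proof -
  obtain a where a: "a \<in> carrier (cmd X (n - 1))" "b = cdf X (n - 1) a"
    using assms by (auto simp: coboundaries_def)
  then show ?thesis
    using chain_mapsD(2,3)[OF assms(1) a(1)] by (auto simp: coboundaries_def)
qed

lemma chain_map_compose:
  assumes X: "is_complex K X" and f: "f \<in> chain_maps K X Y" and g: "g \<in> chain_maps K Y Z"
  shows "(\<lambda>n. \<lambda>v\<in>carrier (cmd X n). g n (f n v)) \<in> chain_maps K X Z"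
  unfolding chain_maps_def
  by (simp add: linear_compose[OF chain_mapsD(1)[OF f] chain_mapsD(1)[OF g] complexD(1)[OF X]]
      complexD(3)[OF X] chain_mapsD(2,3)[OF f] chain_mapsD(2)[OF g])

lemma chain_map_id:
  assumes X: "is_complex K X"
  shows "(\<lambda>n. \<lambda>v\<in>carrier (cmd X n). v) \<in> chain_maps K X X"
  unfolding chain_maps_def
  by (simp add: linear_id[OF complexD(1)[OF X]] complexD(3)[OF X])

lemma quasi_iso_id:
  assumes X: "is_complex K X"
  shows "quasi_iso X X (\<lambda>n. \<lambda>v\<in>carrier (cmd X n). v)"
proof -
  have "y \<ominus>\<^bsub>cmd X n\<^esub> y \<in> coboundaries X n" if "y \<in> cocycles X n" for n y
  proof -
    interpret Module.module K "cmd X n" by (rule complexD(1)[OF X])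
    show ?thesis
      using zero_coboundary[OF X] cocycle_carrier[OF that] r_neg[of y] by (simp add: a_minus_def)
  qed
  then show ?thesis
    unfolding quasi_iso_def using cocycle_carrier by fastforce
qed

lemma quasi_iso_compose:
  assumes X: "is_complex K X" and Y: "is_complex K Y" and Z: "is_complex K Z"
    and f: "f \<in> chain_maps K X Y" and g: "g \<in> chain_maps K Y Z"
    and qf: "quasi_iso X Y f" and qg: "quasi_iso Y Z g"
  shows "quasi_iso X Z (\<lambda>n. \<lambda>v\<in>carrier (cmd X n). g n (f n v))"
proof -
  have "x \<in> coboundaries X n" if "x \<in> cocycles X n" "g n (f n x) \<in> coboundaries Z n" for n x
    using qf qg that chain_map_cocycle[OF X Y f that(1)] unfolding quasi_iso_def by blast
  moreover have "\<exists>x\<in>cocycles X n. z \<ominus>\<^bsub>cmd Z n\<^esub> g n (f n x) \<in> coboundaries Z n"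
    if z: "z \<in> cocycles Z n" for n z
  proof -
    obtain y where y: "y \<in> cocycles Y n" "z \<ominus>\<^bsub>cmd Z n\<^esub> g n y \<in> coboundaries Z n"
      using qg z unfolding quasi_iso_def by blast
    obtain x where x: "x \<in> cocycles X n" "y \<ominus>\<^bsub>cmd Y n\<^esub> f n x \<in> coboundaries Y n"
      using qf y unfolding quasi_iso_def by blast
    interpret Z: Module.module K "cmd Z n" by (rule complexD(1)[OF Z])
    have fx: "f n x \<in> carrier (cmd Y n)"
      using chain_mapsD(3)[OF f cocycle_carrier[OF x(1)]] .
    have gy: "g n y \<in> carrier (cmd Z n)" "g n (f n x) \<in> carrier (cmd Z n)"
      using chain_mapsD(3)[OF g] fx cocycle_carrier[OF y(1)] by auto
    have "g n (y \<ominus>\<^bsub>cmd Y n\<^esub> f n x) = g n y \<ominus>\<^bsub>cmd Z n\<^esub> g n (f n x)"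
      by (rule linear_a_minus[OF complexD(1)[OF Y] complexD(1)[OF Z] chain_mapsD(1)[OF g]])
        (use fx cocycle_carrier[OF y(1)] in auto)
    then have "g n y \<ominus>\<^bsub>cmd Z n\<^esub> g n (f n x) \<in> coboundaries Z n"
      using chain_map_coboundary[OF g x(2)] by simp
    \<comment> \<open>Telescoping: \<open>z - g f x\<close> is the sum of the coboundaries
      \<open>z - g y\<close> and \<open>g (y - f x)\<close>.\<close>
    from coboundary_add[OF Z y(2) this]
    have "(z \<ominus>\<^bsub>cmd Z n\<^esub> g n y) \<oplus>\<^bsub>cmd Z n\<^esub> (g n y \<ominus>\<^bsub>cmd Z n\<^esub> g n (f n x)) \<in> coboundaries Z n" .
    moreover have "(z \<ominus>\<^bsub>cmd Z n\<^esub> g n y) \<oplus>\<^bsub>cmd Z n\<^esub> (g n y \<ominus>\<^bsub>cmd Z n\<^esub> g n (f n x)) =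
        z \<ominus>\<^bsub>cmd Z n\<^esub> g n (f n x)"
      using cocycle_carrier[OF z] gy by (simp add: a_minus_def Z.a_assoc Z.r_neg1)
    ultimately show ?thesis using x(1) by auto
  qed
  ultimately show ?thesis
    unfolding quasi_iso_def using cocycle_carrier by fastforce
qed

section \<open>Composition in a dg-category\<close>

lemma dgcatD:
  assumes "is_dgcat K C"
  shows "x \<in> gob C \<Longrightarrow> y \<in> gob C \<Longrightarrow> is_complex K (ghom C x y)"
    and "x \<in> gob C \<Longrightarrow> did C x \<in> cocycles (ghom C x x) 0"
    and "\<lbrakk>x \<in> gob C; y \<in> gob C; z \<in> gob C; f \<in> carrier (hm C x y p)\<rbrakk> \<Longrightarrow>
      restrict (\<lambda>g. dcmp C x y z q p g f) (carrier (hm C y z q))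
        \<in> linear_maps K (hm C y z q) (hm C x z (q + p))"
    and "\<lbrakk>x \<in> gob C; y \<in> gob C; z \<in> gob C; g \<in> carrier (hm C y z q)\<rbrakk> \<Longrightarrow>
      restrict (\<lambda>f. dcmp C x y z q p g f) (carrier (hm C x y p))
        \<in> linear_maps K (hm C x y p) (hm C x z (q + p))"
    and "\<lbrakk>x \<in> gob C; y \<in> gob C; z \<in> gob C; g \<in> carrier (hm C y z q); f \<in> carrier (hm C x y p)\<rbrakk> \<Longrightarrow>
      cdf (ghom C x z) (q + p) (dcmp C x y z q p g f) =
        dcmp C x y z (q + 1) p (cdf (ghom C y z) q g) f \<oplus>\<^bsub>hm C x z (q + p + 1)\<^esub>
        (let h = dcmp C x y z q (p + 1) g (cdf (ghom C x y) p f)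
         in if even q then h else \<ominus>\<^bsub>hm C x z (q + p + 1)\<^esub> h)"
    and "\<lbrakk>x \<in> gob C; y \<in> gob C; f \<in> carrier (hm C x y p)\<rbrakk> \<Longrightarrow> dcmp C x y y 0 p (did C y) f = f"
    and "\<lbrakk>x \<in> gob C; y \<in> gob C; f \<in> carrier (hm C x y p)\<rbrakk> \<Longrightarrow> dcmp C x x y p 0 f (did C x) = f"
    and "\<lbrakk>w \<in> gob C; x \<in> gob C; y \<in> gob C; z \<in> gob C; f \<in> carrier (hm C w x p); g
      \<in> carrier (hm C x y q);
      h \<in> carrier (hm C y z r)\<rbrakk> \<Longrightarrow>
      dcmp C w y z r (q + p) h (dcmp C w x y q p g f)
        = dcmp C w x z (r + q) p (dcmp C x y z r q h g) f"
  using assms unfolding is_dgcat_def is_graph_def by simp_all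

lemma dgcatI:
  assumes "\<And>x y. x \<in> gob C \<Longrightarrow> y \<in> gob C \<Longrightarrow> is_complex K (ghom C x y)"
    and "\<And>x. x \<in> gob C \<Longrightarrow> did C x \<in> cocycles (ghom C x x) 0"
    and "\<And>x y z f q p. \<lbrakk>x \<in> gob C; y \<in> gob C; z \<in> gob C; f \<in> carrier (hm C x y p)\<rbrakk> \<Longrightarrow>
      restrict (\<lambda>g. dcmp C x y z q p g f) (carrier (hm C y z q))
        \<in> linear_maps K (hm C y z q) (hm C x z (q + p))"
    and "\<And>x y z g q p. \<lbrakk>x \<in> gob C; y \<in> gob C; z \<in> gob C; g \<in> carrier (hm C y z q)\<rbrakk> \<Longrightarrow>
      restrict (\<lambda>f. dcmp C x y z q p g f) (carrier (hm C x y p))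
        \<in> linear_maps K (hm C x y p) (hm C x z (q + p))"
    and "\<And>x y z f g q p. \<lbrakk>x \<in> gob C; y \<in> gob C; z \<in> gob C; g \<in> carrier (hm C y z q); f
      \<in> carrier (hm C x y p)\<rbrakk> \<Longrightarrow>
      cdf (ghom C x z) (q + p) (dcmp C x y z q p g f) =
        dcmp C x y z (q + 1) p (cdf (ghom C y z) q g) f \<oplus>\<^bsub>hm C x z (q + p + 1)\<^esub>
        (let h = dcmp C x y z q (p + 1) g (cdf (ghom C x y) p f)
         in if even q then h else \<ominus>\<^bsub>hm C x z (q + p + 1)\<^esub> h)"
    and "\<And>x y f p. \<lbrakk>x \<in> gob C; y \<in> gob C; f \<in> carrier (hm C x y p)\<rbrakk> \<Longrightarrow> dcmp C x y y 0 p (did C y) f =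
      f"
    and "\<And>x y f p. \<lbrakk>x \<in> gob C; y \<in> gob C; f \<in> carrier (hm C x y p)\<rbrakk> \<Longrightarrow> dcmp C x x y p 0 f (did C x) =
      f"
    and "\<And>w x y z f g h r q p. \<lbrakk>w \<in> gob C; x \<in> gob C; y \<in> gob C; z \<in> gob C; f
      \<in> carrier (hm C w x p);
      g \<in> carrier (hm C x y q); h \<in> carrier (hm C y z r)\<rbrakk> \<Longrightarrow>
      dcmp C w y z r (q + p) h (dcmp C w x y q p g f)
        = dcmp C w x z (r + q) p (dcmp C x y z r q h g) f"
  shows "is_dgcat K C"
  unfolding is_dgcat_def is_graph_def using assms by (intro conjI ballI allI)

context
  fixes K :: "'k ring" and C :: "('k, 'o, 'm) dgcat"
  assumes C: "is_dgcat K C"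
begin

lemmas hom_complex = dgcatD(1)[OF C]
lemmas hom_module = complexD(1)[OF hom_complex]

lemma dcmp_closed:
  assumes "x \<in> gob C" "y \<in> gob C" "z \<in> gob C" "g \<in> carrier (hm C y z q)" "f \<in> carrier (hm C x y p)"
  shows "dcmp C x y z q p g f \<in> carrier (hm C x z (q + p))"
  using linear_mapsD(1)[OF dgcatD(4)[OF C assms(1-4)] assms(5)] assms(5) by simp

lemma dcmp_smult_left:
  assumes "x \<in> gob C" "y \<in> gob C" "z \<in> gob C" "g \<in> carrier (hm C y z q)" "f
    \<in> carrier (hm C x y p)" "r \<in> carrier K"
  shows "dcmp C x y z q p (r \<odot>\<^bsub>hm C y z q\<^esub> g) f = r \<odot>\<^bsub>hm C x z (q + p)\<^esub> dcmp C x y z q p g f"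
  using linear_mapsD(3)[OF dgcatD(3)[OF C assms(1-3,5)] assms(6,4)] assms(4)
    module.smult_closed[OF hom_module[OF assms(2,3)] assms(6,4)] by simp

lemma dcmp_smult_right:
  assumes "x \<in> gob C" "y \<in> gob C" "z \<in> gob C" "g \<in> carrier (hm C y z q)" "f
    \<in> carrier (hm C x y p)" "r \<in> carrier K"
  shows "dcmp C x y z q p g (r \<odot>\<^bsub>hm C x y p\<^esub> f) = r \<odot>\<^bsub>hm C x z (q + p)\<^esub> dcmp C x y z q p g f"
  using linear_mapsD(3)[OF dgcatD(4)[OF C assms(1-4)] assms(6,5)] assms(5)
    module.smult_closed[OF hom_module[OF assms(1,2)] assms(6,5)] by simp

lemma dcmp_minus_left:
  assumes "x \<in> gob C" "y \<in> gob C" "z \<in> gob C" "g \<in> carrier (hm C y z q)" "g' \<in> carrier (hm C y z q)"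
    "f \<in> carrier (hm C x y p)"
  shows "dcmp C x y z q p (g \<ominus>\<^bsub>hm C y z q\<^esub> g') f = dcmp C x y z q p g f \<ominus>\<^bsub>hm C x z (q + p)\<^esub> dcmp C x
    y z q p g' f"
  using linear_a_minus[OF hom_module[OF assms(2,3)] hom_module[OF assms(1,3)] dgcatD(3)[OF C
    assms(1-3,6)] assms(4,5)] assms(4,5)
    abelian_group.minus_closed[OF module_abelian_group[OF hom_module[OF assms(2,3)]] assms(4,5)] by
      simp

lemma dcmp_minus_right:
  assumes "x \<in> gob C" "y \<in> gob C" "z \<in> gob C" "g \<in> carrier (hm C y z q)" "f \<in> carrier (hm C x y p)"
    "f' \<in> carrier (hm C x y p)"
  shows "dcmp C x y z q p g (f \<ominus>\<^bsub>hm C x y p\<^esub> f') = dcmp C x y z q p g f \<ominus>\<^bsub>hm C x z (q + p)\<^esub> dcmp C x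
    y z q p g f'"
  using linear_a_minus[OF hom_module[OF assms(1,2)] hom_module[OF assms(1,3)] dgcatD(4)[OF C
    assms(1-4)] assms(5,6)] assms(5,6)
    abelian_group.minus_closed[OF module_abelian_group[OF hom_module[OF assms(1,2)]] assms(5,6)] by
      simp

lemma dcmp_zero_left:
  assumes "x \<in> gob C" "y \<in> gob C" "z \<in> gob C" "f \<in> carrier (hm C x y p)"
  shows "dcmp C x y z q p \<zero>\<^bsub>hm C y z q\<^esub> f = \<zero>\<^bsub>hm C x z (q + p)\<^esub>"
  using linear_zero[OF hom_module[OF assms(2,3)] hom_module[OF assms(1,3)] dgcatD(3)[OF C assms]]
    abelian_groupE(2)[OF module_abelian_group[OF hom_module[OF assms(2,3)]]] by simp

lemma dcmp_zero_right:
  assumes "x \<in> gob C" "y \<in> gob C" "z \<in> gob C" "g \<in> carrier (hm C y z q)"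
  shows "dcmp C x y z q p g \<zero>\<^bsub>hm C x y p\<^esub> = \<zero>\<^bsub>hm C x z (q + p)\<^esub>"
  using linear_zero[OF hom_module[OF assms(1,2)] hom_module[OF assms(1,3)] dgcatD(4)[OF C assms]]
    abelian_groupE(2)[OF module_abelian_group[OF hom_module[OF assms(1,2)]]] by simp

lemma dcmp_cocycle:
  assumes "x \<in> gob C" "y \<in> gob C" "z \<in> gob C" "g \<in> cocycles (ghom C y z) 0" "f
    \<in> cocycles (ghom C x y) 0"
  shows "dcmp C x y z 0 0 g f \<in> cocycles (ghom C x z) 0"
proof -
  interpret Module.module K "hm C x z 1" by (rule hom_module[OF assms(1,3)])
  show ?thesis
    using dgcatD(5)[OF C assms(1-3), of g 0 f 0] dcmp_closed[OF assms(1-3), of g 0 f 0] assms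
      dcmp_zero_left[OF assms(1-3), of f 0 1] dcmp_zero_right[OF assms(1-3), of g 0 1]
    by (simp add: cocycles_def)
qed

text \<open>The Leibniz rule with \<open>f\<close> closed: \<open>(d b) f = d (b f)\<close>. The
  minus sign caused by the odd degree of \<open>b\<close> falls on a zero term.\<close>

lemma dcmp_coboundary_left:
  assumes "x \<in> gob C" "y \<in> gob C" "z \<in> gob C" "g \<in> coboundaries (ghom C y z) 0" "f
    \<in> cocycles (ghom C x y) 0"
  shows "dcmp C x y z 0 0 g f \<in> coboundaries (ghom C x z) 0"
proof -
  interpret Module.module K "hm C x z 0" by (rule hom_module[OF assms(1,3)])
  obtain b where b: "b \<in> carrier (hm C y z (-1))" "g = cdf (ghom C y z) (-1) b"
    using assms(4) by (auto simp: coboundaries_def)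
  have f: "f \<in> carrier (hm C x y 0)" "cdf (ghom C x y) 0 f = \<zero>\<^bsub>hm C x y 1\<^esub>"
    using assms(5) by (auto simp: cocycles_def)
  have g: "g \<in> carrier (hm C y z 0)" by (rule coboundary_carrier[OF hom_complex[OF assms(2,3)]
    assms(4)])
  have "cdf (ghom C x z) (-1) (dcmp C x y z (-1) 0 b f) = dcmp C x y z 0 0 g f"
    using dgcatD(5)[OF C assms(1-3) b(1) f(1)] dcmp_zero_right[OF assms(1-3) b(1), of 1] f(2) b(2)
      dcmp_closed[OF assms(1-3) g f(1)] by (simp add: a_minus_def)
  then show ?thesis
    using dcmp_closed[OF assms(1-3) b(1) f(1)] by (force simp: coboundaries_def)
qed

text \<open>As \<open>g\<close> is closed of even degree, \<open>g (d b) = d (g b)\<close> without a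
  sign.\<close>

lemma dcmp_coboundary_right:
  assumes "x \<in> gob C" "y \<in> gob C" "z \<in> gob C" "g \<in> cocycles (ghom C y z) 0" "f
    \<in> coboundaries (ghom C x y) 0"
  shows "dcmp C x y z 0 0 g f \<in> coboundaries (ghom C x z) 0"
proof -
  interpret Module.module K "hm C x z 0" by (rule hom_module[OF assms(1,3)])
  obtain b where b: "b \<in> carrier (hm C x y (-1))" "f = cdf (ghom C x y) (-1) b"
    using assms(5) by (auto simp: coboundaries_def)
  have g: "g \<in> carrier (hm C y z 0)" "cdf (ghom C y z) 0 g = \<zero>\<^bsub>hm C y z 1\<^esub>"
    using assms(4) by (auto simp: cocycles_def)
  have f: "f \<in> carrier (hm C x y 0)" by (rule coboundary_carrier[OF hom_complex[OF assms(1,2)]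
    assms(5)])
  have "cdf (ghom C x z) (-1) (dcmp C x y z 0 (-1) g b) = dcmp C x y z 0 0 g f"
    using dgcatD(5)[OF C assms(1-3) g(1) b(1)] dcmp_zero_left[OF assms(1-3) b(1), of 1] g(2) b(2)
      dcmp_closed[OF assms(1-3) g(1) f] by simp
  then show ?thesis
    using dcmp_closed[OF assms(1-3) g(1) b(1)] by (force simp: coboundaries_def)
qed

lemma did_homotopy_equivalence:
  assumes x: "x \<in> gob C" shows "did C x \<in> homotopy_equivalences C x x"
proof -
  interpret Module.module K "hm C x x 0" by (rule hom_module[OF x x])
  note i = dgcatD(2)[OF C x]
  have "dcmp C x x x 0 0 (did C x) (did C x) \<ominus>\<^bsub>hm C x x 0\<^esub> did C x = \<zero>\<^bsub>hm C x x 0\<^esub>"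
    using dgcatD(6)[OF C x x cocycle_carrier[OF i]] cocycle_carrier[OF i] by
      (simp add: a_minus_def r_neg)
  then show ?thesis
    unfolding homotopy_equivalences_def
    using i zero_coboundary[OF hom_complex[OF x x], of 0] by (auto intro!: bexI[of _ "did C x"])
qed

text \<open>If \<open>v u \<sim> 1\<close> and \<open>v' u' \<sim> 1\<close>, then \<open>(v v') (u' u) - 1 = v (v' u' - 1) u + (v u - 1) \<sim> 0\<close>.\<close>

lemma homotopy_inverse_compose:
  assumes x: "x \<in> gob C" and y: "y \<in> gob C" and z: "z \<in> gob C"
    and u: "u \<in> cocycles (ghom C x y) 0" and v: "v \<in> cocycles (ghom C y x) 0"
    and u': "u' \<in> cocycles (ghom C y z) 0" and v': "v' \<in> cocycles (ghom C z y) 0"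
    and vu: "dcmp C x y x 0 0 v u \<ominus>\<^bsub>hm C x x 0\<^esub> did C x \<in> coboundaries (ghom C x x) 0"
    and vu': "dcmp C y z y 0 0 v' u' \<ominus>\<^bsub>hm C y y 0\<^esub> did C y \<in> coboundaries (ghom C y y) 0"
  shows "dcmp C x z x 0 0 (dcmp C z y x 0 0 v v') (dcmp C x y z 0 0 u' u) \<ominus>\<^bsub>hm C x x 0\<^esub> did C x
    \<in> coboundaries (ghom C x x) 0"
proof -
  interpret Module.module K "hm C x x 0" by (rule hom_module[OF x x])
  note uc = cocycle_carrier[OF u] and vc = cocycle_carrier[OF v] and uc' = cocycle_carrier[OF u']
    and vc' = cocycle_carrier[OF v']
  note yc = cocycle_carrier[OF dgcatD(2)[OF C y]] and xc = cocycle_carrier[OF dgcatD(2)[OF C x]]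
  define w where "w = dcmp C y z y 0 0 v' u'"
  have w: "w \<in> carrier (hm C y y 0)" using dcmp_closed[OF y z y vc' uc'] by (simp add: w_def)
  have wu: "dcmp C x y y 0 0 w u \<in> carrier (hm C x y 0)" using dcmp_closed[OF x y y w uc] by simp
  have "dcmp C x y x 0 0 v (dcmp C x y y 0 0 (w \<ominus>\<^bsub>hm C y y 0\<^esub> did C y) u)
    \<in> coboundaries (ghom C x x) 0"
    using dcmp_coboundary_right[OF x y x v dcmp_coboundary_left[OF x y y vu' u]] unfolding w_def .
  moreover have "dcmp C x y x 0 0 v (dcmp C x y y 0 0 (w \<ominus>\<^bsub>hm C y y 0\<^esub> did C y) u) =
      dcmp C x y x 0 0 v (dcmp C x y y 0 0 w u) \<ominus>\<^bsub>hm C x x 0\<^esub> dcmp C x y x 0 0 v u"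
    using dcmp_minus_left[OF x y y w yc uc] dgcatD(6)[OF C x y uc] dcmp_minus_right[OF x y x vc wu
      uc] by simp
  moreover have "dcmp C x z x 0 0 (dcmp C z y x 0 0 v v') (dcmp C x y z 0 0 u' u) =
      dcmp C x y x 0 0 v (dcmp C x y y 0 0 w u)"
    using dgcatD(8)[OF C x z y x, of "dcmp C x y z 0 0 u' u" 0 v' 0 v 0] dcmp_closed[OF x y z uc'
      uc] vc' vc
      dgcatD(8)[OF C x y z y uc uc' vc'] by (simp add: w_def)
  ultimately have "(dcmp C x z x 0 0 (dcmp C z y x 0 0 v v') (dcmp C x y z 0 0 u' u) \<ominus>\<^bsub>hm C x x 0\<^esub>
    dcmp C x y x 0 0 v u)
      \<oplus>\<^bsub>hm C x x 0\<^esub> (dcmp C x y x 0 0 v u \<ominus>\<^bsub>hm C x x 0\<^esub> did C x) \<in> coboundaries (ghom C x x) 0"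
    using coboundary_add[OF hom_complex[OF x x] _ vu] by simp
  moreover have "dcmp C x y x 0 0 v u \<in> carrier (hm C x x 0)"
    "dcmp C x z x 0 0 (dcmp C z y x 0 0 v v') (dcmp C x y z 0 0 u' u) \<in> carrier (hm C x x 0)"
    using dcmp_closed[OF x y x vc uc] dcmp_closed[OF x z x,
      of "dcmp C z y x 0 0 v v'" 0 "dcmp C x y z 0 0 u' u" 0]
      dcmp_closed[OF x y z uc' uc] dcmp_closed[OF z y x vc vc'] by auto
  ultimately show ?thesis
    using xc by (simp add: a_minus_def a_assoc r_neg1)
qed

lemma homotopy_equivalence_compose:
  assumes x: "x \<in> gob C" and y: "y \<in> gob C" and z: "z \<in> gob C"
    and u: "u \<in> homotopy_equivalences C x y" and u': "u' \<in> homotopy_equivalences C y z"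
  shows "dcmp C x y z 0 0 u' u \<in> homotopy_equivalences C x z"
proof -
  obtain v where v: "u \<in> cocycles (ghom C x y) 0" "v \<in> cocycles (ghom C y x) 0"
    "dcmp C x y x 0 0 v u \<ominus>\<^bsub>hm C x x 0\<^esub> did C x \<in> coboundaries (ghom C x x) 0"
    "dcmp C y x y 0 0 u v \<ominus>\<^bsub>hm C y y 0\<^esub> did C y \<in> coboundaries (ghom C y y) 0"
    using u by (auto simp: homotopy_equivalences_def)
  obtain v' where v': "u' \<in> cocycles (ghom C y z) 0" "v' \<in> cocycles (ghom C z y) 0"
    "dcmp C y z y 0 0 v' u' \<ominus>\<^bsub>hm C y y 0\<^esub> did C y \<in> coboundaries (ghom C y y) 0"
    "dcmp C z y z 0 0 u' v' \<ominus>\<^bsub>hm C z z 0\<^esub> did C z \<in> coboundaries (ghom C z z) 0"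
    using u' by (auto simp: homotopy_equivalences_def)
  show ?thesis
    unfolding homotopy_equivalences_def
    \<comment> \<open>One lemma gives both homotopies: in the second instance the inverses play the
      role of the morphisms.\<close>
    using homotopy_inverse_compose[OF x y z v(1,2) v'(1,2) v(3) v'(3)]
      homotopy_inverse_compose[OF z y x v'(2,1) v(2,1) v'(4) v(4)]
      dcmp_cocycle[OF x y z v'(1) v(1)] dcmp_cocycle[OF z y x v(2) v'(2)] by blast
qed

end

section \<open>Graph maps and dg-functors\<close>

lemma graph_mapsD:
  assumes "f \<in> graph_maps K G H"
  shows "x \<in> gob G \<Longrightarrow> fst f x \<in> gob H"
    and "fst f \<in> extensional (gob G)"
    and "x \<in> gob G \<Longrightarrow> y \<in> gob G \<Longrightarrow> snd f x y \<in> chain_maps K (ghom G x y) (ghom H (fst f x) (fst f y))"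
    and "\<not> (x \<in> gob G \<and> y \<in> gob G) \<Longrightarrow> snd f x y = (\<lambda>_ _. undefined)"
  using assms by (auto simp: graph_maps_def PiE_def)

lemma graph_mapsI:
  assumes "\<And>x. x \<in> gob G \<Longrightarrow> fst f x \<in> gob H" and "fst f \<in> extensional (gob G)"
    and "\<And>x y. x \<in> gob G \<Longrightarrow> y \<in> gob G \<Longrightarrow> snd f x y \<in> chain_maps K (ghom G x y) (ghom H (fst f x) (fst
      f y))"
    and "\<And>x y. \<not> (x \<in> gob G \<and> y \<in> gob G) \<Longrightarrow> snd f x y = (\<lambda>_ _. undefined)"
  shows "f \<in> graph_maps K G H"
  using assms by (cases f) (auto simp: graph_maps_def PiE_def)

lemma graph_maps_ext:
  assumes f: "f \<in> graph_maps K G H" and g: "g \<in> graph_maps K G H"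
    and ob: "\<And>x. x \<in> gob G \<Longrightarrow> fst f x = fst g x"
    and ar: "\<And>x y n v. x \<in> gob G \<Longrightarrow> y \<in> gob G \<Longrightarrow> v \<in> carrier (hm G x y n) \<Longrightarrow>
      snd f x y n v = snd g x y n v"
  shows "f = g"
proof (rule prod_eqI)
  show "fst f = fst g"
    by (rule extensionalityI[OF graph_mapsD(2)[OF f] graph_mapsD(2)[OF g] ob])
  have "snd f x y = snd g x y" for x y
  proof (cases "x \<in> gob G \<and> y \<in> gob G")
    case True
    have "snd f x y n = snd g x y n" for n
      using True linear_mapsD(4)[OF chain_mapsD(1)[OF graph_mapsD(3)[OF f]]]
        linear_mapsD(4)[OF chain_mapsD(1)[OF graph_mapsD(3)[OF g]]]
      by (intro extensionalityI[of _ "carrier (hm G x y n)"]) (auto intro: ar)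
    then show ?thesis by blast
  next
    case False
    then show ?thesis using graph_mapsD(4)[OF f] graph_mapsD(4)[OF g] by metis
  qed
  then show "snd f = snd g" by blast
qed

lemma gmap_comp_fst: "x \<in> gob G \<Longrightarrow> fst (gmap_comp G g f) x = fst g (fst f x)"
  by (simp add: gmap_comp_def)

lemma gmap_comp_snd:
  "x \<in> gob G \<Longrightarrow> y \<in> gob G \<Longrightarrow>
    snd (gmap_comp G g f) x y = (\<lambda>n. \<lambda>v\<in>carrier (hm G x y n).
      snd g (fst f x) (fst f y) n (snd f x y n v))"
  by (auto simp: gmap_comp_def fun_eq_iff)

lemma gmap_comp_apply:
  "x \<in> gob G \<Longrightarrow> y \<in> gob G \<Longrightarrow> v \<in> carrier (hm G x y n) \<Longrightarrow>
    snd (gmap_comp G g f) x y n v = snd g (fst f x) (fst f y) n (snd f x y n v)"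
  by (simp add: gmap_comp_snd)

lemma gmap_comp_closed:
  assumes G: "is_graph K G" and f: "f \<in> graph_maps K G H" and g: "g \<in> graph_maps K H I"
  shows "gmap_comp G g f \<in> graph_maps K G I"
proof (rule graph_mapsI)
  note fD = graph_mapsD[OF f] and gD = graph_mapsD[OF g]
  show "fst (gmap_comp G g f) x \<in> gob I" if "x \<in> gob G" for x
    using that by (simp add: gmap_comp_fst fD gD)
  show "snd (gmap_comp G g f) x y
      \<in> chain_maps K (ghom G x y) (ghom I (fst (gmap_comp G g f) x) (fst (gmap_comp G g f) y))"
    if x: "x \<in> gob G" and y: "y \<in> gob G" for x y
    unfolding gmap_comp_snd[OF x y] gmap_comp_fst[OF x] gmap_comp_fst[OF y]
    by (rule chain_map_compose) (use G x y in \<open>auto simp: is_graph_def intro: fD gD\<close>)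
qed (auto simp: gmap_comp_def fun_eq_iff)

lemma gmap_id_fst: "x \<in> gob G \<Longrightarrow> fst (gmap_id G) x = x"
  by (simp add: gmap_id_def)

lemma gmap_id_snd:
  "x \<in> gob G \<Longrightarrow> y \<in> gob G \<Longrightarrow> snd (gmap_id G) x y = (\<lambda>n. \<lambda>v\<in>carrier (hm G x y n). v)"
  by (auto simp: gmap_id_def fun_eq_iff)

lemma gmap_id_closed:
  assumes G: "is_graph K G" shows "gmap_id G \<in> graph_maps K G G"
proof (rule graph_mapsI)
  show "snd (gmap_id G) x y \<in> chain_maps K (ghom G x y) (ghom G (fst (gmap_id G) x) (fst (gmap_id G)
    y))"
    if "x \<in> gob G" "y \<in> gob G" for x y
    using that G by (simp add: gmap_id_fst gmap_id_snd chain_map_id is_graph_def)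
qed (auto simp: gmap_id_def fun_eq_iff)

lemma dg_functorsD:
  assumes "f \<in> dg_functors K C D"
  shows "f \<in> graph_maps K C D"
    and "x \<in> gob C \<Longrightarrow> snd f x x 0 (did C x) = did D (fst f x)"
    and "\<lbrakk>x \<in> gob C; y \<in> gob C; z \<in> gob C; g \<in> carrier (hm C y z q); h \<in> carrier (hm C x y p)\<rbrakk> \<Longrightarrow>
      snd f x z (q + p) (dcmp C x y z q p g h) =
      dcmp D (fst f x) (fst f y) (fst f z) q p (snd f y z q g) (snd f x y p h)"
  using assms by (auto simp: dg_functors_def)

lemma dg_functorsI:
  assumes "f \<in> graph_maps K C D"
    and "\<And>x. x \<in> gob C \<Longrightarrow> snd f x x 0 (did C x) = did D (fst f x)"
    and "\<And>x y z g h q p. \<lbrakk>x \<in> gob C; y \<in> gob C; z \<in> gob C; g \<in> carrier (hm C y z q); h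
      \<in> carrier (hm C x y p)\<rbrakk> \<Longrightarrow>
      snd f x z (q + p) (dcmp C x y z q p g h) =
      dcmp D (fst f x) (fst f y) (fst f z) q p (snd f y z q g) (snd f x y p h)"
  shows "f \<in> dg_functors K C D"
  using assms by (cases f) (auto simp: dg_functors_def)

lemma dgcat_graph: "is_dgcat K C \<Longrightarrow> is_graph K C"
  by (simp add: is_dgcat_def)

lemma dg_functor_comp:
  assumes C: "is_dgcat K C" and f: "f \<in> dg_functors K C D" and g: "g \<in> dg_functors K D E"
  shows "gmap_comp C g f \<in> dg_functors K C E"
proof (rule dg_functorsI)
  note fD = dg_functorsD[OF f] and gD = dg_functorsD[OF g]
  show "gmap_comp C g f \<in> graph_maps K C E"
    by (rule gmap_comp_closed[OF dgcat_graph[OF C] fD(1) gD(1)])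
  show "snd (gmap_comp C g f) x x 0 (did C x) = did E (fst (gmap_comp C g f) x)" if x: "x \<in> gob C"
    for x
    using x cocycle_carrier[OF dgcatD(2)[OF C x]]
    by (simp add: gmap_comp_apply gmap_comp_fst fD(2) gD(2) graph_mapsD(1)[OF fD(1)])
  show "snd (gmap_comp C g f) x z (q + p) (dcmp C x y z q p k h) =
      dcmp E (fst (gmap_comp C g f) x) (fst (gmap_comp C g f) y) (fst (gmap_comp C g f) z) q p
        (snd (gmap_comp C g f) y z q k) (snd (gmap_comp C g f) x y p h)"
    if x: "x \<in> gob C" "y \<in> gob C" "z \<in> gob C" and "k \<in> carrier (hm C y z q)" "h
      \<in> carrier (hm C x y p)" for x y z k h q p
    using that dcmp_closed[OF C that] graph_mapsD(1)[OF fD(1)] chain_mapsD(3)[OF graph_mapsD(3)[OF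
      fD(1)]]
    by (simp add: gmap_comp_apply gmap_comp_fst fD(3) gD(3))
qed

lemma dg_functor_id:
  assumes C: "is_dgcat K C" shows "gmap_id C \<in> dg_functors K C C"
proof (rule dg_functorsI)
  show "gmap_id C \<in> graph_maps K C C" by (rule gmap_id_closed[OF dgcat_graph[OF C]])
  show "snd (gmap_id C) x x 0 (did C x) = did C (fst (gmap_id C) x)" if x: "x \<in> gob C" for x
    using x cocycle_carrier[OF dgcatD(2)[OF C x]] by (simp add: gmap_id_fst gmap_id_snd)
  show "snd (gmap_id C) x z (q + p) (dcmp C x y z q p k h) =
      dcmp C (fst (gmap_id C) x) (fst (gmap_id C) y) (fst (gmap_id C) z) q p
        (snd (gmap_id C) y z q k) (snd (gmap_id C) x y p h)"
    if x: "x \<in> gob C" "y \<in> gob C" "z \<in> gob C" and "k \<in> carrier (hm C y z q)" "h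
      \<in> carrier (hm C x y p)" for x y z k h q p
    using that dcmp_closed[OF C that] by (simp add: gmap_id_fst gmap_id_snd)
qed

section \<open>Quasi-equivalences in the category of dg-categories\<close>

lemma dgCat_simps [simp]:
  "Ob (dgCat T K) = {C. is_dgcat K C}" "Hom (dgCat T K) = dg_functors K"
  "Cmp (dgCat T K) C D E g f = gmap_comp C g f" "Idn (dgCat T K) C = gmap_id C"
  "weq (dgCat T K) = quasi_equivalence" "fib (dgCat T K) = dg_fibration"
  by (simp_all add: dgCat_def)

lemma category_dgCat: "category (dgCat T K)"
  unfolding category_def dgCat_simps
proof (intro conjI ballI; unfold mem_Collect_eq)
  fix C assume "is_dgcat K C" then show "gmap_id C \<in> dg_functors K C C" by (rule dg_functor_id)
next
  fix C D E f g
  assume "is_dgcat K C" "is_dgcat K D" "is_dgcat K E" "f \<in> dg_functors K C D" "g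
    \<in> dg_functors K D E"
  then show "gmap_comp C g f \<in> dg_functors K C E" by (intro dg_functor_comp)
next
  fix C D f
  assume C: "is_dgcat K C" and D: "is_dgcat K D" and f: "f \<in> dg_functors K C D"
  note fg = dg_functorsD(1)[OF f]
  note fD = graph_mapsD(1)[OF fg] chain_mapsD(3)[OF graph_mapsD(3)[OF fg]]
  show "gmap_comp C (gmap_id D) f = f"
    by (rule graph_maps_ext[OF gmap_comp_closed[OF dgcat_graph[OF C] fg gmap_id_closed[OF
      dgcat_graph[OF D]]] fg])
      (simp_all add: gmap_comp_fst gmap_comp_apply gmap_id_fst gmap_id_snd fD)
  show "gmap_comp C f (gmap_id C) = f"
    by (rule graph_maps_ext[OF gmap_comp_closed[OF dgcat_graph[OF C] gmap_id_closed[OF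
      dgcat_graph[OF C]] fg] fg])
      (simp_all add: gmap_comp_fst gmap_comp_apply gmap_id_fst gmap_id_snd)
next
  fix B C D E f g h
  assume B: "is_dgcat K B" and C: "is_dgcat K C" and D: "is_dgcat K D" and E: "is_dgcat K E"
    and f: "f \<in> dg_functors K B C" and g: "g \<in> dg_functors K C D" and h: "h \<in> dg_functors K D E"
  note fg = dg_functorsD(1)[OF f]
  show "gmap_comp B h (gmap_comp B g f) = gmap_comp B (gmap_comp C h g) f"
    by (rule graph_maps_ext[OF dg_functorsD(1)[OF dg_functor_comp[OF B dg_functor_comp[OF B f g] h]]
          dg_functorsD(1)[OF dg_functor_comp[OF B f dg_functor_comp[OF C g h]]]])
      (simp_all add: gmap_comp_fst gmap_comp_apply graph_mapsD(1)[OF fg] chain_mapsD(3)[OF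
        graph_mapsD(3)[OF fg]])
qed

lemma quasi_equivalence_id:
  assumes C: "is_dgcat K C" shows "quasi_equivalence C C (gmap_id C)"
  unfolding quasi_equivalence_def
  using did_homotopy_equivalence[OF C] quasi_iso_id[OF dgcatD(1)[OF C]]
  by (auto simp: gmap_id_fst gmap_id_snd)

lemma dg_functor_homotopy_equivalence:
  assumes C: "is_dgcat K C" and D: "is_dgcat K D" and f: "f \<in> dg_functors K C D"
    and x: "x \<in> gob C" and y: "y \<in> gob C" and u: "u \<in> homotopy_equivalences C x y"
  shows "snd f x y 0 u \<in> homotopy_equivalences D (fst f x) (fst f y)"
proof -
  note fg = dg_functorsD(1)[OF f]
  note fx = graph_mapsD(1)[OF fg x] and fy = graph_mapsD(1)[OF fg y]
  note ch = graph_mapsD(3)[OF fg]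
  obtain v where v: "u \<in> cocycles (ghom C x y) 0" "v \<in> cocycles (ghom C y x) 0"
    "dcmp C x y x 0 0 v u \<ominus>\<^bsub>hm C x x 0\<^esub> did C x \<in> coboundaries (ghom C x x) 0"
    "dcmp C y x y 0 0 u v \<ominus>\<^bsub>hm C y y 0\<^esub> did C y \<in> coboundaries (ghom C y y) 0"
    using u by (auto simp: homotopy_equivalences_def)
  \<comment> \<open>Stated for arbitrary objects and cocycles, so that it can be applied again with
    \<open>x\<close> and \<open>y\<close> exchanged.\<close>
  have *: "dcmp D (fst f x) (fst f y) (fst f x) 0 0 (snd f y x 0 v) (snd f x y 0 u) \<ominus>\<^bsub>hm D (fst f x)
    (fst f x) 0\<^esub>
      did D (fst f x) \<in> coboundaries (ghom D (fst f x) (fst f x)) 0"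
    if x: "x \<in> gob C" and y: "y \<in> gob C"
      and u: "u \<in> cocycles (ghom C x y) 0" and v: "v \<in> cocycles (ghom C y x) 0"
      and b: "dcmp C x y x 0 0 v u \<ominus>\<^bsub>hm C x x 0\<^esub> did C x \<in> coboundaries (ghom C x x) 0" for x y u v
  proof -
    note cu = cocycle_carrier[OF u] and cv = cocycle_carrier[OF v]
      and ci = cocycle_carrier[OF dgcatD(2)[OF C x]]
    have "snd f x x 0 (dcmp C x y x 0 0 v u \<ominus>\<^bsub>hm C x x 0\<^esub> did C x) =
        snd f x x 0 (dcmp C x y x 0 0 v u) \<ominus>\<^bsub>hm D (fst f x) (fst f x) 0\<^esub> snd f x x 0 (did C x)"
      by (rule linear_a_minus[OF complexD(1) complexD(1) chain_mapsD(1)[OF ch[OF x x]]])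
        (use dcmp_closed[OF C x y x cv cu] ci dgcatD(1)[OF C] dgcatD(1)[OF D] x graph_mapsD(1)[OF
          fg] in auto)
    then show ?thesis
      using chain_map_coboundary[OF ch[OF x x] b] dg_functorsD(2)[OF f x] dg_functorsD(3)[OF f x y x
        cv cu] by simp
  qed
  show ?thesis
    unfolding homotopy_equivalences_def
    using *[OF x y v(1,2,3)] *[OF y x v(2,1,4)]
      chain_map_cocycle[OF dgcatD(1)[OF C x y] dgcatD(1)[OF D fx fy] ch[OF x y] v(1)]
      chain_map_cocycle[OF dgcatD(1)[OF C y x] dgcatD(1)[OF D fy fx] ch[OF y x] v(2)] by blast
qed

lemma quasi_equivalence_comp:
  assumes C: "is_dgcat K C" and D: "is_dgcat K D" and E: "is_dgcat K E"
    and f: "f \<in> dg_functors K C D" and g: "g \<in> dg_functors K D E"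
    and qf: "quasi_equivalence C D f" and qg: "quasi_equivalence D E g"
  shows "quasi_equivalence C E (gmap_comp C g f)"
  unfolding quasi_equivalence_def
proof (intro conjI ballI)
  note fg = dg_functorsD(1)[OF f] and gg = dg_functorsD(1)[OF g]
  note f1 = graph_mapsD(1)[OF fg] and g1 = graph_mapsD(1)[OF gg]
  show "quasi_iso (ghom C x y) (ghom E (fst (gmap_comp C g f) x) (fst (gmap_comp C g f) y)) (snd
    (gmap_comp C g f) x y)"
    if x: "x \<in> gob C" and y: "y \<in> gob C" for x y
    unfolding gmap_comp_snd[OF x y] gmap_comp_fst[OF x] gmap_comp_fst[OF y]
    by (rule quasi_iso_compose[OF dgcatD(1)[OF C x y] dgcatD(1)[OF D f1[OF x] f1[OF y]]
          dgcatD(1)[OF E g1[OF f1[OF x]] g1[OF f1[OF y]]] graph_mapsD(3)[OF fg x y]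
          graph_mapsD(3)[OF gg f1[OF x] f1[OF y]]])
      (use qf qg x y f1 in \<open>auto simp: quasi_equivalence_def\<close>)
  show "\<exists>x\<in>gob C. homotopy_equivalences E (fst (gmap_comp C g f) x) z \<noteq> {}" if z: "z \<in> gob E" for z
  proof -
    obtain y u' where y: "y \<in> gob D" "u' \<in> homotopy_equivalences E (fst g y) z"
      using qg z unfolding quasi_equivalence_def by blast
    obtain x u where x: "x \<in> gob C" "u \<in> homotopy_equivalences D (fst f x) y"
      using qf y(1) unfolding quasi_equivalence_def by blast
    \<comment> \<open>The image under \<open>g\<close> of an equivalence from \<open>f x\<close> to
      \<open>y\<close> starts at \<open>g f x\<close> and ends at \<open>g y\<close>, where it
      composes with \<open>u'\<close>.\<close>
    have "snd g (fst f x) y 0 u \<in> homotopy_equivalences E (fst g (fst f x)) (fst g y)"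
      by (rule dg_functor_homotopy_equivalence[OF D E g f1[OF x(1)] y(1) x(2)])
    from homotopy_equivalence_compose[OF E g1[OF f1[OF x(1)]] g1[OF y(1)] z this y(2)]
    show ?thesis using x(1) gmap_comp_fst[OF x(1), of g f] by (auto intro!: bexI[of _ x])
  qed
qed

lemma relative_category_dgCat: "relative_category (dgCat T K) (weq (dgCat T K))"
  by (rule relative_category.intro)
    (auto simp: category_dgCat quasi_equivalence_id intro: quasi_equivalence_comp)


section \<open>The linear simplices\<close>

text \<open>Scalars and vertices are encoded by \<open>\<iota>\<close> and \<open>e\<close>, with left inverses \<open>\<kappa>\<close> and \<open>d\<close>, because the
  objects of \<open>cL\<close> live in the universe \<open>'u\<close>, whereas \<open>Delta_graph\<close> has vertices in \<open>nat\<close> and scalars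
  in \<open>'k\<close>.\<close>

definition lin_cpx :: "'k ring \<Rightarrow> ('k \<Rightarrow> 'b) \<Rightarrow> ('b \<Rightarrow> 'k) \<Rightarrow> bool \<Rightarrow> ('k, 'b) cpx" where
  "lin_cpx K \<iota> \<kappa> b = \<lparr>
    cmd = (\<lambda>m. \<lparr>carrier = \<iota> ` (if b \<and> m = 0 then carrier K else {\<zero>\<^bsub>K\<^esub>}), mult = undefined,
      one = undefined, ring.zero = \<iota> \<zero>\<^bsub>K\<^esub>, add = (\<lambda>v w. \<iota> (\<kappa> v \<oplus>\<^bsub>K\<^esub> \<kappa> w)), smult = (\<lambda>r v.
        \<iota> (r \<otimes>\<^bsub>K\<^esub> \<kappa> v))\<rparr>),
    cdf = (\<lambda>m v. \<iota> \<zero>\<^bsub>K\<^esub>)\<rparr>"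

text \<open>One definition serves two purposes: with identity encodings it is
  \<open>Delta_graph\<close>, and with encodings into \<open>'u\<close> it is the generating graph
  that \<open>free_finite_type\<close> asks for.\<close>

definition chain_graph ::
    "'k ring \<Rightarrow> ('k \<Rightarrow> 'b) \<Rightarrow> ('b \<Rightarrow> 'k) \<Rightarrow> (nat \<Rightarrow> 'a) \<Rightarrow> ('a \<Rightarrow> nat) \<Rightarrow> nat \<Rightarrow> ('k, 'a, 'b) graph" where
  "chain_graph K \<iota> \<kappa> e d n = \<lparr>gob = e ` {..n}, ghom = (\<lambda>x y. lin_cpx K \<iota> \<kappa> (d y = Suc (d x)))\<rparr>"

text \<open>Composition needs no case distinction: outside degree 0 or against the order the only
  element is \<open>\<iota> \<zero>\<close>, and products with zero vanish.\<close>

definition simplex ::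
    "'k ring \<Rightarrow> ('k \<Rightarrow> 'b) \<Rightarrow> ('b \<Rightarrow> 'k) \<Rightarrow> (nat \<Rightarrow> 'a) \<Rightarrow> ('a \<Rightarrow> nat) \<Rightarrow> nat \<Rightarrow> ('k, 'a, 'b) dgcat" where
  "simplex K \<iota> \<kappa> e d n = \<lparr>gob = e ` {..n}, ghom = (\<lambda>x y. lin_cpx K \<iota> \<kappa> (d x \<le> d y)),
    dcmp = (\<lambda>x y z q p g f. \<iota> (\<kappa> g \<otimes>\<^bsub>K\<^esub> \<kappa> f)), did = (\<lambda>x. \<iota> \<one>\<^bsub>K\<^esub>)\<rparr>"

lemma Delta_graph_chain_graph: "Delta_graph K n = chain_graph K (\<lambda>r. r) (\<lambda>r. r) (\<lambda>i. i) (\<lambda>i. i) n"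
  by (auto simp: Delta_graph_def chain_graph_def unit_cpx_def lin_cpx_def fun_eq_iff)

section \<open>Encoded copies of the complexes \<open>k\<close> and \<open>0\<close>\<close>

locale linear_encoding = cring K for K :: "'k ring" (structure) +
  fixes \<iota> :: "'k \<Rightarrow> 'b" and \<kappa> :: "'b \<Rightarrow> 'k"
  assumes decode [simp]: "r \<in> carrier K \<Longrightarrow> \<kappa> (\<iota> r) = r"
begin

abbreviation (input) "lc \<equiv> lin_cpx K \<iota> \<kappa>"

lemma lin_cpx_simps [simp]:
  "\<zero>\<^bsub>cmd (lc b) m\<^esub> = \<iota> \<zero>" "v \<oplus>\<^bsub>cmd (lc b) m\<^esub> w = \<iota> (\<kappa> v \<oplus> \<kappa> w)"
  "r \<odot>\<^bsub>cmd (lc b) m\<^esub> v = \<iota> (r \<otimes> \<kappa> v)" "cdf (lc b) m v = \<iota> \<zero>"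
  by (simp_all add: lin_cpx_def)

lemma lin_cpx_carrier:
  "v \<in> carrier (cmd (lc b) m) \<longleftrightarrow> (\<exists>r\<in>carrier K. v = \<iota> r \<and> (b \<and> m = 0 \<or> r = \<zero>))"
  by (auto simp: lin_cpx_def)

lemma lin_cpx_mem [simp]:
  "r \<in> carrier K \<Longrightarrow> \<iota> r \<in> carrier (cmd (lc b) m) \<longleftrightarrow> b \<and> m = 0 \<or> r = \<zero>"
  unfolding lin_cpx_carrier by (metis decode zero_closed)

lemma lin_cpx_cases:
  assumes "v \<in> carrier (cmd (lc b) m)"
  obtains r where "r \<in> carrier K" "v = \<iota> r" "b \<and> m = 0 \<or> r = \<zero>"
  using assms unfolding lin_cpx_carrier by blast

lemma lin_cpx_linearI:
  assumes "f \<in> extensional (carrier (cmd (lc b) m))"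
    and "\<And>r. r \<in> carrier K \<Longrightarrow> b \<and> m = 0 \<or> r = \<zero> \<Longrightarrow> f (\<iota> r) \<in> carrier N"
    and "\<And>r s. r \<in> carrier K \<Longrightarrow> s \<in> carrier K \<Longrightarrow> b \<and> m = 0 \<or> r = \<zero> \<and> s = \<zero> \<Longrightarrow>
      f (\<iota> (r \<oplus> s)) = f (\<iota> r) \<oplus>\<^bsub>N\<^esub> f (\<iota> s)"
    and "\<And>r s. r \<in> carrier K \<Longrightarrow> s \<in> carrier K \<Longrightarrow> b \<and> m = 0 \<or> s = \<zero> \<Longrightarrow>
      f (\<iota> (r \<otimes> s)) = r \<odot>\<^bsub>N\<^esub> f (\<iota> s)"
  shows "f \<in> linear_maps K (cmd (lc b) m) N"
proof (rule linear_mapsI)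
  show "f v \<in> carrier N" if "v \<in> carrier (cmd (lc b) m)" for v
    using that by (rule lin_cpx_cases) (simp add: assms(2))
  show "f (v \<oplus>\<^bsub>cmd (lc b) m\<^esub> w) = f v \<oplus>\<^bsub>N\<^esub> f w"
    if v: "v \<in> carrier (cmd (lc b) m)" and w: "w \<in> carrier (cmd (lc b) m)" for v w
    using v
  proof (cases rule: lin_cpx_cases)
    case r: (1 r)
    show ?thesis
      using w by (rule lin_cpx_cases) (use r assms(3)[of r] in auto)
  qed
  show "f (r \<odot>\<^bsub>cmd (lc b) m\<^esub> v) = r \<odot>\<^bsub>N\<^esub> f v" if "r \<in> carrier K" "v \<in> carrier (cmd (lc b) m)"
    for r v
    using that(2) by (rule lin_cpx_cases) (use that(1) assms(4)[of r] in auto)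
qed (rule assms(1))

lemma lin_cpx_module: "Module.module K (cmd (lc b) m)"
proof (rule moduleI)
  show "abelian_group (cmd (lc b) m)"
  proof (rule abelian_groupI)
    show "\<exists>w\<in>carrier (cmd (lc b) m). w \<oplus>\<^bsub>cmd (lc b) m\<^esub> v = \<zero>\<^bsub>cmd (lc b) m\<^esub>"
      if "v \<in> carrier (cmd (lc b) m)" for v
      using that
    proof (cases rule: lin_cpx_cases)
      case (1 r)
      then show ?thesis
        by (intro bexI[of _ "\<iota> (\<ominus> r)"]) (auto simp: l_neg)
    qed
  qed (auto simp: a_ac elim!: lin_cpx_cases)
qed (auto simp: is_cring l_distr r_distr m_assoc elim!: lin_cpx_cases)

lemma lin_cpx_complex: "is_complex K (lc b)"
proof -
  have "restrict (\<lambda>v. \<iota> \<zero>) (carrier (cmd (lc b) m))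
    \<in> linear_maps K (cmd (lc b) m) (cmd (lc b) (m + 1))" for m
    by (rule lin_cpx_linearI) auto
  moreover have "restrict (cdf (lc b) m) A = restrict (\<lambda>v. \<iota> \<zero>) A" for A m
    by (simp add: fun_eq_iff)
  ultimately show ?thesis
    unfolding is_complex_def using lin_cpx_module by simp
qed

lemma lin_cpx_cocycles: "cocycles (lc b) m = carrier (cmd (lc b) m)"
  by (simp add: cocycles_def)

lemma chain_map_lin_zero:
  assumes Y: "is_complex K Y" and f: "f \<in> chain_maps K (lc b) Y"
  shows "f m (\<iota> \<zero>) = \<zero>\<^bsub>cmd Y m\<^esub>"
  using linear_zero[OF lin_cpx_module complexD(1)[OF Y] chain_mapsD(1)[OF f]] by simp

lemma chain_map_lin_smult:
  assumes f: "f \<in> chain_maps K (lc True) Y" and r: "r \<in> carrier K"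
  shows "f 0 (\<iota> r) = r \<odot>\<^bsub>cmd Y 0\<^esub> f 0 (\<iota> \<one>)"
  using linear_mapsD(3)[OF chain_mapsD(1)[OF f, of 0] r, of "\<iota> \<one>"] r by simp

text \<open>A chain map out of \<open>k\<close> in degree 0 is a cocycle of degree 0, the image of
  1; this is the chain map for the cocycle \<open>P\<close>. By \<open>chain_map_lin_smult\<close>
  the image of 1 determines the map.\<close>

definition lin_map :: "('k, 'm) cpx \<Rightarrow> bool \<Rightarrow> 'm \<Rightarrow> int \<Rightarrow> 'b \<Rightarrow> 'm" where
  "lin_map Y b P = (\<lambda>m. \<lambda>v\<in>carrier (cmd (lc b) m). if b \<and> m =
    0 then \<kappa> v \<odot>\<^bsub>cmd Y 0\<^esub> P else \<zero>\<^bsub>cmd Y m\<^esub>)"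

lemma lin_map_closed:
  assumes Y: "is_complex K Y" and P: "b \<Longrightarrow> P \<in> cocycles Y 0"
  shows "lin_map Y b P \<in> chain_maps K (lc b) Y"
proof -
  have lin: "lin_map Y b P m \<in> linear_maps K (cmd (lc b) m) (cmd Y m)" for m
  proof -
    interpret Y: Module.module K "cmd Y m" by (rule complexD(1)[OF Y])
    interpret Y0: Module.module K "cmd Y 0" by (rule complexD(1)[OF Y])
    show ?thesis
    proof (cases "b \<and> m = 0")
      case True
      then have "P \<in> carrier (cmd Y m)" using P cocycle_carrier[of P Y 0] by simp
      then show ?thesis
        using True by (intro lin_cpx_linearI) (simp_all add: lin_map_def Y0.smult_l_distr
          Y0.smult_assoc1)
    next
      case False
      then show ?thesis
        by (intro lin_cpx_linearI) (auto simp: lin_map_def)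
    qed
  qed
  have "lin_map Y b P (m + 1) (\<iota> \<zero>) = cdf Y m (lin_map Y b P m v)" if v: "v
    \<in> carrier (cmd (lc b) m)" for m v
  proof -
    interpret Y: Module.module K "cmd Y 1" by (rule complexD(1)[OF Y])
    have "lin_map Y b P (m + 1) (\<iota> \<zero>) = \<zero>\<^bsub>cmd Y (m + 1)\<^esub>"
      using linear_zero[OF lin_cpx_module complexD(1)[OF Y] lin] by simp
    moreover have "cdf Y m (lin_map Y b P m v) = \<zero>\<^bsub>cmd Y (m + 1)\<^esub>"
    proof (cases "b \<and> m = 0")
      case True
      then show ?thesis
        using P v by (auto simp: lin_map_def cocycles_def cdf_smult[OF Y] elim!: lin_cpx_cases)
    next
      case False
      then show ?thesis using v by (auto simp: lin_map_def cdf_zero[OF Y])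
    qed
    ultimately show ?thesis by simp
  qed
  then show ?thesis using lin by (simp add: chain_maps_def)
qed

end

locale linear_encoding_pair = S: linear_encoding K \<iota> \<kappa> + G: linear_encoding K \<iota>' \<kappa>'
  for K :: "'k ring" (structure) and \<iota> :: "'k \<Rightarrow> 'b" and \<kappa> and \<iota>' :: "'k \<Rightarrow> 'c" and \<kappa>'
begin

text \<open>A change of encoding. Its domain depends on the source flag alone, so by
  \<open>transport_closed\<close> it also serves as the inclusion of the zero complex into
  \<open>k\<close>.\<close>

definition transport :: "bool \<Rightarrow> int \<Rightarrow> 'c \<Rightarrow> 'b" where
  "transport b = (\<lambda>m. \<lambda>v\<in>carrier (cmd (lin_cpx K \<iota>' \<kappa>' b) m). \<iota> (\<kappa>' v))"

lemma transport_apply: "v \<in> carrier (cmd (lin_cpx K \<iota>' \<kappa>' b) m) \<Longrightarrow> transport b m v = \<iota> (\<kappa>' v)"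
  by (simp add: transport_def)

lemma transport_closed:
  "(b \<Longrightarrow> b') \<Longrightarrow> transport b \<in> chain_maps K (lin_cpx K \<iota>' \<kappa>' b) (lin_cpx K \<iota> \<kappa> b')"
  unfolding chain_maps_def
  by (auto simp: transport_def intro!: G.lin_cpx_linearI)

text \<open>All differentials vanish, so cohomology is the complex itself, and recoding scalars is
  bijective on it.\<close>

lemma transport_quasi_iso: "quasi_iso (lin_cpx K \<iota>' \<kappa>' b) (lin_cpx K \<iota> \<kappa> b) (transport b)"
proof -
  have cob: "coboundaries (lin_cpx K \<iota> \<kappa> b) m = {\<iota> \<zero>}" "coboundaries (lin_cpx K \<iota>' \<kappa>' b) m = {\<iota>' \<zero>}"
    for m
    using S.lin_cpx_mem[OF S.zero_closed, of b "m - 1"] G.lin_cpx_mem[OF S.zero_closed,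
      of b "m - 1"]
    unfolding coboundaries_def S.lin_cpx_simps G.lin_cpx_simps by blast+
  have diff: "v \<ominus>\<^bsub>cmd (lin_cpx K \<iota> \<kappa> b) m\<^esub> v = \<iota> \<zero>" if "v \<in> carrier (cmd (lin_cpx K \<iota> \<kappa> b) m)"
    for v m
  proof -
    interpret M: Module.module K "cmd (lin_cpx K \<iota> \<kappa> b) m" by (rule S.lin_cpx_module)
    show ?thesis using M.r_neg[OF that] by (simp add: a_minus_def)
  qed
  have "\<exists>w\<in>carrier (cmd (lin_cpx K \<iota>' \<kappa>' b) m). v \<ominus>\<^bsub>cmd (lin_cpx K \<iota> \<kappa> b) m\<^esub> transport b m w = \<iota> \<zero>"
    if v: "v \<in> carrier (cmd (lin_cpx K \<iota> \<kappa> b) m)" for v m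
    using v
  proof (cases rule: S.lin_cpx_cases)
    case (1 r)
    then show ?thesis by (intro bexI[of _ "\<iota>' r"]) (simp_all add: transport_apply diff)
  qed
  moreover have "w = \<iota>' \<zero>" if "w \<in> carrier (cmd (lin_cpx K \<iota>' \<kappa>' b) m)" "transport b m w = \<iota> \<zero>"
    for w m
    using that(1)
  proof (cases rule: G.lin_cpx_cases)
    case (1 r)
    then have "\<iota> r = \<iota> \<zero>" using that by (simp add: transport_apply)
    then show ?thesis using 1 S.decode S.zero_closed by metis
  qed
  ultimately show ?thesis
    unfolding quasi_iso_def S.lin_cpx_cocycles G.lin_cpx_cocycles cob by auto
qed

end

lemma (in linear_encoding) perfect_lin_cpx: "perfect K (lc b)"
proof -
  \<comment> \<open>\<open>perfect\<close> wants a complex with elements in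
    \<open>nat \<Rightarrow> 'k\<close>, so scalars become functions on \<open>{..<Suc 0}\<close>,
    the elements of the free module of rank 1.\<close>
  let ?\<iota> = "\<lambda>r. \<lambda>i\<in>{..<Suc 0}. r" and ?\<kappa> = "\<lambda>v :: nat \<Rightarrow> 'k. v 0"
  interpret P: linear_encoding K ?\<iota> ?\<kappa> by unfold_locales simp
  interpret SP: linear_encoding_pair K \<iota> \<kappa> ?\<iota> ?\<kappa> ..
  let ?P = "lin_cpx K ?\<iota> ?\<kappa> b"
  have "fg_projective K (cmd ?P m)" for m
    unfolding fg_projective_def
  proof (intro conjI exI[of _ "Suc 0"] bexI ballI)
    let ?F = "free_module K (Suc 0)"
    show "Module.module K (cmd ?P m)" by (rule P.lin_cpx_module)
    have sub: "carrier (cmd ?P m) \<subseteq> carrier ?F"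
      by (auto simp: free_module_def split: if_splits elim!: P.lin_cpx_cases)
    show "(\<lambda>v\<in>carrier (cmd ?P m). v) \<in> linear_maps K (cmd ?P m) ?F"
      by (rule P.lin_cpx_linearI) (auto simp: free_module_def fun_eq_iff P.lin_cpx_mem)
    have F: "v 0 \<in> carrier K" if "v \<in> carrier ?F" for v
      using that by (auto simp: free_module_def)
    have F_add: "v \<oplus>\<^bsub>?F\<^esub> w \<in> carrier ?F" "(v \<oplus>\<^bsub>?F\<^esub> w) 0 = v 0 \<oplus> w 0"
      if "v \<in> carrier ?F" "w \<in> carrier ?F" for v w
      using F[OF that(1)] F[OF that(2)] by (simp_all add: free_module_def)
    have F_smult: "r \<odot>\<^bsub>?F\<^esub> v \<in> carrier ?F" "(r \<odot>\<^bsub>?F\<^esub> v) 0 = r \<otimes> v 0"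
      if "r \<in> carrier K" "v \<in> carrier ?F" for r v
      using F[OF that(2)] that(1) by (simp_all add: free_module_def)
    \<comment> \<open>Evaluation at 0 where the module is a copy of \<open>K\<close>, and the zero
      map where it vanishes.\<close>
    let ?r = "\<lambda>v\<in>carrier ?F. ?\<iota> (if b \<and> m = 0 then v 0 else \<zero>)"
    show "?r \<in> linear_maps K ?F (cmd ?P m)"
      by (rule linear_mapsI) (simp_all add: F F_add F_smult P.lin_cpx_mem)
    show "?r ((\<lambda>v\<in>carrier (cmd ?P m). v) v) = v" if v: "v \<in> carrier (cmd ?P m)" for v
      using v
    proof (cases rule: P.lin_cpx_cases)
      case (1 r)
      then show ?thesis using v subsetD[OF sub v] by auto
    qed
  qed
  moreover have "{m. carrier (cmd ?P m) \<noteq> {\<zero>\<^bsub>cmd ?P m\<^esub>}} \<subseteq> {0}"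
    by (auto simp: lin_cpx_def)
  then have "finite {m. carrier (cmd ?P m) \<noteq> {\<zero>\<^bsub>cmd ?P m\<^esub>}}"
    by (rule finite_subset) simp
  ultimately show ?thesis
    unfolding perfect_def using lin_cpx_complex P.lin_cpx_complex SP.transport_closed
      SP.transport_quasi_iso by blast
qed

section \<open>The linear simplex as a dg-category\<close>

locale linear_simplex = linear_encoding K \<iota> \<kappa>
  for K :: "'k ring" (structure) and \<iota> :: "'k \<Rightarrow> 'b" and \<kappa> +
  fixes e :: "nat \<Rightarrow> 'a" and d :: "'a \<Rightarrow> nat"
  assumes index [simp]: "d (e i) = i"
begin

abbreviation (input) "sx \<equiv> simplex K \<iota> \<kappa> e d"

lemma simplex_simps [simp]:
  "gob (sx n) = e ` {..n}" "ghom (sx n) x y = lc (d x \<le> d y)"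
  "dcmp (sx n) x y z q p g f = \<iota> (\<kappa> g \<otimes> \<kappa> f)" "did (sx n) x = \<iota> \<one>"
  by (simp_all add: simplex_def)

lemma chain_graph_simps [simp]:
  "gob (chain_graph K \<iota> \<kappa> e d n) = e ` {..n}"
  "ghom (chain_graph K \<iota> \<kappa> e d n) x y = lc (d y = Suc (d x))"
  by (simp_all add: chain_graph_def)

lemma is_graph_chain_graph: "is_graph K (chain_graph K \<iota> \<kappa> e d n)"
  by (simp add: is_graph_def lin_cpx_complex)

lemma is_dgcat_simplex: "is_dgcat K (sx n)"
proof (rule dgcatI; unfold simplex_simps)
  show "is_complex K (lc (d x \<le> d y))" for x y by (rule lin_cpx_complex)
  show "\<iota> \<one> \<in> cocycles (lc (d x \<le> d x)) 0" for x
    by (simp add: lin_cpx_cocycles)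
  show "restrict (\<lambda>g. \<iota> (\<kappa> g \<otimes> \<kappa> f)) (carrier (cmd (lc (d y \<le> d z)) q))
      \<in> linear_maps K (cmd (lc (d y \<le> d z)) q) (cmd (lc (d x \<le> d z)) (q + p))"
    if "f \<in> carrier (cmd (lc (d x \<le> d y)) p)" for x y z f q p
    using that by (intro lin_cpx_linearI) (auto simp: l_distr[symmetric] m_assoc[symmetric] elim!:
      lin_cpx_cases)
  show "restrict (\<lambda>f. \<iota> (\<kappa> g \<otimes> \<kappa> f)) (carrier (cmd (lc (d x \<le> d y)) p))
      \<in> linear_maps K (cmd (lc (d x \<le> d y)) p) (cmd (lc (d x \<le> d z)) (q + p))"
    if "g \<in> carrier (cmd (lc (d y \<le> d z)) q)" for x y z g q p
  proof -
    have "r \<otimes> (s \<otimes> t) = \<zero>" if "r \<in> carrier K" "s \<in> carrier K" "t \<in> carrier K" "r \<otimes> t = \<zero>" for r s t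
      using that m_lcomm[of r s t] by simp
    then show ?thesis
      using that by (intro lin_cpx_linearI) (auto simp: r_distr[symmetric] m_lcomm elim!:
        lin_cpx_cases)
  qed
  show "cdf (lc (d x \<le> d z)) (q + p) (\<iota> (\<kappa> g \<otimes> \<kappa> f)) =
      \<iota> (\<kappa> (cdf (lc (d y \<le> d z)) q g) \<otimes> \<kappa> f) \<oplus>\<^bsub>cmd (lc (d x \<le> d z)) (q + p + 1)\<^esub>
      (let h = \<iota> (\<kappa> g \<otimes> \<kappa> (cdf (lc (d x \<le> d y)) p f))
       in if even q then h else \<ominus>\<^bsub>cmd (lc (d x \<le> d z)) (q + p + 1)\<^esub> h)"
    if "g \<in> carrier (cmd (lc (d y \<le> d z)) q)" "f \<in> carrier (cmd (lc (d x \<le> d y)) p)"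
      for x y z g f q p
  proof -
    interpret M: Module.module K "cmd (lc (d x \<le> d z)) (q + p + 1)" by (rule lin_cpx_module)
    have "\<kappa> g \<in> carrier K" "\<kappa> f \<in> carrier K" using that by (auto elim!: lin_cpx_cases)
    then show ?thesis using M.r_neg[OF M.zero_closed] M.a_inv_closed[OF M.zero_closed] M.l_zero[OF
      M.a_inv_closed[OF M.zero_closed]] by (simp add: Let_def)
  qed
qed (auto simp: m_assoc elim!: lin_cpx_cases)

text \<open>\<open>\<iota> \<one>\<close> from \<open>e i\<close> to \<open>e (i + l)\<close> is a
  product of \<open>l\<close> generators, and every element of a Hom complex is a scalar multiple of
  such an element or zero.\<close>

lemma dg_functor_simplex_eqI:
  assumes D: "is_dgcat K D" and f: "f \<in> dg_functors K (sx n) D" and g: "g \<in> dg_functors K (sx n) D"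
    and ob: "\<And>i. i \<le> n \<Longrightarrow> fst f (e i) = fst g (e i)"
    and ar: "\<And>i. i < n \<Longrightarrow> snd f (e i) (e (Suc i)) 0 (\<iota> \<one>) = snd g (e i) (e (Suc i)) 0 (\<iota> \<one>)"
  shows "f = g"
proof (rule graph_maps_ext[OF dg_functorsD(1)[OF f] dg_functorsD(1)[OF g]])
  show "fst f x = fst g x" if "x \<in> gob (sx n)" for x
    using that ob by auto
  have path: "snd f (e i) (e (i + l)) 0 (\<iota> \<one>) = snd g (e i) (e (i + l)) 0 (\<iota> \<one>)" if "i + l \<le> n"
    for i l
    using that
  proof (induction l)
    case 0
    then show ?case
      using dg_functorsD(2)[OF f, of "e i"] dg_functorsD(2)[OF g, of "e i"] ob by simp
  next
    case (Suc l)
    have *: "snd k (e i) (e (i + Suc l)) 0 (\<iota> \<one>) =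
        dcmp D (fst k (e i)) (fst k (e (i + l))) (fst k (e (i + Suc l))) 0 0
          (snd k (e (i + l)) (e (i + Suc l)) 0 (\<iota> \<one>)) (snd k (e i) (e (i + l)) 0 (\<iota> \<one>))"
      if "k \<in> dg_functors K (sx n) D" for k
      using dg_functorsD(3)[OF that, of "e i" "e (i + l)" "e (i + Suc l)" "\<iota> \<one>" 0 "\<iota> \<one>" 0] Suc.prems
      by simp
    show ?case
      unfolding *[OF f] *[OF g] using Suc ob ar[of "i + l"] by simp
  qed
  show "snd f x y m v = snd g x y m v"
    if x: "x \<in> gob (sx n)" and y: "y \<in> gob (sx n)" and v: "v \<in> carrier (hm (sx n) x y m)"
      for x y m v
  proof -
    obtain i j where ij: "x = e i" "i \<le> n" "y = e j" "j \<le> n" using x y by auto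
    obtain r where r: "r \<in> carrier K" "v = \<iota> r" "i \<le> j \<and> m = 0 \<or> r = \<zero>"
      using v ij by (auto elim: lin_cpx_cases)
    have ch: "snd k x y \<in> chain_maps K (lc (i \<le> j)) (ghom D (fst k x) (fst k y))"
      and co: "is_complex K (ghom D (fst k x) (fst k y))"
      if "k \<in> dg_functors K (sx n) D" for k
      using graph_mapsD(3)[OF dg_functorsD(1)[OF that] x y] graph_mapsD(1)[OF dg_functorsD(1)[OF
        that]]
        x y ij by (auto intro!: dgcatD(1)[OF D])
    note xy = ob[OF ij(2), folded ij(1)] ob[OF ij(4), folded ij(3)]
    show ?thesis
    proof (cases "i \<le> j \<and> m = 0")
      case True
      then have "snd f x y 0 (\<iota> \<one>) = snd g x y 0 (\<iota> \<one>)"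
        using path[of i "j - i"] ij by simp
      then show ?thesis
        using chain_map_lin_smult[of "snd f x y", OF _ r(1)] chain_map_lin_smult[of "snd g x y",
          OF _ r(1)]
          ch[OF f] ch[OF g] True r xy by simp
    next
      case False
      then have "v = \<iota> \<zero>" using r by blast
      then show ?thesis
        using xy chain_map_lin_zero[OF co[OF f] ch[OF f]] chain_map_lin_zero[OF co[OF g] ch[OF g]]
          by simp
    qed
  qed
qed

section \<open>The dg-functor of a chain of closed morphisms\<close>

context
  fixes D :: "('k, 'o, 'm) dgcat" and ob :: "nat \<Rightarrow> 'o" and ar :: "nat \<Rightarrow> 'm" and n :: nat
  assumes D: "is_dgcat K D" and ob: "\<And>i. i \<le> n \<Longrightarrow> ob i \<in> gob D"
    and ar: "\<And>i. i < n \<Longrightarrow> ar i \<in> cocycles (ghom D (ob i) (ob (Suc i))) 0"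
begin

text \<open>\<open>path\<close> reads its graph map only at vertices and generators, so a stand-in
  that ignores target, degree and element suffices.\<close>

abbreviation (input) "pth \<equiv> path K D (ob, \<lambda>i j m v. ar i)"

lemma path_cocycle: "i + l \<le> n \<Longrightarrow> pth i l \<in> cocycles (ghom D (ob i) (ob (i + l))) 0"
proof (induction l)
  case 0
  then show ?case using dgcatD(2)[OF D ob] by simp
next
  case (Suc l)
  then show ?case
    using dcmp_cocycle[OF D ob ob ob, of i "i + l" "i + Suc l" "ar (i + l)" "pth i l"] ar[of "i +
      l"] by simp
qed

text \<open>This identity is what makes \<open>simplex_functor\<close> respect composition of two
  edges.\<close>

lemma path_add:
  "i + l + m \<le> n \<Longrightarrow> pth i (l + m) = dcmp D (ob i) (ob (i + l)) (ob (i + l + m)) 0 0 (pth (i + l) m)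
    (pth i l)"
proof (induction m)
  case 0
  then show ?case
    using dgcatD(6)[OF D ob ob cocycle_carrier[OF path_cocycle]] by simp
next
  case (Suc m)
  \<comment> \<open>The degrees \<open>0 + 0\<close> are kept unsimplified to match the
    associativity law, where the degrees of composites are sums.\<close>
  have "dcmp D (ob i) (ob (i + l + m)) (ob (Suc (i + l + m))) 0 (0 + 0) (ar (i + l + m))
      (dcmp D (ob i) (ob (i + l)) (ob (i + l + m)) 0 0 (pth (i + l) m) (pth i l)) =
    dcmp D (ob i) (ob (i + l)) (ob (Suc (i + l + m))) (0 + 0) 0
      (dcmp D (ob (i + l)) (ob (i + l + m)) (ob (Suc (i + l + m))) 0 0 (ar (i + l + m)) (pth (i + l)
        m)) (pth i l)"
    using Suc.prems
    by (intro dgcatD(8)[OF D] ob cocycle_carrier[OF path_cocycle] cocycle_carrier[OF ar]) auto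
  then show ?case using Suc by (simp add: add.assoc)
qed

text \<open>For \<open>d y < d x\<close> the truncated difference yields a meaningless path, which
  \<open>lin_map\<close> ignores because its flag is false.\<close>

definition simplex_functor :: "('a, 'b, 'o, 'm) gmap" where
  "simplex_functor = (\<lambda>x\<in>e ` {..n}. ob (d x),
    \<lambda>x y. if x \<in> e ` {..n} \<and> y \<in> e ` {..n}
      then lin_map (ghom D (ob (d x)) (ob (d y))) (d x \<le> d y) (pth (d x) (d y - d x)) else (\<lambda>_ _.
        undefined))"

lemma simplex_functor_fst: "i \<le> n \<Longrightarrow> fst simplex_functor (e i) = ob i"
  by (simp add: simplex_functor_def)

lemma simplex_functor_snd:
  "i \<le> n \<Longrightarrow> k \<le> n \<Longrightarrow>
    snd simplex_functor (e i) (e k) = lin_map (ghom D (ob i) (ob k)) (i \<le> k) (pth i (k - i))"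
  by (simp add: simplex_functor_def)

lemma simplex_functor_path:
  "i \<le> k \<Longrightarrow> k \<le> n \<Longrightarrow> r \<in> carrier K \<Longrightarrow>
    snd simplex_functor (e i) (e k) 0 (\<iota> r) = r \<odot>\<^bsub>hm D (ob i) (ob k) 0\<^esub> pth i (k - i)"
  by (simp add: simplex_functor_snd lin_map_def)

lemma simplex_functor_gen:
  assumes "i < n" shows "snd simplex_functor (e i) (e (Suc i)) 0 (\<iota> \<one>) = ar i"
proof -
  have i: "i \<le> n" "Suc i \<le> n" "i \<le> Suc i" using assms by auto
  note c = cocycle_carrier[OF ar[OF assms]]
  show ?thesis
    using simplex_functor_path[OF i(3,2), of \<one>] dgcatD(7)[OF D ob[OF i(1)] ob[OF i(2)] c]
      module.smult_one[OF complexD(1)[OF dgcatD(1)[OF D ob[OF i(1)] ob[OF i(2)]]] c] by simp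
qed

lemma lin_map_simplex_functor:
  "i \<le> n \<Longrightarrow> k \<le> n \<Longrightarrow>
    snd simplex_functor (e i) (e k) \<in> chain_maps K (lc (i \<le> k)) (ghom D (ob i) (ob k))"
  unfolding simplex_functor_snd
  by (rule lin_map_closed[OF dgcatD(1)[OF D ob ob]]) (use path_cocycle[of i "k - i"] in auto)

lemma simplex_functor_closed: "simplex_functor \<in> dg_functors K (sx n) D"
proof (rule dg_functorsI)
  show "simplex_functor \<in> graph_maps K (sx n) D"
  proof (rule graph_mapsI)
    show "snd simplex_functor x y \<in> chain_maps K (ghom (sx n) x y)
        (ghom D (fst simplex_functor x) (fst simplex_functor y))" if "x \<in> gob (sx n)" "y
          \<in> gob (sx n)" for x y
      using that lin_map_simplex_functor by (auto simp: simplex_functor_fst)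
  qed (auto simp: simplex_functor_fst ob, auto simp: simplex_functor_def)
  show "snd simplex_functor x x 0 (did (sx n) x) = did D (fst simplex_functor x)" if "x
    \<in> gob (sx n)" for x
  proof -
    from that obtain i where i: "x = e i" "i \<le> n" by auto
    show ?thesis
      using simplex_functor_path[of i i \<one>] i cocycle_carrier[OF dgcatD(2)[OF D ob[OF i(2)]]]
        module.smult_one[OF complexD(1)[OF dgcatD(1)[OF D ob ob]], of i i]
      by (simp add: simplex_functor_fst)
  qed
  fix x y z g f q p
  assume "x \<in> gob (sx n)" "y \<in> gob (sx n)" "z \<in> gob (sx n)"
    and g: "g \<in> carrier (hm (sx n) y z q)" and f: "f \<in> carrier (hm (sx n) x y p)"
  then obtain i k l where x: "x = e i" "i \<le> n" and y: "y = e k" "k \<le> n" and z: "z = e l" "l \<le> n"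
    by auto
  obtain s where s: "s \<in> carrier K" "g = \<iota> s" "k \<le> l \<and> q = 0 \<or> s = \<zero>"
    using g y z by (auto elim: lin_cpx_cases)
  obtain r where r: "r \<in> carrier K" "f = \<iota> r" "i \<le> k \<and> p = 0 \<or> r = \<zero>"
    using f x y by (auto elim: lin_cpx_cases)
  note obx = ob[OF x(2)] and oby = ob[OF y(2)] and obz = ob[OF z(2)]
  note ch = chain_mapsD(3)[OF lin_map_simplex_functor]
  have zero: "snd simplex_functor (e i) (e k) m (\<iota> \<zero>) = \<zero>\<^bsub>hm D (ob i) (ob k) m\<^esub>" if "i \<le> n" "k \<le> n"
    for i k m
    by (rule chain_map_lin_zero[OF dgcatD(1)[OF D ob[OF that(1)] ob[OF that(2)]]
      lin_map_simplex_functor[OF that]])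
  have "snd simplex_functor (e i) (e l) (q + p) (\<iota> (s \<otimes> r)) =
      dcmp D (ob i) (ob k) (ob l) q p (snd simplex_functor (e k) (e l) q (\<iota> s))
        (snd simplex_functor (e i) (e k) p (\<iota> r))"
  \<comment> \<open>Either both factors have degree 0 and follow the order, and the scalars are
    pulled out of \<open>path_add\<close>; or one scalar is zero and both sides vanish.\<close>
  proof (cases "k \<le> l \<and> q = 0 \<and> i \<le> k \<and> p = 0")
    case True
    then have kl: "k \<le> l" and ik: "i \<le> k" and [simp]: "q = 0" "p = 0" by auto
    interpret M: Module.module K "hm D (ob i) (ob l) 0" by
      (rule complexD(1)[OF dgcatD(1)[OF D obx obz]])
    interpret N: Module.module K "hm D (ob i) (ob k) 0" by
      (rule complexD(1)[OF dgcatD(1)[OF D obx oby]])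
    have P: "pth i (k - i) \<in> carrier (hm D (ob i) (ob k) 0)" "pth k (l - k)
      \<in> carrier (hm D (ob k) (ob l) 0)"
      using cocycle_carrier[OF path_cocycle[of i "k - i"]] cocycle_carrier[OF path_cocycle[of k "l -
        k"]]
        kl ik y z by auto
    have "pth i (l - i) = dcmp D (ob i) (ob k) (ob l) 0 0 (pth k (l - k)) (pth i (k - i))"
      using path_add[of i "k - i" "l - k"] kl ik z by simp
    moreover have "dcmp D (ob i) (ob k) (ob l) 0 0 (pth k (l - k)) (pth i (k - i))
      \<in> carrier (hm D (ob i) (ob l) 0)"
      using dcmp_closed[OF D obx oby obz P(2,1)] by simp
    ultimately show ?thesis
      using kl ik y z r s P
        dcmp_smult_left[OF D obx oby obz P(2) N.smult_closed[OF r(1) P(1)] s(1)]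
        dcmp_smult_right[OF D obx oby obz P(2,1) r(1)]
      by (simp add: simplex_functor_path M.smult_assoc1)
  next
    case False
    then have sr: "s = \<zero> \<or> r = \<zero>" using s r by blast
    then have "s \<otimes> r = \<zero>" using s r by auto
    moreover have "\<iota> s \<in> carrier (cmd (lc (k \<le> l)) q)" "\<iota> r \<in> carrier (cmd (lc (i \<le> k)) p)"
      using s r by auto
    ultimately show ?thesis
      using sr ch[OF y(2) z(2)] ch[OF x(2) y(2)] zero[OF x(2) z(2)] zero[OF y(2) z(2)] zero[OF x(2)
        y(2)]
        dcmp_zero_left[OF D obx oby obz] dcmp_zero_right[OF D obx oby obz] by auto
  qed
  then show "snd simplex_functor x z (q + p) (dcmp (sx n) x y z q p g f) =
      dcmp D (fst simplex_functor x) (fst simplex_functor y) (fst simplex_functor z) q p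
        (snd simplex_functor y z q g) (snd simplex_functor x y p f)"
    using x y z r s by (simp add: simplex_functor_fst)
qed

end

end

section \<open>Freeness on the chain of generators\<close>

locale linear_simplex_pair = S: linear_simplex K \<iota> \<kappa> e d + G: linear_simplex K \<iota>' \<kappa>' e' d'
  for K :: "'k ring" (structure) and \<iota> :: "'k \<Rightarrow> 'b" and \<kappa> and e :: "nat \<Rightarrow> 'a" and d
    and \<iota>' :: "'k \<Rightarrow> 'q" and \<kappa>' and e' :: "nat \<Rightarrow> 'p" and d'
begin

sublocale linear_encoding_pair K \<iota> \<kappa> \<iota>' \<kappa>' ..

abbreviation (input) "sx \<equiv> simplex K \<iota> \<kappa> e d"
abbreviation (input) "cg \<equiv> chain_graph K \<iota>' \<kappa>' e' d'"

definition simplex_unit :: "nat \<Rightarrow> ('p, 'q, 'a, 'b) gmap" where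
  "simplex_unit n = (\<lambda>x\<in>e' ` {..n}. e (d' x),
    \<lambda>x y. if x \<in> e' ` {..n} \<and> y \<in> e' ` {..n} then transport (d' y = Suc (d' x)) else (\<lambda>_ _.
      undefined))"

lemma simplex_unit_fst: "i \<le> n \<Longrightarrow> fst (simplex_unit n) (e' i) = e i"
  by (simp add: simplex_unit_def)

lemma simplex_unit_snd:
  "i \<le> n \<Longrightarrow> k \<le> n \<Longrightarrow> snd (simplex_unit n) (e' i) (e' k) = transport (k = Suc i)"
  by (simp add: simplex_unit_def)

lemma simplex_unit_gen: "i < n \<Longrightarrow> snd (simplex_unit n) (e' i) (e' (Suc i)) 0 (\<iota>' \<one>) = \<iota> \<one>"
  by (simp add: simplex_unit_snd transport_apply)

lemma simplex_unit_closed: "simplex_unit n \<in> graph_maps K (cg n) (sx n)"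
proof (rule graph_mapsI)
  show "snd (simplex_unit n) x y \<in> chain_maps K (ghom (cg n) x y)
      (ghom (sx n) (fst (simplex_unit n) x) (fst (simplex_unit n) y))" if "x \<in> gob (cg n)" "y
        \<in> gob (cg n)" for x y
    using that by (auto simp: simplex_unit_fst simplex_unit_snd intro!: transport_closed)
qed (auto simp: simplex_unit_fst, auto simp: simplex_unit_def)

lemma free_on_simplex: "free_on K (cg n) (sx n) (simplex_unit n)"
  unfolding free_on_def
proof (intro conjI allI impI ballI)
  show "is_graph K (cg n)" by (rule G.is_graph_chain_graph)
  show "is_dgcat K (sx n)" by (rule S.is_dgcat_simplex)
  show "simplex_unit n \<in> graph_maps K (cg n) (sx n)" by (rule simplex_unit_closed)
  fix D :: "('k, 'a, 'b) dgcat" and g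
  assume D: "is_dgcat K D" and g: "g \<in> graph_maps K (cg n) D"
  define ob where "ob i = fst g (e' i)" for i
  define ar where "ar i = snd g (e' i) (e' (Suc i)) 0 (\<iota>' \<one>)" for i
  have ob: "ob i \<in> gob D" if "i \<le> n" for i
    using graph_mapsD(1)[OF g, of "e' i"] that by (simp add: ob_def)
  have ch: "snd g (e' i) (e' k) \<in> chain_maps K (lin_cpx K \<iota>' \<kappa>' (k = Suc i)) (ghom D (ob i) (ob k))"
    if "i \<le> n" "k \<le> n" for i k
    using graph_mapsD(3)[OF g, of "e' i" "e' k"] that by (simp add: ob_def)
  have ar: "ar i \<in> cocycles (ghom D (ob i) (ob (Suc i))) 0" if "i < n" for i
    unfolding ar_def
    by (rule chain_map_cocycle[OF G.lin_cpx_complex dgcatD(1)[OF D ob ob] ch])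
      (use that in \<open>auto simp: G.lin_cpx_cocycles\<close>)
  let ?f = "S.simplex_functor D ob ar n"
  note f = S.simplex_functor_closed[where D = D and ob = ob and ar = ar and n = n,
    OF D ob ar] and f_gen = S.simplex_functor_gen[where D = D and ob = ob and ar = ar and n = n,
    OF D ob ar]
    and f_fst = S.simplex_functor_fst[where D = D and ob = ob and ar = ar and n = n, OF D ob ar]
  have "gmap_comp (cg n) ?f (simplex_unit n) = g"
  proof (rule graph_maps_ext[OF gmap_comp_closed[OF G.is_graph_chain_graph simplex_unit_closed
    dg_functorsD(1)[OF f]] g])
    show "fst (gmap_comp (cg n) ?f (simplex_unit n)) x = fst g x" if "x \<in> gob (cg n)" for x
      using that by (auto simp: gmap_comp_fst simplex_unit_fst f_fst) (simp add: ob_def)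
    fix x y m v
    assume x: "x \<in> gob (cg n)" and y: "y \<in> gob (cg n)" and v: "v \<in> carrier (hm (cg n) x y m)"
    obtain i k where ik: "x = e' i" "i \<le> n" "y = e' k" "k \<le> n" using x y by auto
    obtain r where r: "r \<in> carrier K" "v = \<iota>' r" "k = Suc i \<and> m = 0 \<or> r = \<zero>"
      using v ik by (auto elim: G.lin_cpx_cases)
    note cf = graph_mapsD(3)[OF dg_functorsD(1)[OF f], of "e i" "e k", simplified]
    have "snd (gmap_comp (cg n) ?f (simplex_unit n)) x y m v = snd ?f (e i) (e k) m (\<iota> r)"
      using gmap_comp_apply[OF x y v, of ?f "simplex_unit n"] v r ik
      by (simp add: simplex_unit_fst simplex_unit_snd transport_apply)
    also have "\<dots> = snd g x y m v"
    proof (cases "k = Suc i \<and> m = 0")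
      case True
      then have "snd ?f (e i) (e k) 0 (\<iota> r) = r \<odot>\<^bsub>hm D (ob i) (ob k) 0\<^esub> ar i"
        using S.chain_map_lin_smult[of "snd ?f (e i) (e k)" "ghom D (ob i) (ob k)" r] cf ik r
          f_gen[of i]
        by (simp add: f_fst)
      then show ?thesis
        using G.chain_map_lin_smult[of "snd g (e' i) (e' k)" "ghom D (ob i) (ob k)" r] ch[of i k]
          True ik r
        by (simp add: ar_def)
    next
      case False
      \<comment> \<open>Off the edges of the graph and off degree 0 only zero is left to compare,
        although the simplex may have nonzero elements from \<open>i\<close> to
        \<open>k\<close>.\<close>
      then have r0: "r = \<zero>" using r by blast
      show ?thesis
        using S.chain_map_lin_zero[of "ghom D (ob i) (ob k)" "snd ?f (e i) (e k)" "i \<le> k" m] cf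
          G.chain_map_lin_zero[of "ghom D (ob i) (ob k)" "snd g (e' i) (e' k)" "k =
            Suc i" m] ch[of i k] dgcatD(1)[OF D ob ob, of i k] ik r
        by (simp add: f_fst r0)
    qed
    finally show "snd (gmap_comp (cg n) ?f (simplex_unit n)) x y m v = snd g x y m v" .
  qed
  moreover have "h = ?f" if h: "h \<in> dg_functors K (sx n) D" and hg: "gmap_comp (cg n) h
    (simplex_unit n) = g" for h
  proof (rule S.dg_functor_simplex_eqI[OF D h f])
    show "fst h (e i) = fst ?f (e i)" if "i \<le> n" for i
      using that gmap_comp_fst[of "e' i" "cg n" h "simplex_unit n"] hg
      by (simp add: simplex_unit_fst f_fst) (simp add: ob_def)
    show "snd h (e i) (e (Suc i)) 0 (\<iota> \<one>) = snd ?f (e i) (e (Suc i)) 0 (\<iota> \<one>)" if "i < n" for i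
      using that gmap_comp_apply[of "e' i" "cg n" "e' (Suc i)" "\<iota>' \<one>" 0 h "simplex_unit n"] hg
      by (simp add: simplex_unit_fst f_gen simplex_unit_gen) (simp add: ar_def)
  qed
  ultimately show "\<exists>!h. h \<in> dg_functors K (sx n) D \<and> gmap_comp (cg n) h (simplex_unit n) = g"
    using f by blast
qed

end

text \<open>The same encoding is used for the graph and for the simplex, since the generating graph
  also has to live in \<open>'u\<close>.\<close>

lemma (in linear_simplex) free_finite_type_simplex:
  fixes \<iota>' :: "'k \<Rightarrow> 'u" and e' :: "nat \<Rightarrow> 'u"
  assumes "linear_simplex K \<iota>' \<kappa>' e' d'"
  shows "free_finite_type K (simplex K \<iota>' \<kappa>' e' d' n)"
proof -
  interpret S: linear_simplex K \<iota>' \<kappa>' e' d' by fact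
  interpret P: linear_simplex_pair K \<iota>' \<kappa>' e' d' \<iota>' \<kappa>' e' d' ..
  show ?thesis
    unfolding free_finite_type_def
    using P.free_on_simplex[of n] S.perfect_lin_cpx by (intro exI conjI) auto
qed

subsection \<open>Cofibrancy\<close>

text \<open>A quasi-equivalence reaches \<open>y\<close> up to a homotopy equivalence
  \<open>p x \<rightarrow> y\<close>; the fibration lifts this arrow, and with it the target on the
  nose.\<close>

lemma trivial_fibration_lift_object:
  assumes p: "quasi_equivalence A B p" "dg_fibration A B p" and y: "y \<in> gob B"
  shows "\<exists>x\<in>gob A. fst p x = y"
proof -
  obtain x v where x: "x \<in> gob A" "v \<in> homotopy_equivalences B (fst p x) y"
    using p(1) y unfolding quasi_equivalence_def by blast
  then show ?thesis
    using p(2) y unfolding dg_fibration_def by blast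
qed

text \<open>The quasi-isomorphism lifts \<open>b\<close> up to a coboundary
  \<open>d \<beta>\<close>; surjectivity in degree -1 lifts \<open>\<beta>\<close> to
  \<open>\<alpha>\<close>, and adding \<open>d \<alpha>\<close> corrects the first lift.\<close>

lemma trivial_fibration_lift_cocycle:
  assumes A: "is_dgcat K A" and B: "is_dgcat K B" and p: "p \<in> dg_functors K A B"
    and tf: "quasi_equivalence A B p" "dg_fibration A B p"
    and x: "x \<in> gob A" and y: "y \<in> gob A" and b: "b \<in> cocycles (ghom B (fst p x) (fst p y)) 0"
  shows "\<exists>a\<in>cocycles (ghom A x y) 0. snd p x y 0 a = b"
proof -
  note pg = dg_functorsD(1)[OF p]
  note ch = graph_mapsD(3)[OF pg x y] and px = graph_mapsD(1)[OF pg x] and py =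
    graph_mapsD(1)[OF pg y]
  let ?X = "ghom A x y" and ?Y = "ghom B (fst p x) (fst p y)"
  note X = dgcatD(1)[OF A x y] and Y = dgcatD(1)[OF B px py]
  interpret Y: Module.module K "cmd ?Y 0" by (rule complexD(1)[OF Y])
  have "quasi_iso ?X ?Y (snd p x y)"
    using tf(1) x y unfolding quasi_equivalence_def by blast
  then obtain a0 where a0: "a0 \<in> cocycles ?X 0" "b \<ominus>\<^bsub>cmd ?Y 0\<^esub> snd p x y 0 a0 \<in> coboundaries ?Y 0"
    using b unfolding quasi_iso_def by blast
  then obtain \<beta> where \<beta>: "\<beta> \<in> carrier (cmd ?Y (-1))" "b \<ominus>\<^bsub>cmd ?Y 0\<^esub> snd p x y 0 a0 = cdf ?Y (-1) \<beta>"
    by (auto simp: coboundaries_def)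
  obtain \<alpha> where \<alpha>: "\<alpha> \<in> carrier (cmd ?X (-1))" "snd p x y (-1) \<alpha> = \<beta>"
    using tf(2) x y \<beta>(1) unfolding dg_fibration_def by (metis imageE)
  have d: "cdf ?X (-1) \<alpha> \<in> coboundaries ?X 0"
    using \<alpha>(1) by (auto simp: coboundaries_def)
  note c = cocycle_carrier[OF a0(1)] cocycle_carrier[OF coboundary_cocycle[OF X d]]
  have "snd p x y 0 (a0 \<oplus>\<^bsub>cmd ?X 0\<^esub> cdf ?X (-1) \<alpha>) =
      snd p x y 0 a0 \<oplus>\<^bsub>cmd ?Y 0\<^esub> (b \<ominus>\<^bsub>cmd ?Y 0\<^esub> snd p x y 0 a0)"
    using linear_mapsD(2)[OF chain_mapsD(1)[OF ch] c] chain_mapsD(2)[OF ch \<alpha>(1)] \<alpha>(2) \<beta>(2) by simp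
  also have "\<dots> = b"
    using cocycle_carrier[OF b] chain_mapsD(3)[OF ch c(1)]
    by (simp add: a_minus_def Y.a_lcomm[of _ b] Y.r_neg)
  finally show ?thesis
    using cocycle_add[OF X a0(1) coboundary_cocycle[OF X d]] by blast
qed

definition empty_dgcat :: "('k, 'o, 'm) dgcat" where
  "empty_dgcat = \<lparr>gob = {}, ghom = undefined, dcmp = undefined, did = undefined\<rparr>"

lemma is_dgcat_empty: "is_dgcat K empty_dgcat"
  by (simp add: is_dgcat_def is_graph_def empty_dgcat_def)

lemma dg_functors_empty: "dg_functors K empty_dgcat C = {(\<lambda>_. undefined, \<lambda>_ _ _ _. undefined)}"
  by (auto simp: dg_functors_def graph_maps_def empty_dgcat_def)

lemma initial_empty_dgcat: "initial (dgCat T K) empty_dgcat"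
  by (simp add: initial_def is_dgcat_empty dg_functors_empty)

lemma cofibrant_simplex:
  fixes \<iota> :: "'k \<Rightarrow> 'u" and e :: "nat \<Rightarrow> 'u"
  assumes "linear_simplex K \<iota> \<kappa> e d"
  shows "cofibrant (dgCat TYPE('u) K) (simplex K \<iota> \<kappa> e d n)"
proof -
  interpret linear_simplex K \<iota> \<kappa> e d by fact
  let ?C = "simplex K \<iota> \<kappa> e d n"
  let ?i = "(\<lambda>_. undefined, \<lambda>_ _ _ _. undefined) :: ('u, 'u, 'u, 'u) gmap"
  have "cofibration (dgCat TYPE('u) K) empty_dgcat ?C ?i"
    unfolding cofibration_def
  proof (intro ballI impI)
    fix A B p u v
    assume "A \<in> Ob (dgCat TYPE('u) K)" "B \<in> Ob (dgCat TYPE('u) K)" "p \<in> Hom (dgCat TYPE('u) K) A B"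
      "trivial_fibration (dgCat TYPE('u) K) A B p" "u \<in> Hom (dgCat TYPE('u) K) empty_dgcat A"
      "v \<in> Hom (dgCat TYPE('u) K) ?C B"
    then have A: "is_dgcat K A" and B: "is_dgcat K B" and p: "p \<in> dg_functors K A B"
      and tf: "quasi_equivalence A B p" "dg_fibration A B p"
      and u: "u \<in> dg_functors K empty_dgcat A" and v: "v \<in> dg_functors K ?C B"
      by (simp_all add: trivial_fibration_def)
    note vg = dg_functorsD(1)[OF v]
    \<comment> \<open>By freeness the vertices, and then the generators, can be lifted independently
      of each other: there are no relations to respect.\<close>
    have "\<forall>i. \<exists>x. i \<le> n \<longrightarrow> x \<in> gob A \<and> fst p x = fst v (e i)"
      using trivial_fibration_lift_object[OF tf graph_mapsD(1)[OF vg]] by fastforce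
    then obtain ob where ob: "\<And>i. i \<le> n \<Longrightarrow> ob i \<in> gob A" "\<And>i. i \<le> n \<Longrightarrow> fst p (ob i) = fst v (e i)"
      by metis
    have "\<exists>a. a \<in> cocycles (ghom A (ob i) (ob (Suc i))) 0 \<and>
        snd p (ob i) (ob (Suc i)) 0 a = snd v (e i) (e (Suc i)) 0 (\<iota> \<one>\<^bsub>K\<^esub>)" if i: "i < n" for i
    proof -
      have *: "e i \<in> gob ?C" "e (Suc i) \<in> gob ?C" using i by auto
      have "snd v (e i) (e (Suc i)) 0 (\<iota> \<one>\<^bsub>K\<^esub>) \<in> cocycles (ghom B (fst v (e i)) (fst v (e (Suc i))))
        0"
        using i graph_mapsD(1)[OF vg *(1)] graph_mapsD(1)[OF vg *(2)] graph_mapsD(3)[OF vg *]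
        by (intro chain_map_cocycle[OF lin_cpx_complex[of True] dgcatD(1)[OF B]])
          (auto simp: lin_cpx_cocycles)
      then show ?thesis
        using trivial_fibration_lift_cocycle[OF A B p tf ob(1) ob(1), of i "Suc i"] ob(2) i by auto
    qed
    then obtain ar where ar: "\<And>i. i < n \<Longrightarrow> ar i \<in> cocycles (ghom A (ob i) (ob (Suc i))) 0"
      "\<And>i. i < n \<Longrightarrow> snd p (ob i) (ob (Suc i)) 0 (ar i) = snd v (e i) (e (Suc i)) 0 (\<iota> \<one>\<^bsub>K\<^esub>)"
      by metis
    let ?h = "simplex_functor A ob ar n"
    note h = simplex_functor_closed[where D = A and ob = ob and ar = ar and n = n, OF A ob(1) ar(1)]
      and h_fst = simplex_functor_fst[where D = A and ob = ob and ar = ar and n = n,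
        OF A ob(1) ar(1)]
      and h_gen = simplex_functor_gen[where D = A and ob = ob and ar = ar and n = n,
        OF A ob(1) ar(1)]
    have "gmap_comp ?C p ?h = v"
    proof (rule dg_functor_simplex_eqI[OF B dg_functor_comp[OF is_dgcat_simplex h p] v])
      show "fst (gmap_comp ?C p ?h) (e i) = fst v (e i)" if "i \<le> n" for i
        using that by (simp add: gmap_comp_fst h_fst ob(2))
      show "snd (gmap_comp ?C p ?h) (e i) (e (Suc i)) 0 (\<iota> \<one>\<^bsub>K\<^esub>) =
        snd v (e i) (e (Suc i)) 0 (\<iota> \<one>\<^bsub>K\<^esub>)"
        if "i < n" for i
        using that by (simp add: gmap_comp_apply h_fst
            h_gen ar(2))
    qed
    \<comment> \<open>Automatic: both sides are dg-functors out of the initial object.\<close>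
    moreover have "gmap_comp (empty_dgcat :: ('k, 'u, 'u) dgcat) ?h ?i = u"
      using u dg_functor_comp[OF is_dgcat_empty, of ?i K ?C ?h A] h by (simp add: dg_functors_empty)
    ultimately show "\<exists>h\<in>Hom (dgCat TYPE('u) K) ?C A. Cmp (dgCat TYPE('u) K) empty_dgcat ?C A h ?i =
      u \<and>
        Cmp (dgCat TYPE('u) K) ?C A B p h = v"
      using h by auto
  qed
  then show ?thesis
    unfolding cofibrant_def
    using initial_empty_dgcat is_dgcat_simplex by (auto simp: dg_functors_empty intro!: exI[of _
      empty_dgcat])
qed


section \<open>The linearisation of the simplex category\<close>

context linear_simplex
begin

text \<open>With equal encodings \<open>transport\<close> is an inclusion. It is needed because
  \<open>i \<le> k\<close> implies \<open>\<theta> i \<le> \<theta> k\<close> but not conversely, so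
  a zero Hom complex may be mapped into \<open>k\<close>.\<close>

interpretation T: linear_encoding_pair K \<iota> \<kappa> \<iota> \<kappa> ..

definition simplex_map :: "nat \<Rightarrow> (nat \<Rightarrow> nat) \<Rightarrow> ('a, 'b, 'a, 'b) gmap" where
  "simplex_map m \<theta> = (\<lambda>x\<in>e ` {..m}. e (\<theta> (d x)),
    \<lambda>x y. if x \<in> e ` {..m} \<and> y \<in> e ` {..m} then T.transport (d x \<le> d y) else (\<lambda>_ _. undefined))"

lemma simplex_map_fst: "i \<le> m \<Longrightarrow> fst (simplex_map m \<theta>) (e i) = e (\<theta> i)"
  by (simp add: simplex_map_def)

lemma simplex_map_snd: "i \<le> m \<Longrightarrow> k \<le> m \<Longrightarrow> snd (simplex_map m \<theta>) (e i) (e k) = T.transport (i \<le> k)"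
  by (simp add: simplex_map_def)

lemma transport_scalar: "r \<in> carrier K \<Longrightarrow> b \<and> p = 0 \<or> r = \<zero> \<Longrightarrow> T.transport b p (\<iota> r) = \<iota> r"
  by (auto simp: T.transport_apply)

lemma simplex_map_closed:
  assumes \<theta>: "\<theta> \<in> dmap m n"
  shows "simplex_map m \<theta> \<in> dg_functors K (sx m) (sx n)"
proof (rule dg_functorsI)
  show "simplex_map m \<theta> \<in> graph_maps K (sx m) (sx n)"
  proof (rule graph_mapsI)
    show "snd (simplex_map m \<theta>) x y \<in> chain_maps K (ghom (sx m) x y)
        (ghom (sx n) (fst (simplex_map m \<theta>) x) (fst (simplex_map m \<theta>) y))"
      if "x \<in> gob (sx m)" "y \<in> gob (sx m)" for x y
      using that dmap_mono[OF \<theta>]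
      by (auto simp: simplex_map_fst simplex_map_snd intro!: T.transport_closed)
  qed (auto simp: simplex_map_fst dmap_bound[OF \<theta>], auto simp: simplex_map_def)
  show "snd (simplex_map m \<theta>) x x 0 (did (sx m) x) = did (sx n) (fst (simplex_map m \<theta>) x)"
    if "x \<in> gob (sx m)" for x
    using that by (auto simp: simplex_map_snd transport_scalar)
  fix x y z g f q p
  assume "x \<in> gob (sx m)" "y \<in> gob (sx m)" "z \<in> gob (sx m)"
    and g: "g \<in> carrier (hm (sx m) y z q)" and f: "f \<in> carrier (hm (sx m) x y p)"
  then obtain i k l where x: "x = e i" "i \<le> m" and y: "y = e k" "k \<le> m" and z: "z = e l" "l \<le> m"
    by auto
  obtain s where s: "s \<in> carrier K" "g = \<iota> s" "k \<le> l \<and> q = 0 \<or> s = \<zero>"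
    using g y z by (auto elim: lin_cpx_cases)
  obtain r where r: "r \<in> carrier K" "f = \<iota> r" "i \<le> k \<and> p = 0 \<or> r = \<zero>"
    using f x y by (auto elim: lin_cpx_cases)
  have "T.transport (i \<le> l) (q + p) (\<iota> (s \<otimes> r)) = \<iota> (s \<otimes> r)"
    using s r by (intro transport_scalar) auto
  then show "snd (simplex_map m \<theta>) x z (q + p) (dcmp (sx m) x y z q p g f) =
      dcmp (sx n) (fst (simplex_map m \<theta>) x) (fst (simplex_map m \<theta>) y) (fst (simplex_map m \<theta>) z) q p
        (snd (simplex_map m \<theta>) y z q g) (snd (simplex_map m \<theta>) x y p f)"
    using x y z r s by (simp add: simplex_map_snd transport_scalar)
qed

lemma simplex_map_scalar:
  "x \<in> gob (sx m) \<Longrightarrow> y \<in> gob (sx m) \<Longrightarrow> v \<in> carrier (hm (sx m) x y p) \<Longrightarrow> snd (simplex_map m \<theta>) x y p v =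
    v"
  by (auto simp: simplex_map_snd transport_scalar elim!: lin_cpx_cases)

lemma simplex_map_id: "simplex_map n (\<lambda>i\<in>{..n}. i) = gmap_id (sx n)"
  by (rule graph_maps_ext[OF dg_functorsD(1)[OF simplex_map_closed[OF dmap_id]]
        dg_functorsD(1)[OF dg_functor_id[OF is_dgcat_simplex]]])
    (auto simp: gmap_id_fst gmap_id_snd simplex_map_fst simplex_map_scalar)

lemma simplex_map_compose:
  assumes \<phi>: "\<phi> \<in> dmap l m" and \<theta>: "\<theta> \<in> dmap m n"
  shows "simplex_map l (compose {..l} \<theta> \<phi>) = gmap_comp (sx l) (simplex_map m \<theta>) (simplex_map l \<phi>)"
proof (rule graph_maps_ext[OF dg_functorsD(1)[OF simplex_map_closed[OF dmap_compose[OF \<phi> \<theta>]]]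
        dg_functorsD(1)[OF dg_functor_comp[OF is_dgcat_simplex simplex_map_closed[OF \<phi>]
          simplex_map_closed[OF \<theta>]]]])
  show "fst (simplex_map l (compose {..l} \<theta> \<phi>)) x = fst (gmap_comp (sx l) (simplex_map m \<theta>)
    (simplex_map l \<phi>)) x"
    if "x \<in> gob (sx l)" for x
    using that dmap_bound[OF \<phi>] by (auto simp: gmap_comp_fst simplex_map_fst compose_def)
  fix x y p v
  assume x: "x \<in> gob (sx l)" and y: "y \<in> gob (sx l)" and v: "v \<in> carrier (hm (sx l) x y p)"
  note \<phi>g = dg_functorsD(1)[OF simplex_map_closed[OF \<phi>]]
  \<comment> \<open>\<open>v\<close> is still an element of the middle Hom complex, so the second
    map fixes it as well.\<close>
  have "v \<in> carrier (hm (sx m) (fst (simplex_map l \<phi>) x) (fst (simplex_map l \<phi>) y) p)"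
    using chain_mapsD(3)[OF graph_mapsD(3)[OF \<phi>g x y] v] simplex_map_scalar[OF x y v] by simp
  then show "snd (simplex_map l (compose {..l} \<theta> \<phi>)) x y p v =
      snd (gmap_comp (sx l) (simplex_map m \<theta>) (simplex_map l \<phi>)) x y p v"
    using gmap_comp_apply[OF x y v, of "simplex_map m \<theta>" "simplex_map l \<phi>"] simplex_map_scalar[OF x
      y v]
      simplex_map_scalar[OF graph_mapsD(1)[OF \<phi>g x] graph_mapsD(1)[OF \<phi>g y]] by metis
qed

definition simplex_dgfunctor :: "(nat, nat \<Rightarrow> nat, ('k, 'a, 'b) dgcat, ('a, 'b, 'a,
  'b) gmap) fctr" where
  "simplex_dgfunctor = \<lparr>FOb = sx, FAr = (\<lambda>m n \<theta>. simplex_map m \<theta>)\<rparr>"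

end

lemma Delta_simps [simp]:
  "Ob Delta = UNIV" "Hom Delta = dmap" "Cmp Delta l m n \<theta> \<phi> = compose {..l} \<theta> \<phi>"
  "Idn Delta n = (\<lambda>i\<in>{..n}. i)"
  by (simp_all add: Delta_def)

lemma is_functor_simplex:
  fixes \<iota> :: "'k \<Rightarrow> 'u" and e :: "nat \<Rightarrow> 'u"
  assumes "linear_simplex K \<iota> \<kappa> e d"
  shows "is_functor Delta (dgCat TYPE('u) K) (linear_simplex.simplex_dgfunctor K \<iota> \<kappa> e d)"
proof -
  interpret linear_simplex K \<iota> \<kappa> e d by fact
  show ?thesis
    unfolding is_functor_def
    by (auto simp: category_Delta category_dgCat simplex_dgfunctor_def is_dgcat_simplex
      simplex_map_closed
        simplex_map_id simplex_map_compose)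
qed

text \<open>A discrete simplicial category has the same arrows in every degree, so an arrow has to
  go to a constant hammock of each width.\<close>

definition (in relative_category) localised ::
    "('p, 'b, 'o, 'a) fctr \<Rightarrow> ('p, 'b, 'o, ('o, 'a) hammock) sfun" where
  "localised F = \<lparr>SFOb = FOb F, SFAr = (\<lambda>x y k f. cls k (FOb F x) (FOb F y) (arrow_step k (FOb F y)
    (FAr F x y f)))\<rparr>"

lemma (in relative_category) simplicial_functor_localised:
  assumes F: "is_functor D C F" and S: "S \<subseteq> Ob C" and FS: "\<And>x. x \<in> Ob D \<Longrightarrow> FOb F x \<in> S"
  shows "simplicial_functor (discrete D) (full_sub (hammock_localisation C W) S) (localised F)"
proof (rule simplicial_functorI)
  let ?H = "hammock_localisation C W"
  note FD = is_functorD[OF F]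
  have full [simp]: "SOb (full_sub ?H S) = S" "SHom (full_sub ?H S) = hammock_space C W"
    "SCmp (full_sub ?H S) = SCmp ?H" "SId (full_sub ?H S) x = cls 0 x x []" for x
    by (simp_all add: full_sub_def)
  have disc [simp]: "SOb (discrete D) = Ob D" "smp (SHom (discrete D) x y) n = Hom D x y"
    "sop (SHom (discrete D) x y) m n \<theta> f = f" "SCmp (discrete D) x y z n g f = Cmp D x y z g f"
    "SId (discrete D) = Idn D" for x y z m n \<theta> f g
    by (simp_all add: discrete_def)
  show "simplicial_category (discrete D)" by (rule simplicial_category_discrete[OF FD(1)])
  show "simplicial_category (full_sub ?H S)"
    by (rule simplicial_category_full_sub[OF simplicial_category_hammock]) (simp add: S)
  show "SFOb (localised F) x \<in> SOb (full_sub ?H S)" if "x \<in> SOb (discrete D)" for x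
    using that FS by (simp add: localised_def)
  show "SFAr (localised F) x x 0 (SId (discrete D) x) = SId (full_sub ?H S) (SFOb (localised F) x)"
    if "x \<in> SOb (discrete D)" for x
    using that FD by (simp add: localised_def arrow_Idn)
  show "SFAr (localised F) x y n f \<in> smp (SHom (full_sub ?H S) (SFOb (localised F) x) (SFOb
    (localised F) y)) n"
    if "x \<in> SOb (discrete D)" "y \<in> SOb (discrete D)" "f \<in> smp (SHom (discrete D) x y) n" for x y n f
  proof -
    have "zz n (FOb F x) (FOb F y) (arrow_step n (FOb F y) (FAr F x y f))"
      using that by (intro zz_arrow) (simp_all add: FD)
    then show ?thesis
      unfolding full hammock_simplex localised_def sfun.simps by blast
  qed
  show "SFAr (localised F) x y m (sop (SHom (discrete D) x y) m n \<theta> f) =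
      sop (SHom (full_sub ?H S) (SFOb (localised F) x) (SFOb (localised F) y)) m n \<theta> (SFAr
        (localised F) x y n f)"
    if "\<theta> \<in> dmap m n" for x y n f m \<theta>
    using that by (simp add: localised_def hammock_pull pull_arrow)
  show "SFAr (localised F) x z n (SCmp (discrete D) x y z n g f) =
      SCmp (full_sub ?H S) (SFOb (localised F) x) (SFOb (localised F) y) (SFOb (localised F) z) n
        (SFAr (localised F) y z n g) (SFAr (localised F) x y n f)"
    if "x \<in> SOb (discrete D)" "y \<in> SOb (discrete D)" "z \<in> SOb (discrete D)"
      "f \<in> smp (SHom (discrete D) x y) n" "g \<in> smp (SHom (discrete D) y z) n" for x y z n f g
    using that FD hammock_comp[OF zz_arrow zz_arrow, of "FOb F x" "FOb F y" "FAr F x y f" "FOb F z"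
      "FAr F y z g" n]
    by (simp add: localised_def arrow_Cmp)
qed

theorem linearisation_simplex:
  fixes \<iota> :: "'k \<Rightarrow> 'u" and e :: "nat \<Rightarrow> 'u"
  assumes "linear_simplex K \<iota> \<kappa> e d"
  shows "linearisation TYPE('u) K (relative_category.localised (dgCat TYPE('u) K) (weq (dgCat
    TYPE('u) K))
    (linear_simplex.simplex_dgfunctor K \<iota> \<kappa> e d))" (is "linearisation _ K ?j")
proof -
  let ?C = "dgCat TYPE('u) K"
  interpret linear_simplex K \<iota> \<kappa> e d by fact
  \<comment> \<open>Under the identity encodings \<open>chain_graph\<close> is
    \<open>Delta_graph\<close>, the graph that \<open>linearisation\<close> refers to.\<close>
  interpret N: linear_simplex K "\<lambda>r. r" "\<lambda>r. r" "\<lambda>i. i" "\<lambda>i. i" by unfold_locales simp_all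
  interpret P: linear_simplex_pair K \<iota> \<kappa> e d "\<lambda>r. r" "\<lambda>r. r" "\<lambda>i. i" "\<lambda>i. i" ..
  interpret R: relative_category ?C "weq ?C" by (rule relative_category_dgCat)
  have cL: "sx n \<in> cL TYPE('u) K" for n
    unfolding cL_def using is_dgcat_simplex cofibrant_simplex[OF assms] free_finite_type_simplex[OF
      assms] by blast
  have j: "SFOb ?j n = sx n" "SFAr ?j m n 0 \<theta> = localise ?C (weq ?C) (sx m) (sx n) (simplex_map m
    \<theta>)" for m n \<theta>
    unfolding R.localised_def simplex_dgfunctor_def localise_def R.arrow_step_def by simp_all
  have "simplicial_functor (discrete Delta) (cL_S TYPE('u) K) ?j"
    unfolding cL_S_def L_dgCat_def
    by (rule R.simplicial_functor_localised[OF is_functor_simplex[OF assms]])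
      (use cL in \<open>auto simp: cL_def simplex_dgfunctor_def\<close>)
  moreover have "free_on K (Delta_graph K n) (SFOb ?j n) (P.simplex_unit n)" for n
    unfolding Delta_graph_chain_graph j by (rule P.free_on_simplex)
  moreover have "induced_by K m \<theta> (sx n) (P.simplex_unit m) (P.simplex_unit n) (simplex_map m \<theta>)"
    if \<theta>: "\<theta> \<in> dmap m n" for m n \<theta>
  proof -
    \<comment> \<open>Generators of \<open>sx n\<close> are all \<open>\<iota> \<one>\<close>, hence
      so are paths; as \<open>simplex_map\<close> fixes scalars, this gives
      \<open>induced_by\<close>.\<close>
    have path: "path K (sx n) (P.simplex_unit n) i l = \<iota> \<one>\<^bsub>K\<^esub>" if "i + l \<le> n" for i l
      using that P.simplex_unit_gen by (induction l) simp_all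
    have "path K (sx n) (P.simplex_unit n) (\<theta> i) (\<theta> (Suc i) - \<theta> i) = \<iota> \<one>\<^bsub>K\<^esub>" if "i < m" for i
      using path[of "\<theta> i" "\<theta> (Suc i) - \<theta> i"] dmap_mono[OF \<theta>, of i "Suc i"] dmap_bound[OF \<theta>,
        of "Suc i"] that by simp
    then show ?thesis
      unfolding induced_by_def using dmap_bound[OF \<theta>] P.simplex_unit_gen[of _ m]
      by (simp add: P.simplex_unit_fst simplex_map_fst simplex_map_scalar)
  qed
  ultimately show ?thesis
    unfolding linearisation_def j
    by (intro conjI exI[of _ P.simplex_unit] allI ballI bexI[OF _ simplex_map_closed]) auto
qed

theorem proposition1p3:
  fixes K :: "'k ring"
  assumes "cring K"
    and "infinite (UNIV :: 'u set)" and "\<exists>\<iota> :: 'k \<Rightarrow> 'u. inj_on \<iota> (carrier K)"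
    and "small_scat TYPE('v) (cL_S TYPE('u) K)"
  shows "\<exists>j j_shriek. linearisation TYPE('u) K j \<and>
    quillen_adjunction
      (presheaves TYPE('v) (discrete Delta))
      (presheaves TYPE('v) (cL_S TYPE('u) K))
      j_shriek
      (restriction (discrete Delta) j)"
proof -
  obtain \<iota> :: "'k \<Rightarrow> 'u" where \<iota>: "inj_on \<iota> (carrier K)" using assms(3) by blast
  \<comment> \<open>The universe \<open>'u\<close> has to hold the vertices of all simplices, next
    to the scalars encoded by \<open>\<iota>\<close>.\<close>
  obtain e :: "nat \<Rightarrow> 'u" where e: "inj e"
    using infinite_countable_subset[OF assms(2)] by blast
  interpret cring K by fact
  have "linear_simplex K \<iota> (inv_into (carrier K) \<iota>) e (inv_into UNIV e)"
    by unfold_locales (simp_all add: \<iota> e)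
  from linearisation_simplex[OF this]
  obtain j where j: "linearisation TYPE('u) K j" by blast
  \<comment> \<open>The objects of \<open>Delta\<close> are the natural numbers; they have codes in
    \<open>'v\<close> because \<open>small_scat\<close> makes it infinite.\<close>
  obtain \<nu> :: "nat \<Rightarrow> 'v" where \<nu>: "inj \<nu>"
    using infinite_countable_subset assms(4) unfolding small_scat_def by blast
  have "\<exists>j_shriek. quillen_adjunction (presheaves TYPE('v) (discrete Delta))
      (presheaves TYPE('v) (cL_S TYPE('u) K)) j_shriek (restriction (discrete Delta) j)"
    by (rule quillen_adjunction_restriction[OF _ assms(4) inj_on_subset[OF \<nu> subset_UNIV]])
      (use j in \<open>simp add: linearisation_def\<close>)
  then show ?thesis using j by blast
qed

end
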